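(* Let $\nu$ be a place of $\mathbb{Q}$ (a prime $p$, or the real place $r$), let $g$ be a smooth compactly supported function on $(0,\infty)$, and let $0<c<1$. Then for every $y\in\mathbb{Q}_\nu$, $y\neq 0$, $$W_\nu(g;y) = -\log(|y|_\nu)\,g_\nu(y) + \mathcal{F}\left(-\log(|x|_\nu)\cdot\mathcal{F}^{-1}(g_\nu)(x)\right)(y) = -\log(|y|_\nu)\,g_\nu(y) + (G_\nu * g_\nu)(y).$$ In particular, taking $y=1$, $W_\nu(g) = W_\nu(g;1) = (G_\nu*g_\nu)(1)$.
   Context: Notation. $\mathbb{Q}_\nu$ is the completion of $\mathbb{Q}$ at $\nu$, with $\mathbb{Q}_r=\mathbb{R}$, and $|\cdot|_\nu$ is the usual normalized absolute value ($|p|_p=1/p$). $g_\nu$ is the function $y\mapsto g(|y|_\nu)$ on $\mathbb{Q}_\nu$ (with value $0$ at $y=0$). $\widehat g(s)=\int_0^\infty g(u)u^s\,\frac{du}{u}$ is the Mellin transform. $\mathcal{F}$ is the Fourier transform on $\mathbb{Q}_\nu$ with respect to the standard additive character ($e^{2\pi i x}$ on $\mathbb{R}$ up to sign; a character trivial on $\mathbb{Z}_p$ and on no larger fractional ideal for $\nu=p$) and the self-dual Haar measure (Lebesgue measure on $\mathbb{R}$, $\mathrm{vol}(\mathbb{Z}_p)=1$ on $\mathbb{Q}_p$). $G_\nu$ is the Fourier transform, in the sense of (tempered) distributions, of the locally integrable function $x\mapsto -\log(|x|_\nu)$ on $\mathbb{Q}_\nu$, and $*$ is additive convolution on $\mathbb{Q}_\nu$.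 Local Euler factors: $L_p(s)=\frac{1}{1-p^{-s}}$, $L_r(s)=\pi^{-s/2}\Gamma(s/2)$. Gamma functions: $\Gamma_\nu(s)=L_\nu(s)/L_\nu(1-s)$, that is $\Gamma_p(s)=\frac{1-p^{-1+s}}{1-p^{-s}}$ and $\Gamma_r(s)=\pi^{\frac12-s}\frac{\Gamma(s/2)}{\Gamma((1-s)/2)}$. Put $\Lambda_\nu(s)=-\frac{\Gamma_\nu'(s)}{\Gamma_\nu(s)}$. Definitions: for $y\ne 0$, $$W_\nu(g;y)=\frac{1}{2\pi i}\int_{\mathrm{Re}(s)=c}\Lambda_\nu(s)\,\widehat g(s)\,|y|_\nu^{-s}\,ds ,$$ and $$W_\nu(g)=\frac{1}{2\pi i}\int_{\mathrm{Re}(s)=3/2}-\frac{L_\nu'(s)}{L_\nu(s)}\left(\widehat g(s)+\widehat g(1-s)\right)ds .$$ *)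

theory Defs
  imports "HOL-Analysis.Analysis" "HOL-Computational_Algebra.Computational_Algebra"
begin

subsection \<open>The completions of the rationals\<close>

datatype place = Prime_Place nat | Real_Place

definition padic_abs :: "nat \<Rightarrow> rat \<Rightarrow> real" where
  "padic_abs p q = (if q = 0 then 0 else
     (case quotient_of q of (a, b) \<Rightarrow>
        real p powi (int (multiplicity (int p) b) - int (multiplicity (int p) a))))"

text \<open>
  The absolute value is the distance to zero: the library reserves \<open>norm\<close> for real vector
  spaces, and a p-adic field is none. On the type \<open>real\<close> this is the usual absolute value.
\<close>

definition absv :: "'a::{zero, metric_space} \<Rightarrow> real" where
  "absv x = dist x 0"

text \<open>
  The following says that \<open>'a\<close> is a completion of the rationals for the normalized p-adic absolute
  value (completeness comes from the sort), which determines it up to a unique isometric isomorphism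
  of fields. The real place is represented by the type \<open>real\<close>.
\<close>

definition is_padic_completion :: "nat \<Rightarrow> 'a::{field_char_0, complete_space} itself \<Rightarrow> bool" where
  "is_padic_completion p _ \<longleftrightarrow>
     (\<forall>x y :: 'a. dist x y = absv (x - y)) \<and>
     (\<forall>x y :: 'a. absv (x * y) = absv x * absv y) \<and>
     (\<forall>q. absv (of_rat q :: 'a) = padic_abs p q) \<and>
     closure (range of_rat) = (UNIV :: 'a set)"

definition integer_ring :: "'a::{zero, metric_space} set" where
  "integer_ring = {x. absv x \<le> 1}"


subsection \<open>Haar measure and additive characters\<close>

definition is_normalized_haar :: "'a::{monoid_add, metric_space} measure \<Rightarrow> bool" where
  "is_normalized_haar \<mu> \<longleftrightarrow>
     sets \<mu> = sets borel \<and>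
     (\<forall>a. distr \<mu> borel (\<lambda>x. a + x) = \<mu>) \<and>
     emeasure \<mu> integer_ring = 1"

definition is_additive_character :: "('a::{topological_space, plus} \<Rightarrow> complex) \<Rightarrow> bool" where
  "is_additive_character \<psi> \<longleftrightarrow>
     continuous_on UNIV \<psi> \<and>
     (\<forall>x. norm (\<psi> x) = 1) \<and>
     (\<forall>x y. \<psi> (x + y) = \<psi> x * \<psi> y)"

text \<open>The fractional ideals are the sets \<open>a * integer_ring\<close> with \<open>a \<noteq> 0\<close>.\<close>

definition is_standard_padic_character ::
    "('a::{semiring_0, metric_space} \<Rightarrow> complex) \<Rightarrow> bool" where
  "is_standard_padic_character \<psi> \<longleftrightarrow>
     is_additive_character \<psi> \<and>
     (\<forall>x \<in> integer_ring. \<psi> x = 1) \<and>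
     (\<forall>a. integer_ring \<subset> (\<lambda>x. a * x) ` integer_ring \<longrightarrow>
        \<not> (\<forall>x \<in> (\<lambda>x. a * x) ` integer_ring. \<psi> x = 1))"

definition is_standard_real_character :: "(real \<Rightarrow> complex) \<Rightarrow> bool" where
  "is_standard_real_character \<psi> \<longleftrightarrow>
     \<psi> = (\<lambda>x. exp (2 * of_real pi * \<i> * of_real x)) \<or>
     \<psi> = (\<lambda>x. exp (- (2 * of_real pi * \<i> * of_real x)))"


subsection \<open>Fourier transform of functions and of distributions\<close>

definition fourier ::
    "'a measure \<Rightarrow> ('a::times \<Rightarrow> complex) \<Rightarrow> ('a \<Rightarrow> complex) \<Rightarrow> 'a \<Rightarrow> complex" where
  "fourier \<mu> \<psi> f y = (LINT x|\<mu>. f x * \<psi> (x * y))"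

definition inverse_fourier ::
    "'a measure \<Rightarrow> ('a::{times, uminus} \<Rightarrow> complex) \<Rightarrow> ('a \<Rightarrow> complex) \<Rightarrow> 'a \<Rightarrow> complex" where
  "inverse_fourier \<mu> \<psi> f x = (LINT y|\<mu>. f y * \<psi> (- (x * y)))"

text \<open>
  A distribution is represented by its pairing with functions, which is meaningful on test
  functions (Schwartz functions on the reals, locally constant compactly supported functions in
  the p-adic case). Its Fourier transform is defined by transposition.
\<close>

type_synonym 'a distribution = "('a \<Rightarrow> complex) \<Rightarrow> complex"

definition distribution_of :: "'a measure \<Rightarrow> ('a \<Rightarrow> complex) \<Rightarrow> 'a distribution" where
  "distribution_of \<mu> f = (\<lambda>\<phi>. LINT x|\<mu>. f x * \<phi> x)"

definition distribution_fourier ::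
    "'a measure \<Rightarrow> ('a::times \<Rightarrow> complex) \<Rightarrow> 'a distribution \<Rightarrow> 'a distribution" where
  "distribution_fourier \<mu> \<psi> T = (\<lambda>\<phi>. T (fourier \<mu> \<psi> \<phi>))"

definition distribution_conv ::
    "'a::minus distribution \<Rightarrow> ('a \<Rightarrow> complex) \<Rightarrow> 'a \<Rightarrow> complex" where
  "distribution_conv T \<phi> y = T (\<lambda>x. \<phi> (y - x))"

definition minus_log_abs :: "'a::{zero, metric_space} \<Rightarrow> complex" where
  "minus_log_abs x = of_real (- ln (absv x))"

definition G_dist ::
    "'a measure \<Rightarrow> ('a::{times, zero, metric_space} \<Rightarrow> complex) \<Rightarrow> 'a distribution" where
  "G_dist \<mu> \<psi> = distribution_fourier \<mu> \<psi> (distribution_of \<mu> minus_log_abs)"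


subsection \<open>Test functions on the positive half-line\<close>

definition smooth_on :: "real set \<Rightarrow> (real \<Rightarrow> complex) \<Rightarrow> bool" where
  "smooth_on S g \<longleftrightarrow>
     (\<exists>D :: nat \<Rightarrow> real \<Rightarrow> complex. D 0 = g \<and>
        (\<forall>n. \<forall>u\<in>S. (D n has_vector_derivative D (Suc n) u) (at u)))"

text \<open>Only the values on the positive half-line matter.\<close>

definition is_test_function :: "(real \<Rightarrow> complex) \<Rightarrow> bool" where
  "is_test_function g \<longleftrightarrow>
     smooth_on {0<..} g \<and>
     (\<exists>K. compact K \<and> K \<subseteq> {0<..} \<and> (\<forall>u\<in>{0<..} - K. g u = 0))"

definition lift_abs :: "(real \<Rightarrow> complex) \<Rightarrow> 'a::{zero, metric_space} \<Rightarrow> complex" where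
  "lift_abs g y = (if y = 0 then 0 else g (absv y))"

definition mellin :: "(real \<Rightarrow> complex) \<Rightarrow> complex \<Rightarrow> complex" where
  "mellin g s = (LINT u:{0<..}|lborel. g u * of_real u powr s / of_real u)"


subsection \<open>Local factors and the explicit formula terms\<close>

fun L_local :: "place \<Rightarrow> complex \<Rightarrow> complex" where
  "L_local (Prime_Place p) s = 1 / (1 - of_nat p powr (- s))"
| "L_local Real_Place s = of_real pi powr (- s / 2) * Gamma (s / 2)"

definition Gamma_local :: "place \<Rightarrow> complex \<Rightarrow> complex" where
  "Gamma_local \<nu> s = L_local \<nu> s / L_local \<nu> (1 - s)"

definition Lambda_local :: "place \<Rightarrow> complex \<Rightarrow> complex" where
  "Lambda_local \<nu> s = - deriv (Gamma_local \<nu>) s / Gamma_local \<nu> s"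

text \<open>\<open>vertical_integral c F\<close> is the integral of \<open>F(s) ds\<close> over \<open>Re s = c\<close>, upwards.\<close>

definition vertical_integral :: "real \<Rightarrow> (complex \<Rightarrow> complex) \<Rightarrow> complex" where
  "vertical_integral c F = (LINT t|lborel. F (Complex c t) * \<i>)"

definition W_at ::
    "place \<Rightarrow> real \<Rightarrow> (real \<Rightarrow> complex) \<Rightarrow> 'a::{zero, metric_space} \<Rightarrow> complex" where
  "W_at \<nu> c g y =
     1 / (2 * of_real pi * \<i>) *
     vertical_integral c (\<lambda>s. Lambda_local \<nu> s * mellin g s * of_real (absv y) powr (- s))"

definition W_local :: "place \<Rightarrow> (real \<Rightarrow> complex) \<Rightarrow> complex" where
  "W_local \<nu> g =
     1 / (2 * of_real pi * \<i>) *
     vertical_integral (3 / 2)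
       (\<lambda>s. - deriv (L_local \<nu>) s / L_local \<nu> s * (mellin g s + mellin g (1 - s)))"

end

theory Submission
  imports Defs "HOL-Probability.Probability" "HOL-Complex_Analysis.Complex_Analysis" "HOL-Number_Theory.Cong"
begin

text \<open>
  Mellin inversion on any vertical line follows from Gaussian summability, because a test function
  becomes smooth with compact support in the logarithmic variable.

  At a prime, \<open>\<Lambda>\<close> is a sum of two geometric series in \<open>p powr (- s)\<close> and \<open>p powr (s - 1)\<close>, so Mellin
  inversion turns \<open>W\<close> into a finite combination of values of \<open>g\<close> at \<open>\<bar>y\<bar> * p powi k\<close>. On the other side
  \<open>g\<close> is a finite combination of indicators of balls, whose Fourier transforms are known by
  orthogonality of characters, and \<open>- log \<bar>x\<bar>\<close> on a ball counts the smaller balls around 0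
  containing \<open>x\<close>. The two finite sums agree term by term.

  At the real place, let \<open>\<Phi>\<close> be the inverse Fourier transform of \<open>g\<close>. For small \<open>w > 0\<close> the Fourier transform of
  \<open>\<bar>x\<bar> powr (- w) * \<Phi>\<close> is a Riesz potential of \<open>g\<close>, and by the Beta integral its Mellin symbol is \<open>\<Gamma> (1 - s) * \<Gamma> (s - w)\<close>
  for the local Gamma function. The derivative at \<open>w = 0\<close> is the theorem. The limit may be taken under the integral
  because the symbol is bounded along vertical lines, being the Mellin transform of a positive kernel,
  and \<open>\<Lambda>\<close> grows at most linearly.
  Finally the line of integration of \<open>W(g)\<close> is moved into the critical strip, where the two halves of its integrand
  combine to \<open>\<Lambda>\<close> by \<open>s \<mapsto> 1 - s\<close>.
\<close>

section \<open>Fourier and Mellin inversion\<close>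

text \<open>At the real place the Fourier transform of \<open>- ln |x|\<close> is not a locally
  integrable function, so it cannot be convolved with \<open>g\<close> as it stands. For
  \<open>0 < w < 1\<close> the transform of \<open>|x| powr (- w)\<close> is a multiple of
  \<open>|x| powr (w - 1)\<close>, which is one. That kernel has a Mellin symbol with a pole at
  \<open>w = 0\<close>, but the constant of proportionality cancels it exactly, so the derivative at
  \<open>w = 0\<close> makes sense. Growth and decay are matched by hand: \<Lambda> is bounded
  linearly from the Digamma series, so three derivatives of the test function are used, which leaves
  an integrable \<open>1 / (1 + t\<^sup>2)\<close>. The convolution form needs no analysis of its
  own: \<open>g\<close> lifted to the field is even, so \<open>u \<mapsto> g (y - u)\<close> has as
  transform the character at \<open>x * y\<close> times the inverse transform of \<open>g\<close>.
  The p-adic field is given only by axioms; the ultrametric inequality, the value group, the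
  residues and the measures of balls are derived from density of the rationals and translation
  invariance. At a prime the integral for \<open>W(g)\<close> is evaluated without moving any line;
  only the real place requires that.\<close>

lemma integrable_compact_support:
  fixes f :: "real \<Rightarrow> 'b::{banach, second_countable_topology}"
  assumes "continuous_on UNIV f" "\<And>v. R \<le> \<bar>v\<bar> \<Longrightarrow> f v = 0"
  shows "integrable lborel f"
proof -
  have "integrable lborel (\<lambda>x. indicator {-R..R} x *\<^sub>R f x)"
    by (intro borel_integrable_compact) (auto intro: continuous_on_subset[OF assms(1)])
  also have "(\<lambda>x. indicator {-R..R} x *\<^sub>R f x) = f"
    using assms(2) by (force simp: indicator_def)
  finally show ?thesis .
qed

lemma bounded_compact_support:
  fixes f :: "real \<Rightarrow> 'b::real_normed_vector"
  assumes "continuous_on UNIV f" "\<And>v. R \<le> \<bar>v\<bar> \<Longrightarrow> f v = 0"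
  obtains B where "0 \<le> B" "\<And>v. norm (f v) \<le> B"
proof -
  have "compact (f ` {-R..R})"
    by (intro compact_continuous_image continuous_on_subset[OF assms(1)]) auto
  then obtain B where B: "\<forall>x\<in>f ` {-R..R}. norm x \<le> B"
    using compact_imp_bounded bounded_iff by blast
  have "norm (f v) \<le> max B 0" for v
  proof (cases "v \<in> {-R..R}")
    case True
    then show ?thesis using B by (force simp: le_max_iff_disj)
  next
    case False
    then show ?thesis using assms(2)[of v] by force
  qed
  then show ?thesis using that[of "max B 0"] by auto
qed

text \<open>Domination by a product of one-variable functions is how several later interchanges of
  integrals are justified.\<close>

lemma integrable_pair_bound:
  fixes f :: "real \<times> real \<Rightarrow> 'b::{banach, second_countable_topology}"
  assumes f: "f \<in> borel_measurable (lborel \<Otimes>\<^sub>M lborel)"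
    and u: "integrable lborel (u :: real \<Rightarrow> real)" and w: "integrable lborel (w :: real \<Rightarrow> real)"
    and b: "\<And>x y. norm (f (x, y)) \<le> u x * w y"
  shows "integrable (lborel \<Otimes>\<^sub>M lborel) f"
proof -
  note [measurable] = f borel_measurable_integrable[OF u] borel_measurable_integrable[OF w]
  have "integrable (lborel \<Otimes>\<^sub>M lborel) (\<lambda>p. u (fst p) * w (snd p))"
  proof (rule lborel_pair.Fubini_integrable)
    show "integrable lborel (\<lambda>x. LINT y|lborel. norm (u (fst (x, y)) * w (snd (x, y))))"
      using u w by (simp add: abs_mult)
    show "AE x in lborel. integrable lborel (\<lambda>y. u (fst (x, y)) * w (snd (x, y)))"
      using w by simp
  qed measurable
  then show ?thesis
    by (rule Bochner_Integration.integrable_bound)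
       (use b order_trans[OF b abs_ge_self] in \<open>auto intro!: AE_I2 simp: split_beta\<close>)
qed

text \<open>The characteristic function of the standard normal law, rescaled by
  \<open>c = sqrt (2 * a)\<close> so that its exponent \<open>x\<^sup>2 / 2\<close> becomes
  \<open>a * x\<^sup>2\<close>.\<close>

lemma gaussian_fourier:
  fixes a \<xi> :: real
  assumes "0 < a"
  shows "(LINT x|lborel. of_real (exp (- (a * x\<^sup>2))) * exp (\<i> * of_real (x * \<xi>)))
           = of_real (sqrt (pi / a) * exp (- (\<xi>\<^sup>2 / (4 * a))))" (is "?L = _")
    and "integrable lborel (\<lambda>x. exp (- (a * x\<^sup>2)))"
proof -
  define c where "c = sqrt (2 * a)"
  have c: "c > 0" "c\<^sup>2 = 2 * a" using assms by (auto simp: c_def)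
  define t where "t = \<xi> / c"
  have "complex_of_real (exp (- (t^2) / 2)) = char std_normal_distribution t"
    by (simp add: char_std_normal_distribution)
  also have "\<dots> = (LINT x|lborel. std_normal_density x *\<^sub>R iexp (t * x))"
    unfolding char_def by (subst integral_density) auto
  also have "\<dots> = c *\<^sub>R (LINT x|lborel. std_normal_density (0 + c * x) *\<^sub>R iexp (t * (0 + c * x)))"
    using c by (subst lborel_integral_real_affine[where c = c and t = 0]) auto
  also have "(\<lambda>x. std_normal_density (0 + c * x) *\<^sub>R iexp (t * (0 + c * x))) =
     (\<lambda>x. complex_of_real (1 / sqrt (2 * pi)) * (of_real (exp (- (a * x\<^sup>2))) * exp (\<i> * of_real (x * \<xi>))))"
    using c by (auto simp: std_normal_density_def t_def power_mult_distrib scaleR_conv_of_real field_simps)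
  also have "c *\<^sub>R (LINT x|lborel. complex_of_real (1 / sqrt (2 * pi)) * (of_real (exp (- (a * x\<^sup>2))) * exp (\<i> * of_real (x * \<xi>))))
     = complex_of_real (c / sqrt (2 * pi)) * ?L"
    by (subst integral_mult_right_zero) (simp add: scaleR_conv_of_real)
  finally have "?L = of_real (sqrt (2 * pi) / c * exp (- (t^2) / 2))"
    using c by (simp add: field_simps)
  also have "sqrt (2 * pi) / c = sqrt (pi / a)"
    using assms by (simp add: c_def real_sqrt_divide real_sqrt_mult)
  also have "- (t^2) / 2 = - (\<xi>\<^sup>2 / (4 * a))"
    using c by (simp add: t_def power_divide)
  finally show "?L = of_real (sqrt (pi / a) * exp (- (\<xi>\<^sup>2 / (4 * a))))" .
  have "integrable lborel (\<lambda>x. std_normal_density (0 + c * x))"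
    using c integrable_normal_moment[of 1 0 0] by (intro lborel_integrable_real_affine) auto
  then have "integrable lborel (\<lambda>x. sqrt (2 * pi) * std_normal_density (0 + c * x))"
    by simp
  also have "(\<lambda>x. sqrt (2 * pi) * std_normal_density (0 + c * x)) = (\<lambda>x. exp (- (a * x\<^sup>2)))"
    using c by (auto simp: std_normal_density_def power_mult_distrib)
  finally show "integrable lborel (\<lambda>x. exp (- (a * x\<^sup>2)))" .
qed

lemma gaussian_integral:
  assumes "0 < a"
  shows "(LINT x|lborel. exp (- (a * x\<^sup>2))) = sqrt (pi / a)"
proof -
  have "complex_of_real (LINT x|lborel. exp (- (a * x\<^sup>2))) = of_real (sqrt (pi / a))"
    using gaussian_fourier(1)[OF assms, of 0] by (simp add: integral_complex_of_real)
  then show ?thesis by (simp only: of_real_eq_iff)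
qed

text \<open>A Gaussian factor \<open>exp (- (a n * \<tau>\<^sup>2))\<close> makes the double
  integral absolutely convergent, and Fubini then exhibits the left side as an average of
  \<open>h\<close> around \<open>x\<close>. Letting \<open>a n\<close> tend to 0 uses the
  integrability of \<open>H\<close> on one side, the boundedness and continuity of \<open>h\<close>
  on the other.\<close>

lemma fourier_inversion_compact_support:
  fixes h :: "real \<Rightarrow> complex"
  assumes cont: "continuous_on UNIV h" and supp: "\<And>v. R \<le> \<bar>v\<bar> \<Longrightarrow> h v = 0"
    and H: "\<And>\<tau>. H \<tau> = (LINT v|lborel. h v * exp (\<i> * of_real (\<tau> * v)))"
    and int: "integrable lborel H"
  shows "(LINT \<tau>|lborel. H \<tau> * exp (- (\<i> * of_real (\<tau> * x)))) = 2 * of_real pi * h x"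
proof -
  obtain B where B: "\<And>v. norm (h v) \<le> B" "0 \<le> B"
    using bounded_compact_support[OF cont supp] by metis
  have inth: "integrable lborel h" by (rule integrable_compact_support[OF cont supp])
  note [measurable] = borel_measurable_integrable[OF inth] borel_measurable_integrable[OF int]
  define a where "a n = 1 / (real n + 1)" for n :: nat
  have a: "a n > 0" for n by (simp add: a_def)
  have a0: "a \<longlonglongrightarrow> 0" unfolding a_def using LIMSEQ_inverse_real_of_nat by (simp add: inverse_eq_divide add.commute)
  define I where "I n = (LINT \<tau>|lborel. H \<tau> * exp (- (\<i> * of_real (\<tau> * x))) * of_real (exp (- (a n * \<tau>\<^sup>2))))" for n
  have L1: "I \<longlonglongrightarrow> (LINT \<tau>|lborel. H \<tau> * exp (- (\<i> * of_real (\<tau> * x))))"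
    unfolding I_def
  proof (rule integral_dominated_convergence[where w = "\<lambda>\<tau>. norm (H \<tau>)"])
    show "AE \<tau> in lborel. (\<lambda>n. H \<tau> * exp (- (\<i> * of_real (\<tau> * x))) * of_real (exp (- (a n * \<tau>\<^sup>2))))
            \<longlonglongrightarrow> H \<tau> * exp (- (\<i> * of_real (\<tau> * x)))"
    proof (rule AE_I2)
      fix \<tau>
      have "(\<lambda>n. H \<tau> * exp (- (\<i> * of_real (\<tau> * x))) * of_real (exp (- (a n * \<tau>\<^sup>2))))
            \<longlonglongrightarrow> H \<tau> * exp (- (\<i> * of_real (\<tau> * x))) * of_real (exp (- (0 * \<tau>\<^sup>2)))"
        by (intro tendsto_intros a0)
      then show "(\<lambda>n. H \<tau> * exp (- (\<i> * of_real (\<tau> * x))) * of_real (exp (- (a n * \<tau>\<^sup>2))))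
            \<longlonglongrightarrow> H \<tau> * exp (- (\<i> * of_real (\<tau> * x)))" by simp
    qed
    show "AE \<tau> in lborel. norm (H \<tau> * exp (- (\<i> * of_real (\<tau> * x))) * of_real (exp (- (a n * \<tau>\<^sup>2)))) \<le> norm (H \<tau>)" for n
      using a[of n] by (intro AE_I2) (auto simp: norm_mult intro!: mult_left_le)
  qed (use int in auto)
  \<comment> \<open>After Fubini the inner integral is a Gaussian centred at \<open>x\<close> of
    width comparable to \<open>sqrt (a n)\<close>; the substitution
    \<open>v = x + 2 * sqrt (a n) * z\<close> moves all dependence on \<open>n\<close> into the
    argument of \<open>h\<close>.\<close>
  have L2: "I n = 2 * of_real (sqrt pi) * (LINT z|lborel. h (x + 2 * sqrt (a n) * z) * of_real (exp (- z\<^sup>2)))" for n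
  proof -
    have "I n = (LINT \<tau>|lborel. (LINT v|lborel. h v * (of_real (exp (- (a n * \<tau>\<^sup>2))) * exp (\<i> * of_real (\<tau> * (v - x))))))"
      unfolding I_def H
      by (intro Bochner_Integration.integral_cong refl, subst mult.assoc, subst integral_mult_left_zero[symmetric])
         (auto intro!: Bochner_Integration.integral_cong simp: exp_diff exp_minus field_simps right_diff_distrib)
    also have "\<dots> = (LINT v|lborel. (LINT \<tau>|lborel. h v * (of_real (exp (- (a n * \<tau>\<^sup>2))) * exp (\<i> * of_real (\<tau> * (v - x))))))"
      by (rule lborel_pair.Fubini_integral, rule integrable_pair_bound[where u = "\<lambda>v. norm (h v)" and w = "\<lambda>\<tau>. exp (- (a n * \<tau>\<^sup>2))"])
         (auto simp: norm_mult inth gaussian_fourier(2)[OF a] split_beta intro!: integrable_norm)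
    also have "\<dots> = (LINT v|lborel. h v * of_real (sqrt (pi / a n) * exp (- ((v - x)\<^sup>2 / (4 * a n)))))"
      by (simp add: gaussian_fourier(1)[OF a] del: of_real_mult of_real_diff)
    also have "\<dots> = (2 * sqrt (a n)) *\<^sub>R (LINT z|lborel. h (x + 2 * sqrt (a n) * z) * of_real (sqrt (pi / a n) * exp (- ((x + 2 * sqrt (a n) * z - x)\<^sup>2 / (4 * a n)))))"
      using a[of n] by (subst lborel_integral_real_affine[where c = "2 * sqrt (a n)" and t = x]) auto
    also have "(\<lambda>z. h (x + 2 * sqrt (a n) * z) * of_real (sqrt (pi / a n) * exp (- ((x + 2 * sqrt (a n) * z - x)\<^sup>2 / (4 * a n)))))
        = (\<lambda>z. of_real (sqrt (pi / a n)) * (h (x + 2 * sqrt (a n) * z) * of_real (exp (- z\<^sup>2))))"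
      using a[of n] by (auto simp: power_mult_distrib)
    also have "(2 * sqrt (a n)) *\<^sub>R (LINT z|lborel. of_real (sqrt (pi / a n)) * (h (x + 2 * sqrt (a n) * z) * of_real (exp (- z\<^sup>2))))
       = of_real (2 * sqrt (a n) * sqrt (pi / a n)) * (LINT z|lborel. h (x + 2 * sqrt (a n) * z) * of_real (exp (- z\<^sup>2)))"
      by (subst integral_mult_right_zero) (simp add: scaleR_conv_of_real)
    also have "2 * sqrt (a n) * sqrt (pi / a n) = 2 * sqrt pi"
      using a[of n] by (simp add: real_sqrt_divide)
    finally show ?thesis by simp
  qed
  have L3: "(\<lambda>n. 2 * of_real (sqrt pi) * (LINT z|lborel. h (x + 2 * sqrt (a n) * z) * of_real (exp (- z\<^sup>2))))
     \<longlonglongrightarrow> 2 * of_real (sqrt pi) * (LINT z|lborel. h x * of_real (exp (- z\<^sup>2)))"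
  proof (intro tendsto_mult tendsto_const, rule integral_dominated_convergence[where w = "\<lambda>z. B * exp (- z\<^sup>2)"])
    show "AE z in lborel. (\<lambda>n. h (x + 2 * sqrt (a n) * z) * of_real (exp (- z\<^sup>2))) \<longlonglongrightarrow> h x * of_real (exp (- z\<^sup>2))"
    proof (intro AE_I2 tendsto_mult tendsto_const)
      fix z
      have "isCont h x" using cont by (simp add: continuous_on_eq_continuous_at)
      moreover have "(\<lambda>n. x + 2 * sqrt (a n) * z) \<longlonglongrightarrow> x + 2 * sqrt 0 * z"
        by (intro tendsto_intros a0)
      ultimately show "(\<lambda>n. h (x + 2 * sqrt (a n) * z)) \<longlonglongrightarrow> h x"
        by (intro isCont_tendsto_compose[of x h]) simp_all
    qed
    show "AE z in lborel. norm (h (x + 2 * sqrt (a n) * z) * of_real (exp (- z\<^sup>2))) \<le> B * exp (- z\<^sup>2)" for n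
      using B by (intro AE_I2) (simp add: norm_mult)
    show "integrable lborel (\<lambda>z. B * exp (- z\<^sup>2))"
      using gaussian_fourier(2)[of 1] by simp
  qed auto
  have "(LINT \<tau>|lborel. H \<tau> * exp (- (\<i> * of_real (\<tau> * x)))) = 2 * of_real (sqrt pi) * (LINT z|lborel. h x * of_real (exp (- z\<^sup>2)))"
    by (rule LIMSEQ_unique[OF L1 L3[folded L2]])
  also have "(LINT z|lborel. h x * of_real (exp (- z\<^sup>2))) = h x * of_real (sqrt pi)"
    using gaussian_integral[of 1] by (subst integral_mult_right_zero) (simp add: integral_complex_of_real)
  also have "2 * complex_of_real (sqrt pi) * (h x * of_real (sqrt pi)) = 2 * of_real (sqrt pi * sqrt pi) * h x"
    by (simp only: of_real_mult mult_ac)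
  finally show ?thesis by simp
qed

section \<open>Test functions in the logarithmic variable and decay of their Mellin
  transforms\<close>

lemma test_function_derivs:
  assumes "is_test_function g"
  obtains D a b where "D 0 = g"
    "\<And>n u. 0 < u \<Longrightarrow> (D n has_vector_derivative D (Suc n) u) (at u)"
    "0 < a" "\<And>n u. 0 < u \<Longrightarrow> u \<notin> {a..b} \<Longrightarrow> D n u = (0 :: complex)"
proof -
  from assms obtain D K where D: "D 0 = g"
    "\<And>n u. 0 < u \<Longrightarrow> (D n has_vector_derivative D (Suc n) u) (at u)"
    and K: "compact K" "K \<subseteq> {0<..}" "\<forall>u\<in>{0<..} - K. g u = 0"
    unfolding is_test_function_def smooth_on_def by auto
  have opn: "open ({0<..} - K)" using K(1) by (intro open_Diff compact_imp_closed) auto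
  \<comment> \<open>The half-line minus \<open>K\<close> is open, so vanishing there passes from
    each function to its derivative; one interval then serves all orders.\<close>
  have z: "\<forall>u\<in>{0<..} - K. D n u = 0" for n
  proof (induction n)
    case 0
    then show ?case using K D by auto
  next
    case (Suc n)
    show ?case
    proof
      fix u assume u: "u \<in> {0<..} - K"
      have "(D n has_vector_derivative 0) (at u)"
        by (rule has_vector_derivative_transform_within_open[OF _ opn u, of "\<lambda>_. 0"]) (use Suc in auto)
      moreover have "(D n has_vector_derivative D (Suc n) u) (at u)" using D u by auto
      ultimately show "D (Suc n) u = 0" by (rule vector_derivative_unique_at[symmetric])
    qed
  qed
  obtain a b where "0 < a" "K \<subseteq> {a..b}"
  proof (cases "K = {}")
    case True
    then show ?thesis using that[of 1 1] by auto
  next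
    case False
    obtain a where "a \<in> K" "\<And>t. t \<in> K \<Longrightarrow> a \<le> t" using compact_attains_inf[OF K(1) False] by auto
    moreover obtain b where "b \<in> K" "\<And>t. t \<in> K \<Longrightarrow> t \<le> b" using compact_attains_sup[OF K(1) False] by auto
    ultimately show ?thesis using K(2) by (intro that[of a b]) auto
  qed
  then show ?thesis using that[of D a b] D z by blast
qed

lemma test_function_log:
  assumes "is_test_function g"
  obtains F R where "F (0::nat) = (\<lambda>v. g (exp v))" "0 < R"
    "\<And>n v. n < 3 \<Longrightarrow> (F n has_vector_derivative F (Suc n) v) (at v)"
    "\<And>n v. n \<le> 3 \<Longrightarrow> R \<le> \<bar>v\<bar> \<Longrightarrow> F n v = (0 :: complex)"
    "\<And>n. n \<le> 3 \<Longrightarrow> continuous_on UNIV (F n)"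
proof -
  obtain D a b where D: "D 0 = g"
    "\<And>n u. 0 < u \<Longrightarrow> (D n has_vector_derivative D (Suc n) u) (at u)"
    and ab: "0 < a" "\<And>n u. 0 < u \<Longrightarrow> u \<notin> {a..b} \<Longrightarrow> D n u = (0 :: complex)"
    using test_function_derivs[OF assms] by metis
  have E: "((\<lambda>v. D n (exp v)) has_vector_derivative exp v *\<^sub>R D (Suc n) (exp v)) (at v)" for n v
    using vector_diff_chain_at[of exp "exp v" v "D n" "D (Suc n) (exp v)"] D(2)[of "exp v" n]
      DERIV_exp[of v] by (simp add: has_real_derivative_iff_has_vector_derivative o_def)
  define e where "e v = complex_of_real (exp v)" for v
  have e: "(e has_vector_derivative e v) (at v)" for v
    unfolding e_def by (auto intro!: derivative_eq_intros has_vector_derivative_of_real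
        simp: has_real_derivative_iff_has_vector_derivative[symmetric])
  \<comment> \<open>The coefficients 1, 3, 1 are those of
    \<open>(u d/du)^3 = u D + 3 u^2 D^2 + u^3 D^3\<close> at \<open>u = exp v\<close>.\<close>
  define F where "F = (\<lambda>n. [\<lambda>v. D 0 (exp v), \<lambda>v. e v * D 1 (exp v),
     \<lambda>v. e v * D 1 (exp v) + e v * (e v * D 2 (exp v)),
     \<lambda>v. e v * D 1 (exp v) + 3 * (e v * (e v * D 2 (exp v))) + e v * (e v * (e v * D 3 (exp v)))] ! n)"
  define R where "R = \<bar>ln a\<bar> + \<bar>ln b\<bar> + 1"
  have E': "((\<lambda>v. D n (exp v)) has_vector_derivative e v * D (Suc n) (exp v)) (at v)" for n v
    using E[of n v] by (simp add: e_def scaleR_conv_of_real)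
  have z: "D n (exp v) = 0" if "R \<le> \<bar>v\<bar>" for n v
  proof (rule ab(2))
    show "exp v \<notin> {a..b}"
    proof
      assume *: "exp v \<in> {a..b}"
      then have "b > 0" using ab by auto
      then have "ln a \<le> ln (exp v) \<and> ln (exp v) \<le> ln b" using * ab by (subst (1 2) ln_le_cancel_iff) auto
      then show False using that by (auto simp: R_def)
    qed
  qed auto
  have m: "((\<lambda>v. e v * G v) has_vector_derivative e v * G v + e v * G') (at v)"
    if "(G has_vector_derivative G') (at v)" for G G' v
    using has_vector_derivative_mult[OF e that] by (simp add: add.commute)
  have E1: "((\<lambda>v. D 1 (exp v)) has_vector_derivative e v * D 2 (exp v)) (at v)" for v
    using E'[of 1 v] by (simp add: numeral_2_eq_2)
  have E2: "((\<lambda>v. D 2 (exp v)) has_vector_derivative e v * D 3 (exp v)) (at v)" for v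
    using E'[of 2 v] by (simp add: numeral_3_eq_3 numeral_2_eq_2)
  have F: "F 0 = (\<lambda>v. D 0 (exp v))" "F 1 = (\<lambda>v. e v * D 1 (exp v))"
     "F 2 = (\<lambda>v. e v * D 1 (exp v) + e v * (e v * D 2 (exp v)))"
     "F 3 = (\<lambda>v. e v * D 1 (exp v) + (e v * (e v * D 2 (exp v)) + (e v * (e v * D 2 (exp v)) + e v * (e v * D 2 (exp v)))
             + e v * (e v * (e v * D 3 (exp v)))))"
    by (simp_all add: F_def algebra_simps)
  have d: "(F n has_vector_derivative F (Suc n) v) (at v)" if n: "n < 3" for n v
  proof -
    consider "n = 0" | "n = 1" | "n = 2" using n by linarith
    then show ?thesis
    proof cases
      case 1
      then show ?thesis using E'[of 0 v] F by simp
    next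
      case 2
      have "(F 1 has_vector_derivative F 2 v) (at v)"
        unfolding F using m[OF E1] .
      then show ?thesis using 2 by (simp add: numeral_2_eq_2)
    next
      case 3
      have "(F 2 has_vector_derivative F 3 v) (at v)"
        unfolding F
        by (rule has_vector_derivative_eq_rhs[OF has_vector_derivative_add[OF m[OF E1] m[OF m[OF E2]]]])
           (simp add: algebra_simps)
      then show ?thesis using 3 by (simp add: numeral_2_eq_2 numeral_3_eq_3)
    qed
  qed
  have c: "continuous_on UNIV (\<lambda>v. D n (exp v))" for n
    using E[of n] by (intro continuous_at_imp_continuous_on ballI has_vector_derivative_continuous)
  have ce: "continuous_on UNIV e" unfolding e_def by (intro continuous_intros)
  show ?thesis
  proof (rule that[of F R])
    show "F n v = 0" if n: "n \<le> 3" and v: "R \<le> \<bar>v\<bar>" for n v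
    proof -
      consider "n = 0" | "n = 1" | "n = 2" | "n = 3" using n by linarith
      then show ?thesis by cases (auto simp only: F z[OF v] mult_zero_right add_0)
    qed
    show "continuous_on UNIV (F n)" if n: "n \<le> 3" for n
    proof -
      consider "n = 0" | "n = 1" | "n = 2" | "n = 3" using n by linarith
      then show ?thesis by cases (auto simp only: F intro!: continuous_intros c ce)
    qed
  qed (use D d F in \<open>auto simp: R_def\<close>)
qed


lemma test_function_log_continuous:
  assumes "is_test_function g"
  shows "continuous_on UNIV (\<lambda>v. g (exp v))"
    and "\<exists>R>0. \<forall>v. R \<le> \<bar>v\<bar> \<longrightarrow> g (exp v) = 0"
proof -
  obtain F R where "F (0::nat) = (\<lambda>v. g (exp v))" "0 < R"
    "\<And>n v. n \<le> 3 \<Longrightarrow> R \<le> \<bar>v\<bar> \<Longrightarrow> F n v = (0 :: complex)"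
    "\<And>n. n \<le> 3 \<Longrightarrow> continuous_on UNIV (F n)"
    using test_function_log[OF assms] by metis
  then show "continuous_on UNIV (\<lambda>v. g (exp v))" "\<exists>R>0. \<forall>v. R \<le> \<bar>v\<bar> \<longrightarrow> g (exp v) = 0"
    by (metis zero_le_numeral, metis zero_le_numeral)
qed

text \<open>The substitution \<open>u = exp v\<close> turns the Mellin transform into a two-sided
  Laplace transform. The support confines both integrals to finite intervals, where substitution in
  integrals of continuous functions applies.\<close>

lemma mellin_log:
  assumes g: "is_test_function g"
  shows "mellin g s = (LINT v|lborel. g (exp v) * exp (s * of_real v))"
proof -
  obtain R where R: "0 < R" "\<And>v. R \<le> \<bar>v\<bar> \<Longrightarrow> g (exp v) = 0"
    using test_function_log_continuous(2)[OF g] by auto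
  have zero: "g u = 0" if "0 < u" "u \<notin> {exp (-R)..exp R}" for u
  proof -
    have "R \<le> \<bar>ln u\<bar>"
    proof (cases "u < exp (-R)")
      case True
      then have "ln u < -R" using that ln_less_cancel_iff[of u "exp (-R)"] by simp
      then show ?thesis by simp
    next
      case False
      then have "exp R < u" using that by auto
      then have "R < ln u" using that ln_less_cancel_iff[of "exp R" u] by simp
      then show ?thesis by simp
    qed
    then show ?thesis using R(2)[of "ln u"] that by simp
  qed
  have contg: "continuous_on {0<..} g"
  proof -
    have "continuous_on {0<..} (\<lambda>u. g (exp (ln u)))"
      by (intro continuous_on_compose2[OF test_function_log_continuous(1)[OF g]] continuous_intros) auto
    then show ?thesis by (rule continuous_on_eq) auto
  qed
  let ?f = "\<lambda>u. g u * of_real u powr s / complex_of_real u"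
  have "mellin g s = (LINT u:{exp (-R)..exp R}|lborel. ?f u)"
    unfolding mellin_def set_lebesgue_integral_def
  proof (rule Bochner_Integration.integral_cong)
    fix u :: real
    show "indicator {0<..} u *\<^sub>R ?f u = indicator {exp (-R)..exp R} u *\<^sub>R ?f u"
      using zero[of u] less_le_trans[OF exp_gt_zero[of "-R"], of u]
      by (cases "0 < u"; cases "u \<in> {exp (-R)..exp R}") auto
  qed simp
  also have "\<dots> = (LBINT u=exp (-R)..exp R. ?f u)"
    using R(1) by (subst interval_integral_Icc) auto
  also have "\<dots> = (LBINT v=-R..R. exp v *\<^sub>R ?f (exp v))"
  proof (rule interval_integral_substitution_finite[symmetric])
    show "continuous_on (exp ` {- R..R}) ?f"
    proof -
      have "continuous_on {0<..} ?f"
        by (intro continuous_intros contg) (auto simp: complex_nonpos_Reals_iff)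
      then show ?thesis by (rule continuous_on_subset) auto
    qed
  qed (use R(1) in \<open>auto intro!: derivative_eq_intros continuous_intros\<close>)
  also have "\<dots> = (LINT v:{-R..R}|lborel. exp v *\<^sub>R ?f (exp v))"
    using R(1) by (subst interval_integral_Icc) auto
  also have "\<dots> = (LINT v|lborel. g (exp v) * exp (s * of_real v))"
    unfolding set_lebesgue_integral_def
  proof (rule Bochner_Integration.integral_cong)
    fix v :: real
    show "indicator {-R..R} v *\<^sub>R (exp v *\<^sub>R ?f (exp v)) = g (exp v) * exp (s * of_real v)"
      using R(2)[of v] by (cases "v \<in> {-R..R}")
        (auto simp: scaleR_conv_of_real powr_def exp_of_real[symmetric])
  qed simp
  finally show ?thesis .
qed

text \<open>The derivative of \<open>f v * exp (s * v)\<close> integrates to 0 over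
  \<open>{-R..R}\<close>, since \<open>f\<close> vanishes at both ends. It serves the Mellin
  transform and, with imaginary \<open>s\<close>, the real Fourier transform.\<close>

lemma integral_exp_by_parts:
  fixes f f' :: "real \<Rightarrow> complex"
  assumes der: "\<And>v. (f has_vector_derivative f' v) (at v)"
    and cont: "continuous_on UNIV f'"
    and supp: "\<And>v. R \<le> \<bar>v\<bar> \<Longrightarrow> f v = 0" "\<And>v. R \<le> \<bar>v\<bar> \<Longrightarrow> f' v = 0" and R: "0 < R"
  shows "(LINT v|lborel. f' v * exp (s * of_real v)) = - s * (LINT v|lborel. f v * exp (s * of_real v))"
proof -
  have contf: "continuous_on UNIV f"
    using der by (intro continuous_at_imp_continuous_on ballI has_vector_derivative_continuous)
  have i1: "integrable lborel (\<lambda>v. f' v * exp (s * of_real v))"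
    by (rule integrable_compact_support[where R = R]) (auto intro!: continuous_intros cont simp: supp)
  have i2: "integrable lborel (\<lambda>v. f v * exp (s * of_real v))"
    by (rule integrable_compact_support[where R = R]) (auto intro!: continuous_intros contf simp: supp)
  have d: "((\<lambda>v. f v * exp (s * of_real v)) has_vector_derivative
      (f v * (s * exp (s * of_real v)) + f' v * exp (s * of_real v))) (at v within S)" for v S
  proof -
    have "((\<lambda>v. exp (s * of_real v)) has_vector_derivative s * exp (s * of_real v)) (at v)"
      by (rule has_vector_derivative_real_field) (auto intro!: derivative_eq_intros)
    from has_vector_derivative_mult[OF der this] show ?thesis
      by (rule has_vector_derivative_at_within)
  qed
  have "(\<integral>v. indicator {-R..R} v *\<^sub>R (f v * (s * exp (s * of_real v)) + f' v * exp (s * of_real v)) \<partial>lborel)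
     = f R * exp (s * of_real R) - f (-R) * exp (s * of_real (-R))"
    using R by (intro integral_FTC_Icc d continuous_intros continuous_on_subset[OF contf] continuous_on_subset[OF cont]) auto
  also have "\<dots> = 0" using supp(1)[of R] supp(1)[of "-R"] by simp
  also have "(\<lambda>v. indicator {-R..R} v *\<^sub>R (f v * (s * exp (s * of_real v)) + f' v * exp (s * of_real v)))
      = (\<lambda>v. s * (f v * exp (s * of_real v)) + f' v * exp (s * of_real v))"
  proof
    fix v
    show "indicator {-R..R} v *\<^sub>R (f v * (s * exp (s * of_real v)) + f' v * exp (s * of_real v))
      = s * (f v * exp (s * of_real v)) + f' v * exp (s * of_real v)"
      using supp[of v] by (cases "v \<in> {-R..R}") auto
  qed
  also have "(\<integral>v. s * (f v * exp (s * of_real v)) + f' v * exp (s * of_real v) \<partial>lborel)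
     = s * (LINT v|lborel. f v * exp (s * of_real v)) + (LINT v|lborel. f' v * exp (s * of_real v))"
    using i1 i2 by simp
  finally show ?thesis by (simp add: add_eq_0_iff)
qed

lemma norm_integral_exp_le:
  fixes f :: "real \<Rightarrow> complex"
  assumes cont: "continuous_on UNIV f" and supp: "\<And>v. R \<le> \<bar>v\<bar> \<Longrightarrow> f v = 0" and R: "0 < R"
    and s: "\<bar>Re s\<bar> \<le> B"
  shows "norm (LINT v|lborel. f v * exp (s * of_real v)) \<le> (LINT v|lborel. norm (f v)) * exp (B * R)"
proof -
  have "norm (LINT v|lborel. f v * exp (s * of_real v)) \<le> (LINT v|lborel. norm (f v * exp (s * of_real v)))"
    by (rule integral_norm_bound)
  also have "\<dots> \<le> (LINT v|lborel. norm (f v) * exp (B * R))"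
  proof (rule integral_mono)
    show "integrable lborel (\<lambda>v. norm (f v * exp (s * of_real v)))"
      by (rule integrable_compact_support[where R = R]) (auto intro!: continuous_intros cont simp: supp)
    show "integrable lborel (\<lambda>v. norm (f v) * exp (B * R))"
      by (rule integrable_compact_support[where R = R]) (auto intro!: continuous_intros cont simp: supp)
    fix v
    show "norm (f v * exp (s * of_real v)) \<le> norm (f v) * exp (B * R)"
    proof (cases "R \<le> \<bar>v\<bar>")
      case False
      have "Re s * v \<le> \<bar>Re s\<bar> * \<bar>v\<bar>" by (metis abs_ge_self abs_mult)
      also have "\<dots> \<le> B * R" using False s by (intro mult_mono) auto
      finally show ?thesis by (auto simp: norm_mult intro!: mult_left_mono)
    qed (simp add: supp)
  qed
  finally show ?thesis by simp
qed

text \<open>Three integrations by parts produce \<open>s ^ 3\<close>, and on the strip each integral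
  is at most \<open>exp (B * R)\<close> times an L1 norm, uniformly in \<open>Im s\<close>.\<close>

lemma mellin_decay:
  assumes g: "is_test_function g"
  obtains C where "0 \<le> C" "\<And>s. \<bar>Re s\<bar> \<le> B \<Longrightarrow> norm (mellin g s) * (1 + \<bar>Im s\<bar> ^ 3) \<le> C"
proof -
  obtain F R where F: "F (0::nat) = (\<lambda>v. g (exp v))" "0 < R"
    "\<And>n v. n < 3 \<Longrightarrow> (F n has_vector_derivative F (Suc n) v) (at v)"
    "\<And>n v. n \<le> 3 \<Longrightarrow> R \<le> \<bar>v\<bar> \<Longrightarrow> F n v = (0 :: complex)"
    "\<And>n. n \<le> 3 \<Longrightarrow> continuous_on UNIV (F n)"
    by (rule test_function_log[OF g], rule that) assumption+
  define I where "I n s = (LINT v|lborel. F n v * exp (s * of_real v))" for n s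
  have step: "I (Suc n) s = - s * I n s" if "n < 3" for n s
    unfolding I_def using that F
    by (intro integral_exp_by_parts[where R = R] F(3)) auto
  have "I 3 s = - (s ^ 3) * I 0 s" for s
    using step[of 0 s] step[of 1 s] step[of 2 s] by (simp add: numeral_2_eq_2 numeral_3_eq_3)
  moreover have "I 0 s = mellin g s" for s
    by (simp add: I_def mellin_log[OF g] F)
  ultimately have I: "I 0 s = mellin g s" "norm (I 3 s) = norm s ^ 3 * norm (mellin g s)" for s
    by (auto simp: norm_mult norm_power)
  define C where "C = ((LINT v|lborel. norm (F 0 v)) + (LINT v|lborel. norm (F 3 v))) * exp (B * R)"
  show ?thesis
  proof (rule that[of C])
    show "0 \<le> C" by (auto simp: C_def intro!: mult_nonneg_nonneg add_nonneg_nonneg Bochner_Integration.integral_nonneg)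
    fix s assume s: "\<bar>Re s\<bar> \<le> B"
    have "norm (mellin g s) * (1 + \<bar>Im s\<bar> ^ 3) \<le> norm (mellin g s) * (1 + norm s ^ 3)"
      by (intro mult_left_mono add_left_mono power_mono abs_Im_le_cmod) auto
    also have "\<dots> = norm (I 0 s) + norm (I 3 s)" unfolding I by (simp add: algebra_simps)
    also have "\<dots> \<le> C"
      unfolding C_def I_def distrib_right
      by (intro add_mono norm_integral_exp_le[OF _ _ F(2) s] F) auto
    finally show "norm (mellin g s) * (1 + \<bar>Im s\<bar> ^ 3) \<le> C" .
  qed
qed

text \<open>One factor \<open>1 + |Im s|\<close> is reserved to absorb the linear growth of
  \<Lambda>; the rest of the cubic decay is still integrable along a vertical line.\<close>

lemma mellin_decay_product:
  assumes g: "is_test_function g"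
  obtains C where "0 \<le> C" "\<And>s. \<bar>Re s\<bar> \<le> B \<Longrightarrow> norm (mellin g s) * (1 + \<bar>Im s\<bar>) \<le> C / (1 + (Im s)\<^sup>2)"
proof -
  obtain C where C: "0 \<le> C" "\<And>s. \<bar>Re s\<bar> \<le> B \<Longrightarrow> norm (mellin g s) * (1 + \<bar>Im s\<bar> ^ 3) \<le> C"
    using mellin_decay[OF g, of B] by metis
  show ?thesis
  proof (rule that[of "2 * C"])
    fix s assume s: "\<bar>Re s\<bar> \<le> B"
    define t where "t = \<bar>Im s\<bar>"
    have t: "0 \<le> t" "(Im s)\<^sup>2 = t\<^sup>2" by (auto simp: t_def)
    \<comment> \<open>This factorisation proves
      \<open>(1 + t) * (1 + t\<^sup>2) \<le> 2 * (1 + t ^ 3)\<close> and is the origin of the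
      constant \<open>2 * C\<close>.\<close>
    have "2 * (1 + t ^ 3) - (1 + t) * (1 + t\<^sup>2) = (t - 1)\<^sup>2 * (t + 1)"
      by (simp add: power2_eq_square power3_eq_cube algebra_simps)
    also have "\<dots> \<ge> 0" using t by simp
    finally have "norm (mellin g s) * ((1 + t) * (1 + t\<^sup>2)) \<le> norm (mellin g s) * (2 * (1 + t ^ 3))"
      by (intro mult_left_mono) auto
    also have "\<dots> \<le> 2 * C" using C(2)[OF s] by (simp add: t_def algebra_simps)
    finally show "norm (mellin g s) * (1 + \<bar>Im s\<bar>) \<le> 2 * C / (1 + (Im s)\<^sup>2)"
      unfolding t(2) t_def[symmetric] using sum_power2_gt_zero_iff[of 1 t] by (simp add: pos_le_divide_eq mult.assoc)
  qed (use C in auto)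
qed

text \<open>Compact support allows differentiation under the integral sign for every
  \<open>s\<close>. Holomorphy is what later permits moving the line of integration at the real
  place.\<close>

lemma mellin_holomorphic:
  assumes g: "is_test_function g"
  shows "mellin g holomorphic_on A"
proof -
  obtain R where R: "0 < R" "\<And>v. R \<le> \<bar>v\<bar> \<Longrightarrow> g (exp v) = 0"
    using test_function_log_continuous(2)[OF g] by auto
  note cont = test_function_log_continuous(1)[OF g]
  have c: "continuous_on {-R..R} (\<lambda>v. g (exp v) * exp (s * of_real v))" for s
    by (intro continuous_intros continuous_on_subset[OF cont]) auto
  have "mellin g s = integral (cbox (-R) R) (\<lambda>v. g (exp v) * exp (s * of_real v))" for s
  proof -
    have "mellin g s = (LINT v:{-R..R}|lborel. g (exp v) * exp (s * of_real v))"
      unfolding mellin_log[OF g] set_lebesgue_integral_def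
    proof (rule Bochner_Integration.integral_cong)
      fix v
      show "g (exp v) * exp (s * of_real v) = indicator {-R..R} v *\<^sub>R (g (exp v) * exp (s * of_real v))"
        using R(2)[of v] by (cases "v \<in> {-R..R}") auto
    qed simp
    also have "\<dots> = integral {-R..R} (\<lambda>v. g (exp v) * exp (s * of_real v))"
      by (rule set_borel_integral_eq_integral) (intro borel_integrable_atLeastAtMost' c)
    finally show ?thesis by (simp add: cbox_interval)
  qed
  moreover have "(\<lambda>s. integral (cbox (-R) R) (\<lambda>v. g (exp v) * exp (s * of_real v))) holomorphic_on UNIV"
  proof (rule leibniz_rule_holomorphic[where fx = "\<lambda>s v. g (exp v) * (of_real v * exp (s * of_real v))"])
    show "(\<lambda>v. g (exp v) * exp (s * of_real v)) integrable_on cbox (-R) R" for s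
      using c by (intro integrable_continuous) (simp add: cbox_interval)
    show "continuous_on (UNIV \<times> cbox (- R) R) (\<lambda>(s, v). g (exp v) * (of_real v * exp (s * of_real v)))"
      unfolding split_beta
      by (intro continuous_intros continuous_on_compose2[OF cont]) auto
  qed (auto intro!: derivative_eq_intros)
  ultimately show ?thesis by (metis (no_types, lifting) ext holomorphic_on_subset subset_UNIV)
qed

lemma integrable_inverse_square: "integrable lborel (\<lambda>x::real. 1 / (1 + x\<^sup>2))"
proof -
  have "integrable lborel (\<lambda>x::real. indicator {-1..1} x *\<^sub>R (1::real))" by simp
  moreover have "integrable lborel (\<lambda>x::real. indicator {1..} x *\<^sub>R (1 / x\<^sup>2))"
  proof -
    have "((\<lambda>x::real. x powr (-2)) has_integral - (1 powr (-2 + 1)) / (-2 + 1)) {1..}"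
      by (rule has_integral_powr_to_inf) auto
    then have "set_integrable lebesgue {1..} (\<lambda>x::real. x powr (-2))"
      by (intro nonnegative_absolutely_integrable_1) (auto simp: integrable_on_def)
    then have "set_integrable lborel {1..} (\<lambda>x::real. x powr (-2))"
      unfolding set_integrable_def by (subst (asm) integrable_completion) auto
    moreover have "indicator {1..} x *\<^sub>R (1 / x\<^sup>2) = indicator {1..} x *\<^sub>R (x powr (-2))" for x :: real
      by (auto simp: indicator_def powr_minus powr_numeral field_simps)
    ultimately show ?thesis by (simp add: set_integrable_def)
  qed
  moreover from this have "integrable lborel (\<lambda>x. indicator {1..} (0 + (-1) * x) *\<^sub>R (1 / (0 + (-1) * x :: real)\<^sup>2))"
    by (rule lborel_integrable_real_affine) simp
  ultimately have "integrable lborel (\<lambda>x::real. indicator {-1..1} x *\<^sub>R (1::real) + indicator {1..} x *\<^sub>R (1 / x\<^sup>2)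
       + indicator {1..} (0 + (-1) * x) *\<^sub>R (1 / (0 + (-1) * x :: real)\<^sup>2))"
    by (intro Bochner_Integration.integrable_add)
  then show ?thesis
  proof (rule Bochner_Integration.integrable_bound)
    show "AE x::real in lborel. norm (1 / (1 + x\<^sup>2)) \<le> norm (indicator {-1..1} x *\<^sub>R (1::real) + indicator {1..} x *\<^sub>R (1 / x\<^sup>2)
       + indicator {1..} (0 + (-1) * x) *\<^sub>R (1 / (0 + (-1) * x :: real)\<^sup>2))"
    proof (rule AE_I2)
      fix x :: real
      have pos: "0 < 1 + x\<^sup>2" using sum_power2_gt_zero_iff[of 1 x] by simp
      have h1: "1 / (1 + x\<^sup>2) \<le> 1" using pos by (simp add: pos_divide_le_eq)
      have h2: "1 / (1 + x\<^sup>2) \<le> 1 / x\<^sup>2" if "x \<noteq> 0" using pos that by (intro divide_left_mono) auto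
      consider "x \<in> {-1..1}" | "1 < x" | "x < -1" by fastforce
      then show "norm (1 / (1 + x\<^sup>2)) \<le> norm (indicator {-1..1} x *\<^sub>R (1::real) + indicator {1..} x *\<^sub>R (1 / x\<^sup>2)
       + indicator {1..} (0 + (-1) * x) *\<^sub>R (1 / (0 + (-1) * x :: real)\<^sup>2))"
        using pos h1 h2 by cases (auto simp: indicator_def)
    qed
  qed measurable
qed

lemma continuous_on_vertical_mellin:
  assumes g: "is_test_function g"
  shows "continuous_on UNIV (\<lambda>\<tau>. mellin g (Complex c \<tau>))"
proof -
  have "continuous_on UNIV (mellin g)"
    by (rule holomorphic_on_imp_continuous_on[OF mellin_holomorphic[OF g]])
  then show ?thesis
    by (rule continuous_on_compose2) (auto simp: Complex_eq intro!: continuous_intros)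
qed

lemma integrable_vertical_mellin_mult:
  assumes g: "is_test_function g"
    and h: "h \<in> borel_measurable borel" "\<And>\<tau>. norm (h \<tau>) \<le> B * (1 + \<bar>\<tau>\<bar>)"
  shows "integrable lborel (\<lambda>\<tau>. mellin g (Complex c \<tau>) * h \<tau>)"
proof -
  obtain C where C: "0 \<le> C" "\<And>s. \<bar>Re s\<bar> \<le> \<bar>c\<bar> \<Longrightarrow> norm (mellin g s) * (1 + \<bar>Im s\<bar>) \<le> C / (1 + (Im s)\<^sup>2)"
    using mellin_decay_product[OF g, of "\<bar>c\<bar>"] by metis
  have B: "0 \<le> B" using order_trans[OF norm_ge_zero h(2)[of 0]] by simp
  note [measurable] = h(1) borel_measurable_continuous_onI[OF continuous_on_vertical_mellin[OF g, of c]]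
  show ?thesis
  proof (rule Bochner_Integration.integrable_bound[OF integrable_mult_right[OF integrable_inverse_square]])
    show "AE \<tau> in lborel. norm (mellin g (Complex c \<tau>) * h \<tau>) \<le> norm ((B * C) * (1 / (1 + \<tau>\<^sup>2)))"
    proof (rule AE_I2)
      fix \<tau> :: real
      have "norm (mellin g (Complex c \<tau>) * h \<tau>) \<le> norm (mellin g (Complex c \<tau>)) * (B * (1 + \<bar>\<tau>\<bar>))"
        using h(2)[of \<tau>] by (simp add: norm_mult mult_left_mono)
      also have "\<dots> = B * (norm (mellin g (Complex c \<tau>)) * (1 + \<bar>\<tau>\<bar>))" by simp
      also have "\<dots> \<le> B * (C / (1 + \<tau>\<^sup>2))"
        using C(2)[of "Complex c \<tau>"] B by (intro mult_left_mono) auto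
      also have "\<dots> = (B * C) * (1 / (1 + \<tau>\<^sup>2))" by simp
      finally show "norm (mellin g (Complex c \<tau>) * h \<tau>) \<le> norm ((B * C) * (1 / (1 + \<tau>\<^sup>2)))"
        unfolding real_norm_def by (rule order_trans[OF _ abs_ge_self])
    qed
  qed measurable
qed

lemma integrable_vertical_mellin:
  assumes g: "is_test_function g"
  shows "integrable lborel (\<lambda>\<tau>. mellin g (Complex c \<tau>))"
  using integrable_vertical_mellin_mult[OF g, of "\<lambda>_. 1" 1] by simp

text \<open>This is Fourier inversion at \<open>ln y\<close> for
  \<open>g (exp v) * exp (c * v)\<close>, whose transform at \<tau> is the Mellin transform at
  \<open>Complex c \<tau>\<close>; the weight \<open>y powr (- c)\<close> undoes the
  exponential.\<close>

lemma mellin_inversion: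
  assumes g: "is_test_function g" and y: "0 < y"
  shows "(LINT \<tau>|lborel. mellin g (Complex c \<tau>) * of_real y powr (- Complex c \<tau>)) = 2 * of_real pi * g y"
    and "integrable lborel (\<lambda>\<tau>. mellin g (Complex c \<tau>) * of_real y powr (- Complex c \<tau>))"
proof -
  obtain R where R: "0 < R" "\<And>v. R \<le> \<bar>v\<bar> \<Longrightarrow> g (exp v) = 0"
    using test_function_log_continuous(2)[OF g] by auto
  define h where "h v = g (exp v) * of_real (exp (c * v))" for v
  have p: "mellin g (Complex c \<tau>) * of_real y powr (- Complex c \<tau>)
     = of_real (y powr (-c)) * (mellin g (Complex c \<tau>) * exp (- (\<i> * of_real (\<tau> * ln y))))" for \<tau>
  proof -
    have "complex_of_real y powr (- Complex c \<tau>) = exp (of_real (- c * ln y) + (- (\<i> * of_real (\<tau> * ln y))))"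
      using y by (simp add: powr_def Ln_of_real Complex_eq algebra_simps)
    then show ?thesis using y by (simp only: exp_add) (simp add: powr_def exp_of_real[symmetric])
  qed
  have "(LINT \<tau>|lborel. mellin g (Complex c \<tau>) * exp (- (\<i> * of_real (\<tau> * ln y)))) = 2 * of_real pi * h (ln y)"
  proof (rule fourier_inversion_compact_support[where R = R])
    show "continuous_on UNIV h"
      unfolding h_def by (intro continuous_intros test_function_log_continuous[OF g])
    show "mellin g (Complex c \<tau>) = (LINT v|lborel. h v * exp (\<i> * of_real (\<tau> * v)))" for \<tau>
      unfolding mellin_log[OF g] h_def
      by (intro Bochner_Integration.integral_cong refl)
         (simp add: Complex_eq exp_of_real[symmetric] exp_add[symmetric] algebra_simps)
  qed (auto simp: h_def R integrable_vertical_mellin[OF g])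
  then show "(LINT \<tau>|lborel. mellin g (Complex c \<tau>) * of_real y powr (- Complex c \<tau>)) = 2 * of_real pi * g y"
    unfolding p using y by (subst integral_mult_right_zero)
      (simp add: h_def powr_def exp_of_real[symmetric] exp_add[symmetric] exp_minus field_simps)
  show "integrable lborel (\<lambda>\<tau>. mellin g (Complex c \<tau>) * of_real y powr (- Complex c \<tau>))"
    unfolding p
    by (intro integrable_mult_right integrable_vertical_mellin_mult[OF g, where B = 1]) auto
qed

section \<open>The explicit formula at a prime\<close>

text \<open>The last inequality says \<open>|Z s| < 1\<close> on the line \<open>Re s = d\<close>,
  so \<open>Z / (1 - Z)\<close> is a geometric series of exponentials in \<open>s\<close>, and
  Mellin inversion evaluates each term. It is applied with \<open>Z s = p powr (- s)\<close> and
  with \<open>Z s = p powr (s - 1)\<close>.\<close>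

lemma vertical_mellin_geometric:
  fixes b l d y :: real
  assumes g: "is_test_function g" and y: "0 < y" and b: "0 < b" and z: "b * exp (d * l) < 1"
    and Z: "Z = (\<lambda>s. of_real b * exp (s * of_real l))"
  shows "(LINT \<tau>|lborel. mellin g (Complex d \<tau>) * of_real y powr (- Complex d \<tau>) * (Z (Complex d \<tau>) / (1 - Z (Complex d \<tau>))))
           = 2 * of_real pi * (\<Sum>j. of_real (b ^ Suc j) * g (y * exp (- (l * real (Suc j)))))"
    and "integrable lborel (\<lambda>\<tau>. mellin g (Complex d \<tau>) * of_real y powr (- Complex d \<tau>) * (Z (Complex d \<tau>) / (1 - Z (Complex d \<tau>))))"
proof -
  define q where "q = b * exp (d * l)"
  have q: "0 \<le> q" "q < 1" using b z by (auto simp: q_def)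
  define M where "M \<tau> = mellin g (Complex d \<tau>) * of_real y powr (- Complex d \<tau>)" for \<tau>
  have nZ: "norm (Z (Complex d \<tau>)) = q" for \<tau>
    using b by (simp add: Z q_def norm_mult)
  have M_int: "integrable lborel M" unfolding M_def by (rule mellin_inversion(2)[OF g y])
  \<comment> \<open>Multiplication by a power of \<open>Z\<close> dilates the point \<open>y\<close>
    at which the Mellin transform is inverted.\<close>
  have pow_term: "M \<tau> * Z (Complex d \<tau>) ^ Suc j = of_real (b ^ Suc j) *
       (mellin g (Complex d \<tau>) * of_real (y * exp (- (l * real (Suc j)))) powr (- Complex d \<tau>))" for \<tau> j
  proof -
    have "complex_of_real (y * exp (- (l * real (Suc j)))) powr (- Complex d \<tau>)
        = exp (- Complex d \<tau> * of_real (ln y + - (l * real (Suc j))))"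
      using y by (simp add: powr_def Ln_of_real ln_mult del: of_real_mult of_nat_Suc)
    also have "\<dots> = exp (- Complex d \<tau> * of_real (ln y)) * exp (of_nat (Suc j) * (Complex d \<tau> * of_real l))"
      unfolding exp_add[symmetric] by (simp add: algebra_simps)
    also have "\<dots> = of_real y powr (- Complex d \<tau>) * exp (Complex d \<tau> * of_real l) ^ Suc j"
      using y by (simp only: exp_of_nat_mult) (simp add: powr_def Ln_of_real)
    finally show ?thesis by (simp add: M_def Z power_mult_distrib mult_ac)
  qed
  have t_int: "integrable lborel (\<lambda>\<tau>. M \<tau> * Z (Complex d \<tau>) ^ Suc j)" for j
    unfolding pow_term using y by (intro integrable_mult_right mellin_inversion(2)[OF g]) auto
  have t_val: "(LINT \<tau>|lborel. M \<tau> * Z (Complex d \<tau>) ^ Suc j)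
      = 2 * of_real pi * (of_real (b ^ Suc j) * g (y * exp (- (l * real (Suc j)))))" for j
    unfolding pow_term using y
    by (subst integral_mult_right_zero, subst mellin_inversion(1)[OF g]) (auto simp: mult_ac)
  have nrm: "norm (M \<tau> * Z (Complex d \<tau>) ^ Suc j) = norm (M \<tau>) * q ^ Suc j" for \<tau> j
    by (simp add: norm_mult norm_power nZ)
  have sg: "summable (\<lambda>j. C * q ^ Suc j)" for C
    using q by (simp add: summable_mult summable_geometric)
  have s1: "AE \<tau> in lborel. summable (\<lambda>j. norm (M \<tau> * Z (Complex d \<tau>) ^ Suc j))"
    unfolding nrm by (intro AE_I2 sg)
  have s2: "summable (\<lambda>j. LINT \<tau>|lborel. norm (M \<tau> * Z (Complex d \<tau>) ^ Suc j))"
    unfolding nrm integral_mult_left_zero by (rule sg)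
  have geo: "(\<Sum>j. M \<tau> * Z (Complex d \<tau>) ^ Suc j) = M \<tau> * (Z (Complex d \<tau>) / (1 - Z (Complex d \<tau>)))" for \<tau>
  proof -
    have "(\<lambda>j. M \<tau> * Z (Complex d \<tau>) * Z (Complex d \<tau>) ^ j) sums (M \<tau> * Z (Complex d \<tau>) * (1 / (1 - Z (Complex d \<tau>))))"
      using q nZ[of \<tau>] by (intro sums_mult geometric_sums) auto
    then show ?thesis by (simp add: sums_iff mult_ac)
  qed
  have "integrable lborel (\<lambda>\<tau>. \<Sum>j. M \<tau> * Z (Complex d \<tau>) ^ Suc j)"
    by (rule integrable_suminf[OF t_int s1 s2])
  then show "integrable lborel (\<lambda>\<tau>. mellin g (Complex d \<tau>) * of_real y powr (- Complex d \<tau>) * (Z (Complex d \<tau>) / (1 - Z (Complex d \<tau>))))"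
    unfolding geo unfolding M_def .
  \<comment> \<open>Summability of the values of \<open>g\<close> is inherited from the interchange
    of sum and integral.\<close>
  have fin: "summable (\<lambda>j. of_real (b ^ Suc j) * g (y * exp (- (l * real (Suc j)))))"
  proof -
    have "(\<lambda>j. LINT \<tau>|lborel. M \<tau> * Z (Complex d \<tau>) ^ Suc j) sums (LINT \<tau>|lborel. (\<Sum>j. M \<tau> * Z (Complex d \<tau>) ^ Suc j))"
      by (rule sums_integral[OF t_int s1 s2])
    then have "summable (\<lambda>j. 2 * of_real pi * (of_real (b ^ Suc j) * g (y * exp (- (l * real (Suc j))))))"
      unfolding t_val by (rule sums_summable)
    then show ?thesis by (rule summable_mult_D) simp
  qed
  have "(LINT \<tau>|lborel. (\<Sum>j. M \<tau> * Z (Complex d \<tau>) ^ Suc j)) = (\<Sum>j. (LINT \<tau>|lborel. M \<tau> * Z (Complex d \<tau>) ^ Suc j))"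
    by (rule integral_suminf[OF t_int s1 s2])
  also have "\<dots> = 2 * of_real pi * (\<Sum>j. of_real (b ^ Suc j) * g (y * exp (- (l * real (Suc j)))))"
    unfolding t_val by (rule suminf_mult[OF fin])
  finally show "(LINT \<tau>|lborel. mellin g (Complex d \<tau>) * of_real y powr (- Complex d \<tau>) * (Z (Complex d \<tau>) / (1 - Z (Complex d \<tau>))))
           = 2 * of_real pi * (\<Sum>j. of_real (b ^ Suc j) * g (y * exp (- (l * real (Suc j)))))"
    unfolding geo unfolding M_def .
qed

text \<open>The closed form in which the two sides are compared at a prime: the first sum comes from
  expanding in \<open>p powr (- s)\<close>, the second from expanding in
  \<open>p powr (s - 1)\<close>.\<close>

definition padic_term :: "nat \<Rightarrow> (real \<Rightarrow> complex) \<Rightarrow> real \<Rightarrow> complex" where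
  "padic_term p g y = of_real (ln (real p)) *
     ((\<Sum>j. g (y * real p ^ Suc j)) + (\<Sum>j. of_real ((1 / real p) ^ Suc j) * g (y / real p ^ Suc j)))"

lemma L_prime_deriv:
  assumes p: "1 < p" and s: "0 < Re s"
  shows "of_nat p powr (- s) \<noteq> (1::complex)"
    and "(L_local (Prime_Place p) has_field_derivative
           - L_local (Prime_Place p) s * (of_real (ln (real p)) * (of_nat p powr (-s) / (1 - of_nat p powr (-s))))) (at s)"
    and "L_local (Prime_Place p) s \<noteq> 0"
proof -
  have "norm (of_nat p powr (- s) :: complex) = real p powr (- Re s)"
    using p by (subst norm_powr_real_powr) auto
  also have "\<dots> < 1" using p s by (intro powr_less_one) auto
  finally show 1: "of_nat p powr (- s) \<noteq> (1::complex)" by auto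
  show "(L_local (Prime_Place p) has_field_derivative
           - L_local (Prime_Place p) s * (of_real (ln (real p)) * (of_nat p powr (-s) / (1 - of_nat p powr (-s))))) (at s)"
  proof -
    have L: "Ln (of_nat p) = of_real (ln (real p))"
      using p Ln_of_real[of "real p"] by simp
    have "((\<lambda>s. 1 / (1 - exp (- s * Ln (of_nat p)))) has_field_derivative
        - (1 / (1 - exp (- s * Ln (of_nat p)))) * (Ln (of_nat p) * (exp (- s * Ln (of_nat p)) / (1 - exp (- s * Ln (of_nat p)))))) (at s)"
      using 1 p by (auto intro!: derivative_eq_intros simp: powr_def power2_eq_square)
    then show ?thesis
      using p by (simp add: powr_def L L_local.simps[abs_def])
  qed
  show "L_local (Prime_Place p) s \<noteq> 0" using 1 by simp
qed

text \<open>\<open>A\<close> and \<open>B\<close> are the values of \<open>- L' / L\<close> at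
  \<open>s\<close> and at \<open>1 - s\<close>. The quotient and the inner function
  \<open>1 - s\<close> each contribute a sign to the second term, so the two values add.\<close>

lemma Lambda_local_eq:
  assumes "(L_local \<nu> has_field_derivative - L_local \<nu> s * A) (at s)"
    and "(L_local \<nu> has_field_derivative - L_local \<nu> (1 - s) * B) (at (1 - s))"
    and nz: "L_local \<nu> s \<noteq> 0" "L_local \<nu> (1 - s) \<noteq> 0"
  shows "Lambda_local \<nu> s = A + B"
    and "(Gamma_local \<nu> has_field_derivative - Gamma_local \<nu> s * (A + B)) (at s)"
proof -
  have "((\<lambda>s. L_local \<nu> (1 - s)) has_field_derivative (- L_local \<nu> (1 - s) * B) * (-1)) (at s)"
    by (rule DERIV_chain2[where f = "L_local \<nu>" and g = "\<lambda>s. 1 - s", OF assms(2)]) (auto intro!: derivative_eq_intros)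
  from DERIV_divide[OF assms(1) this nz(2)]
  have "(Gamma_local \<nu> has_field_derivative
     (- L_local \<nu> s * A * L_local \<nu> (1 - s) - L_local \<nu> s * (- L_local \<nu> (1 - s) * B * - 1)) /
     (L_local \<nu> (1 - s) * L_local \<nu> (1 - s))) (at s)"
    unfolding Gamma_local_def[abs_def] .
  also have "(- L_local \<nu> s * A * L_local \<nu> (1 - s) - L_local \<nu> s * (- L_local \<nu> (1 - s) * B * - 1)) /
     (L_local \<nu> (1 - s) * L_local \<nu> (1 - s)) = - Gamma_local \<nu> s * (A + B)"
    using nz by (simp add: Gamma_local_def field_simps)
  finally show D: "(Gamma_local \<nu> has_field_derivative - Gamma_local \<nu> s * (A + B)) (at s)" .
  show "Lambda_local \<nu> s = A + B"
    using nz DERIV_imp_deriv[OF D] by (simp add: Lambda_local_def Gamma_local_def)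
qed

text \<open>Brings the two geometric ratios into the shape
  \<open>of_real b * exp (s * of_real l)\<close> that \<open>vertical_mellin_geometric\<close>
  expects.\<close>

lemma padic_weights:
  fixes s :: complex
  assumes p: "1 < p"
  shows "of_nat p powr (- s) = of_real 1 * exp (s * of_real (- ln (real p)))"
    "of_nat p powr (- (1 - s)) = of_real (1 / real p) * exp (s * of_real (ln (real p)))"
proof -
  have L: "Ln (of_nat p) = of_real (ln (real p))"
    using p Ln_of_real[of "real p"] by simp
  show "of_nat p powr (- s) = of_real 1 * exp (s * of_real (- ln (real p)))"
    using p by (simp add: powr_def L)
  have "complex_of_real (1 / real p) = exp (- of_real (ln (real p)))"
    using p by (simp add: exp_minus exp_of_real inverse_eq_divide flip: of_real_minus)
  then show "of_nat p powr (- (1 - s)) = of_real (1 / real p) * exp (s * of_real (ln (real p)))"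
    using p by (simp add: powr_def L exp_add[symmetric] algebra_simps)
qed

lemma padic_term_exp:
  assumes p: "1 < p"
  shows "(\<Sum>j. of_real (1 ^ Suc j) * g (y * exp (- (- ln (real p) * real (Suc j))))) = (\<Sum>j. g (y * real p ^ Suc j))"
    and "(\<Sum>j. of_real ((1 / real p) ^ Suc j) * g (y * exp (- (ln (real p) * real (Suc j)))))
       = (\<Sum>j. of_real ((1 / real p) ^ Suc j) * g (y / real p ^ Suc j))"
proof -
  have e: "exp (ln (real p) * real (Suc j)) = real p ^ Suc j" for j
    using p by (metis exp_ln exp_of_nat2_mult of_nat_0_less_iff order_less_trans zero_less_one)
  show "(\<Sum>j. of_real (1 ^ Suc j) * g (y * exp (- (- ln (real p) * real (Suc j))))) = (\<Sum>j. g (y * real p ^ Suc j))"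
    by (simp only: mult_minus_left minus_minus e) simp
  show "(\<Sum>j. of_real ((1 / real p) ^ Suc j) * g (y * exp (- (ln (real p) * real (Suc j)))))
       = (\<Sum>j. of_real ((1 / real p) ^ Suc j) * g (y / real p ^ Suc j))"
    by (simp only: exp_minus e) (simp add: divide_inverse)
qed

text \<open>The two bounds on \<open>c\<close> are exactly the convergence conditions:
  \<open>0 < c\<close> for the series in \<open>p powr (- s)\<close>, \<open>c < 1\<close> for the
  series in \<open>p powr (s - 1)\<close>.\<close>

lemma vertical_integral_padic_term:
  assumes g: "is_test_function g" and p: "1 < p" and c: "0 < c" "c < 1" and y: "0 < y"
  shows "1 / (2 * of_real pi * \<i>) * vertical_integral c
     (\<lambda>s. Lambda_local (Prime_Place p) s * mellin g s * of_real y powr (- s)) = padic_term p g y"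
proof -
  define M where "M \<tau> = mellin g (Complex c \<tau>) * of_real y powr (- Complex c \<tau>)" for \<tau>
  define Z1 where "Z1 = (\<lambda>s::complex. of_real 1 * exp (s * of_real (- ln (real p))))"
  define Z2 where "Z2 = (\<lambda>s::complex. of_real (1 / real p) * exp (s * of_real (ln (real p))))"
  have lp: "0 < ln (real p)" using p by simp
  have z1: "1 * exp (c * - ln (real p)) < 1" using lp c by (simp add: mult_pos_pos)
  have z2: "1 / real p * exp (c * ln (real p)) < 1"
  proof -
    have "exp (c * ln (real p)) < exp (1 * ln (real p))"
      using lp c by (subst exp_less_cancel_iff) (intro mult_strict_right_mono, auto)
    then show ?thesis using p by simp
  qed
  have ip: "0 < 1 / real p" using p by simp
  note G1 = vertical_mellin_geometric[OF g y zero_less_one z1 Z1_def, folded M_def]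
  note G2 = vertical_mellin_geometric[OF g y ip z2 Z2_def, folded M_def]
  have "Lambda_local (Prime_Place p) (Complex c \<tau>) = of_real (ln (real p)) * (Z1 (Complex c \<tau>) / (1 - Z1 (Complex c \<tau>)))
     + of_real (ln (real p)) * (Z2 (Complex c \<tau>) / (1 - Z2 (Complex c \<tau>)))" for \<tau>
  proof -
    let ?s = "Complex c \<tau>"
    have s: "0 < Re ?s" "0 < Re (1 - ?s)" using c by auto
    have w1: "of_nat p powr (- ?s) = Z1 ?s" unfolding Z1_def by (rule padic_weights[OF p])
    have w2: "of_nat p powr (- (1 - ?s)) = Z2 ?s" unfolding Z2_def by (rule padic_weights[OF p])
    show ?thesis
      using Lambda_local_eq(1)[OF L_prime_deriv(2)[OF p s(1)] L_prime_deriv(2)[OF p s(2)] L_prime_deriv(3)[OF p s(1)] L_prime_deriv(3)[OF p s(2)]]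
      by (simp only: w1 w2)
  qed
  then have "vertical_integral c (\<lambda>s. Lambda_local (Prime_Place p) s * mellin g s * of_real y powr (- s))
     = (LINT \<tau>|lborel. of_real (ln (real p)) * \<i> * (M \<tau> * (Z1 (Complex c \<tau>) / (1 - Z1 (Complex c \<tau>))))
         + of_real (ln (real p)) * \<i> * (M \<tau> * (Z2 (Complex c \<tau>) / (1 - Z2 (Complex c \<tau>)))))"
    unfolding vertical_integral_def M_def
    by (intro Bochner_Integration.integral_cong refl) (simp add: algebra_simps)
  also have "\<dots> = of_real (ln (real p)) * \<i> * (LINT \<tau>|lborel. M \<tau> * (Z1 (Complex c \<tau>) / (1 - Z1 (Complex c \<tau>))))
     + of_real (ln (real p)) * \<i> * (LINT \<tau>|lborel. M \<tau> * (Z2 (Complex c \<tau>) / (1 - Z2 (Complex c \<tau>))))"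
    by (subst Bochner_Integration.integral_add) (auto simp only: integral_mult_right_zero intro!: integrable_mult_right G1(2) G2(2))
  also have "\<dots> = 2 * of_real pi * \<i> * padic_term p g y"
    unfolding G1(1) G2(1) padic_term_exp[OF p] padic_term_def by (simp add: algebra_simps)
  finally show ?thesis by simp
qed

text \<open>Both halves of the integrand carry the series in \<open>p powr (- s)\<close>, which
  converges for \<open>Re s = 3/2\<close>. In the second half, reflecting \<open>s\<close> to
  \<open>1 - s\<close> turns it into the series in \<open>p powr (s - 1)\<close> on the line
  \<open>Re s = -1/2\<close>, which converges as well.\<close>

lemma W_local_padic_term:
  assumes g: "is_test_function g" and p: "1 < p"
  shows "W_local (Prime_Place p) g = padic_term p g 1"
proof -
  define Z1 where "Z1 = (\<lambda>s::complex. of_real 1 * exp (s * of_real (- ln (real p))))"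
  define Z2 where "Z2 = (\<lambda>s::complex. of_real (1 / real p) * exp (s * of_real (ln (real p))))"
  have lp: "0 < ln (real p)" using p by simp
  have z1: "1 * exp (3/2 * - ln (real p)) < 1" using lp by simp
  have z2: "1 / real p * exp (-1/2 * ln (real p)) < 1"
  proof -
    have "exp (-1/2 * ln (real p)) < 1" using lp by simp
    also have "1 < real p" using p by simp
    finally show ?thesis using p by simp
  qed
  have ip: "0 < 1 / real p" using p by simp
  note G1 = vertical_mellin_geometric[OF g zero_less_one zero_less_one z1 Z1_def]
  note G2 = vertical_mellin_geometric[OF g zero_less_one ip z2 Z2_def]
  let ?f1 = "\<lambda>\<tau>. mellin g (Complex (3/2) \<tau>) * of_real 1 powr (- Complex (3/2) \<tau>) * (Z1 (Complex (3/2) \<tau>) / (1 - Z1 (Complex (3/2) \<tau>)))"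
  let ?f2 = "\<lambda>\<tau>. mellin g (Complex (-1/2) \<tau>) * of_real 1 powr (- Complex (-1/2) \<tau>) * (Z2 (Complex (-1/2) \<tau>) / (1 - Z2 (Complex (-1/2) \<tau>)))"
  have f2: "integrable lborel (\<lambda>\<tau>. ?f2 (0 + (-1) * \<tau>))"
    by (rule lborel_integrable_real_affine[OF G2(2)]) simp
  have f2': "(LINT \<tau>|lborel. ?f2 (0 + (-1) * \<tau>)) = (LINT \<tau>|lborel. ?f2 \<tau>)"
    by (subst (2) lborel_integral_real_affine[where c = "-1" and t = 0]) simp_all
  have main: "- deriv (L_local (Prime_Place p)) (Complex (3/2) \<tau>) / L_local (Prime_Place p) (Complex (3/2) \<tau>) *
       (mellin g (Complex (3/2) \<tau>) + mellin g (1 - Complex (3/2) \<tau>)) * \<i>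
     = of_real (ln (real p)) * \<i> * ?f1 \<tau> + of_real (ln (real p)) * \<i> * ?f2 (0 + (-1) * \<tau>)" for \<tau>
  proof -
    let ?s = "Complex (3/2) \<tau>"
    have s: "0 < Re ?s" by simp
    \<comment> \<open>The reflected line is traversed in the opposite direction, hence the argument
      \<open>(-1) * \<tau>\<close>.\<close>
    have s': "1 - ?s = Complex (-1/2) (0 + (-1) * \<tau>)" by (simp add: complex_eq_iff)
    have A: "- deriv (L_local (Prime_Place p)) ?s / L_local (Prime_Place p) ?s = of_real (ln (real p)) * (of_nat p powr (-?s) / (1 - of_nat p powr (-?s)))"
      using DERIV_imp_deriv[OF L_prime_deriv(2)[OF p s]] L_prime_deriv(3)[OF p s] by (simp del: L_local.simps)
    have w1: "Z1 ?s = of_nat p powr (-?s)" unfolding Z1_def by (rule padic_weights[OF p, symmetric])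
    have w2: "Z2 (1 - ?s) = of_nat p powr (-?s)"
      unfolding Z2_def padic_weights(2)[OF p, symmetric] by simp
    show ?thesis unfolding A s'[symmetric] w1 w2 by (simp add: algebra_simps add_divide_distrib)
  qed
  have "vertical_integral (3 / 2) (\<lambda>s. - deriv (L_local (Prime_Place p)) s / L_local (Prime_Place p) s * (mellin g s + mellin g (1 - s)))
     = of_real (ln (real p)) * \<i> * (LINT \<tau>|lborel. ?f1 \<tau>) + of_real (ln (real p)) * \<i> * (LINT \<tau>|lborel. ?f2 (0 + (-1) * \<tau>))"
    unfolding vertical_integral_def main
    by (subst Bochner_Integration.integral_add) (auto simp only: integral_mult_right_zero intro!: integrable_mult_right G1(2) f2)
  also have "\<dots> = 2 * of_real pi * \<i> * padic_term p g 1"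
    unfolding f2' G1(1) G2(1) padic_term_exp[OF p] padic_term_def by (simp add: algebra_simps)
  finally show ?thesis by (simp add: W_local_def)
qed

section \<open>Analysis on a p-adic field\<close>

locale padic_field =
  fixes p :: nat and \<mu> :: "'a::{field_char_0, complete_space} measure" and \<psi> :: "'a \<Rightarrow> complex"
  assumes prime_p: "prime p" and completion: "is_padic_completion p TYPE('a)"
    and haar: "is_normalized_haar \<mu>" and char: "is_standard_padic_character \<psi>"
begin

lemma p_gt_1: "1 < p" using prime_p prime_gt_1_nat by blast

lemma dist_absv: "dist (x::'a) y = absv (x - y)"
  and absv_mult: "absv (x * y :: 'a) = absv x * absv y"
  and absv_of_rat: "absv (of_rat q :: 'a) = padic_abs p q"
  and closure_rat: "closure (range of_rat) = (UNIV :: 'a set)"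
  using completion unfolding is_padic_completion_def by blast+

lemma absv_nonneg [simp]: "0 \<le> absv x" and absv_eq_0_iff [simp]: "absv x = 0 \<longleftrightarrow> x = 0"
  and absv_0 [simp]: "absv (0::'a) = 0" for x :: 'a
  by (simp_all add: absv_def)

lemma absv_pos: "x \<noteq> 0 \<Longrightarrow> 0 < absv x" for x :: 'a
  using absv_nonneg[of x] absv_eq_0_iff[of x] by linarith

lemma absv_1 [simp]: "absv (1::'a) = 1"
  using absv_mult[of 1 1] absv_eq_0_iff[of 1] by simp

lemma absv_minus [simp]: "absv (- x) = absv x" for x :: 'a
  using dist_absv[of 0 x] by (simp add: absv_def dist_commute)

lemma absv_minus_commute: "absv (x - y) = absv (y - x)" for x y :: 'a
  using absv_minus[of "x - y"] by simp

lemma absv_triangle: "absv (x + y) \<le> absv x + absv y" for x y :: 'a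
  using dist_triangle[of x "- y" 0] dist_absv[of x "-y"] by (simp add: absv_def[symmetric] dist_commute[of 0])

lemma absv_power: "absv (x ^ n) = absv x ^ n" for x :: 'a
  by (induction n) (simp_all add: absv_mult)

lemma absv_inverse: "absv (inverse x) = inverse (absv x)" for x :: 'a
proof (cases "x = 0")
  case False
  then have "absv (inverse x) * absv x = 1" by (simp flip: absv_mult)
  then show ?thesis using False by (simp add: field_simps)
qed simp

lemma absv_divide: "absv (x / y) = absv x / absv y" for x :: 'a
  by (simp add: divide_inverse absv_mult absv_inverse)

lemma absv_power_int: "absv (x powi k) = absv x powi k" for x :: 'a
  by (simp add: power_int_def absv_power absv_inverse)

lemma absv_sum_le: "absv (sum f A) \<le> (\<Sum>i\<in>A. absv (f i))" for f :: "'b \<Rightarrow> 'a"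
proof (induction A rule: infinite_finite_induct)
  case (insert x F)
  then show ?case using absv_triangle[of "f x" "sum f F"] by simp
qed simp_all

lemma absv_of_int:
  "absv (of_int n :: 'a) = (if n = 0 then 0 else real p powi (- int (multiplicity (int p) n)))"
proof -
  have "quotient_of (of_int n) = (n, 1)"
    by (simp add: of_int_rat quotient_of_Fract)
  then have "padic_abs p (of_int n) = (if n = 0 then 0 else real p powi (- int (multiplicity (int p) n)))"
    by (simp add: padic_abs_def)
  then show ?thesis using absv_of_rat[of "of_int n"] by simp
qed

lemma absv_of_int_le_1: "absv (of_int n :: 'a) \<le> 1"
  using p_gt_1 by (auto simp: absv_of_int power_int_minus inverse_eq_divide)

lemma absv_of_nat_le_1: "absv (of_nat n :: 'a) \<le> 1"
  using absv_of_int_le_1[of "int n"] by simp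

lemma absv_p: "absv (of_nat p :: 'a) = 1 / real p"
proof -
  have "multiplicity (int p) (int p) = 1"
    using prime_p by (intro multiplicity_self) (auto simp: prime_nat_iff)
  then show ?thesis
    using absv_of_int[of "int p"] p_gt_1 by (simp add: power_int_minus inverse_eq_divide)
qed

lemma absv_of_int_less_1: "int p dvd n \<Longrightarrow> absv (of_int n :: 'a) < 1"
proof (elim dvdE)
  fix k assume "n = int p * k"
  then have "absv (of_int n :: 'a) = 1 / real p * absv (of_int k :: 'a)" by (simp add: absv_mult absv_p)
  also have "\<dots> \<le> 1 / real p * 1" by (intro mult_left_mono absv_of_int_le_1) simp
  also have "\<dots> < 1" using p_gt_1 by simp
  finally show ?thesis .
qed

lemma absv_of_int_eq_1: "\<not> int p dvd n \<Longrightarrow> absv (of_int n :: 'a) = 1"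
  using absv_of_int[of n] by (auto simp: not_dvd_imp_multiplicity_0)

text \<open>The binomial theorem bounds \<open>\<bar>x + y\<bar> ^ n\<close> by \<open>n + 1\<close> times \<open>max \<bar>x\<bar> \<bar>y\<bar> ^ n\<close> because integers
  have absolute value at most 1.\<close>

lemma absv_ultrametric: "absv (x + y) \<le> max (absv x) (absv y)" for x y :: 'a
proof (rule ccontr)
  define M where "M = max (absv x) (absv y)"
  assume "\<not> absv (x + y) \<le> max (absv x) (absv y)"
  then have less: "M < absv (x + y)" unfolding M_def not_le .
  have M: "0 < M"
  proof (rule ccontr)
    assume "\<not> 0 < M"
    then have "x = 0" "y = 0" using absv_pos[of x] absv_pos[of y] by (auto simp: M_def max_def split: if_splits)
    then show False using less by (simp add: M_def)
  qed
  have xM: "absv x \<le> M" "absv y \<le> M" by (auto simp: M_def)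
  define t where "t = absv (x + y) / M"
  have t: "1 < t" using less M by (simp add: t_def)
  have bound: "t ^ n \<le> real (Suc n)" for n
  proof -
    have "absv (x + y) ^ n = absv (\<Sum>k\<le>n. of_nat (n choose k) * x ^ k * y ^ (n - k))"
      by (simp add: absv_power[symmetric] binomial_ring)
    also have "\<dots> \<le> (\<Sum>k\<le>n. absv (of_nat (n choose k) * x ^ k * y ^ (n - k)))"
      by (rule absv_sum_le)
    also have "\<dots> \<le> (\<Sum>k\<le>n. M ^ n)"
    proof (rule sum_mono)
      fix k assume k: "k \<in> {..n}"
      have "absv (of_nat (n choose k) * x ^ k * y ^ (n - k)) \<le> 1 * M ^ k * M ^ (n - k)"
        unfolding absv_mult absv_power
        using M xM by (intro mult_mono power_mono absv_of_nat_le_1) auto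
      then show "absv (of_nat (n choose k) * x ^ k * y ^ (n - k)) \<le> M ^ n"
        using k by (simp flip: power_add)
    qed
    finally show ?thesis using M by (simp add: t_def power_divide pos_divide_le_eq)
  qed
  \<comment> \<open>Geometric growth against a linear bound: the square of Bernoulli's inequality
    contributes \<open>m\<^sup>2 * (t - 1)\<^sup>2\<close> to a lower bound for
    \<open>t ^ (2 * m)\<close>, and this choice of \<open>m\<close> makes that term exceed
    \<open>2 * m\<close>.\<close>
  obtain m where m: "real m > 2 / (t - 1)\<^sup>2" using reals_Archimedean2 by blast
  have "real m * (t - 1)\<^sup>2 > 2" using m t by (simp add: pos_divide_less_eq)
  then have "m > 0" by (cases m) auto
  have "1 + real m * (t - 1) \<le> t ^ m" using Bernoulli_inequality[of "t - 1" m] t by simp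
  then have "(1 + real m * (t - 1))\<^sup>2 \<le> (t ^ m)\<^sup>2" using t by (intro power_mono) auto
  also have "\<dots> = t ^ (2 * m)" by (simp add: power_mult[symmetric] mult.commute)
  also have "\<dots> \<le> real (Suc (2 * m))" by (rule bound)
  finally have "1 + 2 * real m * (t - 1) + real m * (real m * (t - 1)\<^sup>2) \<le> 2 * real m + 1"
    by (simp add: power2_eq_square algebra_simps)
  moreover have "real m * 2 < real m * (real m * (t - 1)\<^sup>2)"
    using \<open>real m * (t - 1)\<^sup>2 > 2\<close> \<open>m > 0\<close> by (intro mult_strict_left_mono) auto
  moreover have "0 \<le> 2 * real m * (t - 1)" using t by simp
  ultimately show False by linarith
qed

lemma absv_diff_le: "absv (x - y) \<le> max (absv x) (absv y)" for x y :: 'a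
  using absv_ultrametric[of x "- y"] by simp

text \<open>In an ultrametric triangle the two longest sides are equal.\<close>

lemma absv_eq_of_close: "absv (x - y) < absv x \<Longrightarrow> absv y = absv x" for x y :: 'a
  using absv_ultrametric[of "x - y" y] absv_diff_le[of x "x - y"] absv_diff_le[of x y] by (auto simp: max_def split: if_splits)

lemma rat_approx:
  fixes x :: 'a
  assumes "0 < e"
  obtains q where "absv (x - of_rat q) < e"
proof -
  have "x \<in> closure (range of_rat)" by (simp add: closure_rat)
  then obtain q where "dist (of_rat q) x < e" using assms by (auto simp: closure_approachable)
  then show ?thesis using that by (simp add: dist_absv absv_minus_commute)
qed

text \<open>By density a nonzero \<open>x\<close> has a rational closer to it than its own absolute
  value; such a rational has the same absolute value, which is a power of \<open>p\<close> by
  definition.\<close>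

lemma value_group:
  fixes x :: 'a
  assumes "x \<noteq> 0"
  obtains n where "absv x = real p powi n"
proof -
  obtain q where q: "absv (x - of_rat q) < absv x" using rat_approx[OF absv_pos[OF assms]] by blast
  have "padic_abs p q = absv x" using absv_eq_of_close[OF q] by (simp add: absv_of_rat)
  moreover have "q \<noteq> 0" using q by auto
  moreover obtain u v where "quotient_of q = (u, v)" by fastforce
  ultimately have "absv x = real p powi (int (multiplicity (int p) v) - int (multiplicity (int p) u))"
    by (simp add: padic_abs_def)
  then show ?thesis by (rule that)
qed

text \<open>Density reduces the claim to a rational \<open>u / v\<close> with \<open>v\<close> prime
  to \<open>p\<close>, whose residue is \<open>u\<close> times an inverse of \<open>v\<close> modulo
  \<open>p\<close>.\<close>

lemma residue:
  fixes x :: 'a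
  assumes "absv x \<le> 1"
  obtains a where "a < p" "absv (x - of_nat a) < 1"
proof -
  obtain q where q: "absv (x - of_rat q) < 1" using rat_approx[of 1 x] by auto
  have q1: "absv (of_rat q :: 'a) \<le> 1" using absv_diff_le[of x "x - of_rat q"] q assms by simp
  obtain u v where uv: "quotient_of q = (u, v)" by fastforce
  have v: "v > 0" "coprime u v" "q = of_int u / of_int v"
    using uv quotient_of_denom_pos quotient_of_coprime quotient_of_div by auto
  have rv: "(of_rat q :: 'a) * of_int v = of_int u" using v by (simp add: of_rat_divide)
  \<comment> \<open>If \<open>p\<close> divided \<open>v\<close>, coprimality would force
    \<open>|u| = 1\<close>, while \<open>|u| = |q| * |v|\<close> would be smaller than 1 because
    \<open>q\<close> is integral.\<close>
  have "\<not> int p dvd v"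
  proof
    assume pv: "int p dvd v"
    then have "\<not> int p dvd u" using v(2) prime_p by (meson coprime_common_divisor prime_nat_int_transfer not_prime_unit)
    then have "absv (of_int u :: 'a) = 1" by (rule absv_of_int_eq_1)
    moreover have "absv (of_rat q :: 'a) * absv (of_int v :: 'a) = absv (of_int u :: 'a)" by (metis absv_mult rv)
    moreover have "absv (of_rat q :: 'a) * absv (of_int v :: 'a) \<le> 1 * absv (of_int v :: 'a)"
      using q1 by (intro mult_right_mono) auto
    ultimately show False using absv_of_int_less_1[OF pv] by simp
  qed
  then have cop: "coprime v (int p)" using prime_p
    by (metis coprime_commute prime_imp_coprime prime_nat_int_transfer)
  then obtain w where w: "[v * w = 1] (mod int p)" using cong_solve_coprime_int by blast
  define a where "a = nat ((u * w) mod int p)"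
  have a: "int a = (u * w) mod int p" using p_gt_1 by (simp add: a_def)
  have "[v * int a = v * (u * w)] (mod int p)" unfolding a by (simp add: cong_def mod_mult_right_eq)
  also have "v * (u * w) = u * (v * w)" by simp
  also have "[u * (v * w) = u * 1] (mod int p)" using w by (rule cong_scalar_left)
  finally have dvd: "int p dvd v * int a - u" by (simp add: cong_iff_dvd_diff)
  have av: "absv (of_int v :: 'a) = 1" using \<open>\<not> int p dvd v\<close> by (rule absv_of_int_eq_1)
  have "(of_nat a - of_rat q :: 'a) * of_int v = of_int (v * int a - u)"
    using rv by (simp add: left_diff_distrib right_diff_distrib mult.commute)
  then have "absv (of_nat a - of_rat q :: 'a) * absv (of_int v :: 'a) = absv (of_int (v * int a - u) :: 'a)"
    by (metis absv_mult)
  then have "absv (of_nat a - of_rat q :: 'a) < 1" using absv_of_int_less_1[OF dvd] av by simp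
  then have "absv (x - of_nat a) < 1"
    using absv_diff_le[of "x - of_rat q" "of_nat a - of_rat q"] q by simp
  moreover have "a < p" using p_gt_1 by (simp add: a_def nat_less_iff)
  ultimately show ?thesis using that by blast
qed

section \<open>Balls, their Haar measure and the transforms of their indicators\<close>

abbreviation pw :: "int \<Rightarrow> real" where "pw k \<equiv> real p powi k"

definition B :: "int \<Rightarrow> 'a set" where "B k = {x. absv x \<le> pw k}"

text \<open>The exponent is negated because \<open>|p| = 1 / p\<close>; thus \<open>scale k\<close>
  has absolute value \<open>pw k\<close>, and multiplication by it maps the ring of integers onto
  \<open>B k\<close>.\<close>

definition scale :: "int \<Rightarrow> 'a" where "scale k = of_nat p powi (- k)"

lemma pw_pos [simp]: "0 < pw k" using p_gt_1 by (simp add: zero_less_power_int)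

lemma pw_le_iff [simp]: "pw k \<le> pw m \<longleftrightarrow> k \<le> m" and pw_less_iff [simp]: "pw k < pw m \<longleftrightarrow> k < m"
proof -
  have 1: "k < m \<Longrightarrow> pw k < pw m" for k m
    using p_gt_1 by (intro power_int_strict_increasing) auto
  show "pw k \<le> pw m \<longleftrightarrow> k \<le> m" "pw k < pw m \<longleftrightarrow> k < m"
    using 1[of k m] 1[of m k] by (cases k m rule: linorder_cases; force)+
qed

lemma pw_add: "pw (k + m) = pw k * pw m"
  using p_gt_1 by (simp add: power_int_add)

lemma ln_pw: "ln (pw k) = real_of_int k * ln (real p)"
  using p_gt_1 by (simp add: powr_real_of_int'[symmetric] ln_powr)

lemma absv_scale: "absv (scale k) = pw k" and scale_nonzero: "scale k \<noteq> 0"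
proof -
  show a: "absv (scale k) = pw k"
  proof -
    have "absv (scale k) = inverse (real p) powi (- k)"
      by (simp only: scale_def absv_power_int absv_p inverse_eq_divide)
    then show ?thesis by (simp add: power_int_inverse power_int_minus)
  qed
  then show "scale k \<noteq> 0" using pw_pos[of k] absv_eq_0_iff by force
qed

text \<open>The absolute value takes only the values 0 and \<open>pw n\<close>, so an open ball is
  the closed ball with the next smaller radius.\<close>

lemma absv_less_pw_iff: "absv x < pw k \<longleftrightarrow> absv x \<le> pw (k - 1)" for x :: 'a
proof (cases "x = 0")
  case False
  then obtain n where "absv x = pw n" by (rule value_group)
  then show ?thesis by auto
qed (use pw_pos in \<open>auto simp: less_imp_le\<close>)

lemma mem_B_iff: "absv x = pw n \<Longrightarrow> x \<in> B k \<longleftrightarrow> n \<le> k"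
  by (simp add: B_def)

lemma zero_mem_B [simp]: "0 \<in> B k" by (simp add: B_def less_imp_le)

lemma B_minus [simp]: "- x \<in> B k \<longleftrightarrow> x \<in> B k" by (simp add: B_def)

lemma B_0: "B 0 = integer_ring" by (simp add: B_def integer_ring_def)

lemma sets_mu [measurable_cong, simp]: "sets \<mu> = sets borel"
  using haar by (simp add: is_normalized_haar_def)

lemma space_mu [simp]: "space \<mu> = UNIV"
  using sets_eq_imp_space_eq[OF sets_mu] by simp

lemma B_closed: "closed (B k)"
proof -
  have "B k = cball 0 (pw k)" by (auto simp: B_def absv_def dist_commute)
  then show ?thesis by simp
qed

lemma B_sets [measurable, simp]: "B k \<in> sets borel"
  by (intro borel_closed B_closed)

lemma continuous_translate: "continuous_on UNIV (\<lambda>x::'a. a + x)"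
  unfolding continuous_on_iff by (auto simp: dist_absv)

lemma continuous_mult: "continuous_on UNIV (\<lambda>x::'a. x * a)"
proof (cases "a = 0")
  case False
  show ?thesis
    unfolding continuous_on_iff
  proof (intro ballI allI impI)
    fix x :: 'a and e :: real assume "0 < e"
    then show "\<exists>d>0. \<forall>y\<in>UNIV. dist y x < d \<longrightarrow> dist (y * a) (x * a) < e"
      using absv_pos[OF False]
      by (intro exI[of _ "e / absv a"]) (auto simp: dist_absv absv_mult pos_less_divide_eq simp flip: left_diff_distrib)
  qed
qed simp

lemma measurable_translate [measurable]: "(\<lambda>x::'a. a + x) \<in> borel_measurable borel"
  by (intro borel_measurable_continuous_onI continuous_translate)

lemma measurable_psi_mult [measurable]: "(\<lambda>x. \<psi> (x * y)) \<in> borel_measurable borel"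
proof -
  have "continuous_on UNIV \<psi>"
    using char by (simp add: is_standard_padic_character_def is_additive_character_def)
  then show ?thesis
    by (intro borel_measurable_continuous_onI continuous_on_compose2[OF _ continuous_mult]) auto
qed

lemma psi_add: "\<psi> (x + y) = \<psi> x * \<psi> y" and psi_norm [simp]: "norm (\<psi> x) = 1"
  and psi_integer: "absv x \<le> 1 \<Longrightarrow> \<psi> x = 1"
  using char by (auto simp: is_standard_padic_character_def is_additive_character_def integer_ring_def)

lemma distr_translate: "distr \<mu> borel (\<lambda>x. a + x) = \<mu>"
  using haar by (simp add: is_normalized_haar_def)

lemma emeasure_translate: "S \<in> sets borel \<Longrightarrow> emeasure \<mu> ((\<lambda>x. a + x) -` S) = emeasure \<mu> S"
  by (subst (2) distr_translate[of a, symmetric], subst emeasure_distr) auto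

lemma integral_translate:
  fixes f :: "'a \<Rightarrow> complex"
  assumes [measurable]: "f \<in> borel_measurable borel"
  shows "(LINT x|\<mu>. f (a + x)) = (LINT x|\<mu>. f x)"
  by (subst (2) distr_translate[of a, symmetric], subst integral_distr) auto

text \<open>\<open>B k\<close> is the disjoint union of \<open>p\<close> translates of
  \<open>B (k - 1)\<close>, centred at \<open>scale k * a\<close> for \<open>a < p\<close>.
  Existence of residues gives the covering; disjointness holds because \<open>p\<close> does not
  divide a difference of two distinct digits.\<close>

lemma emeasure_B_step: "emeasure \<mu> (B k) = of_nat p * emeasure \<mu> (B (k - 1))"
proof -
  define C where "C a = (\<lambda>x. - (scale k * of_nat a) + x) -` B (k - 1)" for a
  have C: "x \<in> C a \<longleftrightarrow> absv (x - scale k * of_nat a) < pw k" for x a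
    by (simp add: C_def B_def absv_less_pw_iff)
  have U: "B k = (\<Union>a\<in>{..<p}. C a)"
  proof (intro equalityI subsetI)
    fix x assume "x \<in> B k"
    then have "absv (x / scale k) \<le> 1"
      by (simp add: B_def absv_divide absv_scale)
    then obtain a where a: "a < p" "absv (x / scale k - of_nat a) < 1" by (rule residue)
    have "absv (scale k) * absv (x / scale k - of_nat a) < pw k"
      using a by (simp add: absv_scale)
    then have "absv (x - scale k * of_nat a) < pw k"
      using scale_nonzero[of k] by (simp add: absv_mult[symmetric] right_diff_distrib)
    then show "x \<in> (\<Union>a\<in>{..<p}. C a)" using a C by auto
  next
    fix x assume "x \<in> (\<Union>a\<in>{..<p}. C a)"
    then obtain a where "absv (x - scale k * of_nat a) < pw k" using C by auto
    moreover have "absv (scale k * of_nat a) \<le> pw k"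
      using absv_of_nat_le_1[of a] by (simp add: absv_mult absv_scale mult_left_le)
    ultimately show "x \<in> B k"
      using absv_ultrametric[of "x - scale k * of_nat a" "scale k * of_nat a"] by (auto simp: B_def)
  qed
  have dis: "disjoint_family_on C {..<p}"
    unfolding disjoint_family_on_def
  proof (intro ballI impI, rule ccontr)
    fix a b assume ab: "a \<in> {..<p}" "b \<in> {..<p}" "a \<noteq> b" and "C a \<inter> C b \<noteq> {}"
    then obtain x where x: "absv (x - scale k * of_nat a) < pw k" "absv (x - scale k * of_nat b) < pw k"
      using C by auto
    have "absv (scale k * (of_nat b - of_nat a)) < pw k"
      using absv_diff_le[of "x - scale k * of_nat a" "x - scale k * of_nat b"] x
      by (simp add: right_diff_distrib)
    then have "absv (of_int (int b - int a) :: 'a) < 1"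
      by (simp add: absv_mult absv_scale)
    then have "int p dvd int b - int a" using absv_of_int_eq_1[of "int b - int a"] by fastforce
    then show False using ab zdvd_imp_le[of "int p" "\<bar>int b - int a\<bar>"] by auto
  qed
  have "emeasure \<mu> (B k) = (\<Sum>a<p. emeasure \<mu> (C a))"
    unfolding U
  proof (rule sum_emeasure[symmetric])
    have "C a \<in> sets borel" for a
      unfolding C_def using measurable_sets[OF measurable_translate[of "- (scale k * of_nat a)"] B_sets]
      by (simp only: space_borel Int_UNIV_right)
    then show "C ` {..<p} \<subseteq> sets \<mu>" by auto
  qed (use dis in auto)
  also have "\<dots> = (\<Sum>a<p. emeasure \<mu> (B (k - 1)))"
    unfolding C_def by (intro sum.cong refl emeasure_translate B_sets)
  finally show ?thesis by simp
qed

lemma emeasure_B: "emeasure \<mu> (B k) = ennreal (pw k)"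
proof (induction k rule: int_induct[where k = 0])
  case base
  then show ?case using haar by (simp add: B_0 is_normalized_haar_def)
next
  case (step1 i)
  then show ?case using emeasure_B_step[of "i + 1"] pw_add[of i 1]
    by (simp add: ennreal_of_nat_eq_real_of_nat ennreal_mult[symmetric] less_imp_le mult.commute)
next
  case (step2 i)
  have "ennreal (real p) * emeasure \<mu> (B (i - 1)) = ennreal (real p) * ennreal (pw (i - 1))"
    using step2 emeasure_B_step[of i] pw_add[of "i - 1" 1]
    by (simp add: ennreal_of_nat_eq_real_of_nat ennreal_mult[symmetric] less_imp_le mult.commute)
  then show ?case using p_gt_1 by (subst (asm) ennreal_mult_cancel_left) auto
qed

lemma measure_B: "measure \<mu> (B k) = pw k"
  by (simp add: measure_def emeasure_B less_imp_le)

lemma integrable_B: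
  fixes f :: "'a \<Rightarrow> complex"
  assumes [measurable]: "f \<in> borel_measurable borel" and "\<And>x. norm (f x) \<le> C"
  shows "integrable \<mu> (\<lambda>x. indicator (B k) x *\<^sub>R f x)"
  using assms by (intro integrableI_bounded_set_indicator[where B = C]) (auto simp: emeasure_B)

text \<open>The origin lies in balls of arbitrarily small measure. Almost everywhere, then,
  \<open>absv x\<close> is a power of \<open>p\<close> and the logarithm has its proper
  value.\<close>

lemma AE_nonzero: "AE x in \<mu>. x \<noteq> 0"
proof -
  have "emeasure \<mu> {0} \<le> 0"
  proof (rule ennreal_le_epsilon)
    fix e :: real assume e: "0 < e"
    obtain n where n: "(1 / real p) ^ n < e" using real_arch_pow_inv[of e "1 / real p"] e p_gt_1 by auto
    have "emeasure \<mu> {0} \<le> emeasure \<mu> (B (- int n))" by (intro emeasure_mono) auto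
    also have "\<dots> = ennreal ((1 / real p) ^ n)"
      by (simp add: emeasure_B power_int_minus power_one_over inverse_eq_divide)
    also have "\<dots> \<le> ennreal e" using n by (intro ennreal_leI) simp
    finally show "emeasure \<mu> {0} \<le> 0 + ennreal e" by simp
  qed
  then have "{0} \<in> null_sets \<mu>" by (auto simp: null_sets_def)
  then show ?thesis by (rule AE_I') auto
qed

text \<open>Orthogonality: for \<open>y\<close> in the dual ball \<open>B (- k)\<close> the
  character is 1 on \<open>B k\<close>. Otherwise it differs from 1 at some point of
  \<open>B k\<close>, and translating by that point multiplies the integral by a number other than
  1, which forces it to be 0.\<close>

lemma integral_B_psi:
  "(LINT x|\<mu>. indicator (B k) x *\<^sub>R \<psi> (x * y)) = of_real (pw k * indicator (B (- k)) y)"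
proof (cases "y \<in> B (- k)")
  case True
  have "indicator (B k) x *\<^sub>R \<psi> (x * y) = indicator (B k) x *\<^sub>R 1" for x
  proof (cases "x \<in> B k")
    case x: True
    have "absv (x * y) \<le> pw k * pw (- k)"
      using x True unfolding absv_mult B_def by (intro mult_mono) (auto simp: less_imp_le)
    also have "\<dots> = 1" by (simp flip: pw_add)
    finally show ?thesis by (simp add: psi_integer)
  qed simp
  then have "(LINT x|\<mu>. indicator (B k) x *\<^sub>R \<psi> (x * y)) = (LINT x|\<mu>. indicator (B k) x *\<^sub>R 1)"
    by (simp only:)
  moreover have "has_bochner_integral \<mu> (\<lambda>x. indicator (B k) x *\<^sub>R (1::complex)) (measure \<mu> (B k) *\<^sub>R 1)"
    by (rule has_bochner_integral_indicator) (auto simp: emeasure_B)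
  ultimately show ?thesis
    using True by (simp add: has_bochner_integral_iff measure_B scaleR_conv_of_real del: integral_complex_of_real)
next
  case False
  then have y: "absv y > pw (- k)" by (simp add: B_def)
  \<comment> \<open>The products \<open>x * y\<close> with \<open>x\<close> in \<open>B k\<close>
    form the fractional ideal generated by \<open>a\<close>. It is strictly larger than the ring of
    integers, so a standard character is not trivial on it.\<close>
  define a where "a = scale k * y"
  have "pw k * pw (- k) < pw k * absv y" using y by (intro mult_strict_left_mono) auto
  then have a: "1 < absv a" by (simp add: a_def absv_mult absv_scale flip: pw_add)
  have a0: "a \<noteq> 0" using a by auto
  have "integer_ring \<subset> (\<lambda>x. a * x) ` integer_ring"
  proof (rule psubsetI)
    show "integer_ring \<subseteq> (\<lambda>x. a * x) ` integer_ring"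
    proof
      fix x :: 'a assume "x \<in> integer_ring"
      then have "absv (x / a) \<le> 1"
        using a by (simp add: integer_ring_def absv_divide)
      then show "x \<in> (\<lambda>x. a * x) ` integer_ring"
        using a0 by (intro image_eqI[of _ _ "x / a"]) (auto simp: integer_ring_def)
    qed
    have "a \<in> (\<lambda>x. a * x) ` integer_ring" by (rule image_eqI[of _ _ 1]) (auto simp: integer_ring_def)
    moreover have "a \<notin> integer_ring" using a by (simp add: integer_ring_def)
    ultimately show "integer_ring \<noteq> (\<lambda>x. a * x) ` integer_ring" by blast
  qed
  then obtain z where z: "absv z \<le> 1" "\<psi> (a * z) \<noteq> 1"
    using char unfolding is_standard_padic_character_def integer_ring_def by blast
  define x0 where "x0 = scale k * z"
  have x0: "x0 \<in> B k" "\<psi> (x0 * y) \<noteq> 1"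
    using z by (auto simp: x0_def a_def B_def absv_mult absv_scale mult_ac mult_left_le)
  have inv: "x0 + x \<in> B k \<longleftrightarrow> x \<in> B k" for x
    using x0(1) absv_ultrametric[of x0 x] absv_diff_le[of "x0 + x" x0] by (auto simp: B_def)
  have "(LINT x|\<mu>. indicator (B k) x *\<^sub>R \<psi> (x * y)) = (LINT x|\<mu>. indicator (B k) (x0 + x) *\<^sub>R \<psi> ((x0 + x) * y))"
    by (subst integral_translate) auto
  also have "(\<lambda>x. indicator (B k) (x0 + x) *\<^sub>R \<psi> ((x0 + x) * y)) = (\<lambda>x. \<psi> (x0 * y) * (indicator (B k) x *\<^sub>R \<psi> (x * y)))"
    using inv by (auto simp: indicator_def distrib_right psi_add)
  also have "(LINT x|\<mu>. \<psi> (x0 * y) * (indicator (B k) x *\<^sub>R \<psi> (x * y))) = \<psi> (x0 * y) * (LINT x|\<mu>. indicator (B k) x *\<^sub>R \<psi> (x * y))"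
    by (rule integral_mult_right_zero)
  finally have "(LINT x|\<mu>. indicator (B k) x *\<^sub>R \<psi> (x * y)) = 0" using x0(2) by simp
  then show ?thesis using False by simp
qed


context
  fixes g :: "real \<Rightarrow> complex" and S :: "int set"
  assumes finS: "finite S" and g_zero: "\<And>k. k \<notin> S \<Longrightarrow> g (pw k) = 0"
begin

text \<open>The lifted function is constant on spheres, and a sphere is the difference of two
  consecutive balls. At 0, which lies in every ball, all differences cancel, in agreement with the
  value 0 assigned there.\<close>

lemma lift_abs_eq:
  "lift_abs g y = (\<Sum>k\<in>S. g (pw k) * (indicator (B k) y *\<^sub>R 1 - indicator (B (k - 1)) y *\<^sub>R 1))" for y :: 'a
proof (cases "y = 0")
  case True
  then show ?thesis by (simp add: lift_abs_def)
next
  case False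
  then obtain n where n: "absv y = pw n" by (rule value_group)
  have "(\<Sum>k\<in>S. g (pw k) * (indicator (B k) y *\<^sub>R 1 - indicator (B (k - 1)) y *\<^sub>R 1))
      = (\<Sum>k\<in>S. if n = k then g (pw k) else 0)"
    by (intro sum.cong refl) (auto simp: indicator_def mem_B_iff[OF n])
  also have "\<dots> = g (pw n)" using finS g_zero[of n] by simp
  finally show ?thesis using False by (simp add: lift_abs_def n)
qed

lemma measurable_lift_abs [measurable]: "(lift_abs g :: 'a \<Rightarrow> complex) \<in> borel_measurable borel"
  unfolding lift_abs_eq[abs_def] by measurable

lemma lift_abs_minus: "lift_abs g (- y) = lift_abs g y" for y :: 'a
  by (simp add: lift_abs_def)

lemma inverse_fourier_lift_abs:
  "inverse_fourier \<mu> \<psi> (lift_abs g) x =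
     (\<Sum>k\<in>S. g (pw k) * (of_real (pw k * indicator (B (- k)) x) - of_real (pw (k - 1) * indicator (B (1 - k)) x)))"
proof -
  have i: "integrable \<mu> (\<lambda>y. indicator (B k) y *\<^sub>R \<psi> (y * - x))" for k
    by (rule integrable_B[OF measurable_psi_mult, where C = 1]) simp
  have "inverse_fourier \<mu> \<psi> (lift_abs g) x =
    (LINT y|\<mu>. (\<Sum>k\<in>S. g (pw k) * (indicator (B k) y *\<^sub>R \<psi> (y * - x) - indicator (B (k - 1)) y *\<^sub>R \<psi> (y * - x))))"
    unfolding inverse_fourier_def lift_abs_eq sum_distrib_right
    by (intro Bochner_Integration.integral_cong sum.cong refl) (simp add: algebra_simps)
  also have "\<dots> = (\<Sum>k\<in>S. g (pw k) * ((LINT y|\<mu>. indicator (B k) y *\<^sub>R \<psi> (y * - x)) - (LINT y|\<mu>. indicator (B (k - 1)) y *\<^sub>R \<psi> (y * - x))))"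
    by (subst Bochner_Integration.integral_sum)
       (auto intro!: sum.cong integrable_mult_right Bochner_Integration.integrable_diff i simp only: integral_mult_right_zero Bochner_Integration.integral_diff[OF i i])
  finally show ?thesis
    unfolding integral_B_psi by (simp add: indicator_def)
qed

text \<open>Translation by \<open>y\<close> and evenness of the lifted function. This is what
  identifies the convolution with \<open>G_dist\<close> with the Fourier transform in the second
  form of the theorem.\<close>

lemma fourier_reflected_lift_abs:
  "fourier \<mu> \<psi> (\<lambda>u. lift_abs g (y - u)) x = \<psi> (x * y) * inverse_fourier \<mu> \<psi> (lift_abs g) x"
proof -
  have "fourier \<mu> \<psi> (\<lambda>u. lift_abs g (y - u)) x = (LINT u|\<mu>. lift_abs g (- y + u) * \<psi> (u * x))"
    unfolding fourier_def using lift_abs_minus[of "y - _"] by (simp add: algebra_simps)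
  also have "\<dots> = (LINT u|\<mu>. lift_abs g (- y + (y + u)) * \<psi> ((y + u) * x))"
    by (subst integral_translate[of _ y])
      (rule borel_measurable_times[OF measurable_compose[OF measurable_translate measurable_lift_abs] measurable_psi_mult], rule refl)
  also have "\<dots> = (LINT u|\<mu>. \<psi> (x * y) * (lift_abs g u * \<psi> (- (u * - x))))"
    by (simp add: algebra_simps psi_add)
  also have "\<dots> = \<psi> (x * y) * inverse_fourier \<mu> \<psi> (lift_abs g) (- x)"
    unfolding inverse_fourier_def by (subst integral_mult_right_zero) (simp add: mult.commute)
  also have "inverse_fourier \<mu> \<psi> (lift_abs g) (- x) = inverse_fourier \<mu> \<psi> (lift_abs g) x"
    unfolding inverse_fourier_lift_abs by (simp add: indicator_def)
  finally show ?thesis .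
qed

lemma distribution_conv_G_dist:
  "distribution_conv (G_dist \<mu> \<psi>) (lift_abs g) y =
     fourier \<mu> \<psi> (\<lambda>x. minus_log_abs x * inverse_fourier \<mu> \<psi> (lift_abs g) x) y"
  unfolding distribution_conv_def G_dist_def distribution_fourier_def distribution_of_def
    fourier_reflected_lift_abs
  unfolding fourier_def by (simp add: mult_ac)

end

section \<open>The logarithm on balls and the comparison with the explicit formula\<close>

definition log_ball :: "int \<Rightarrow> 'a \<Rightarrow> complex" where
  "log_ball m y = (LINT x|\<mu>. minus_log_abs x * (indicator (B m) x *\<^sub>R \<psi> (x * y)))"

lemma measurable_minus_log_abs [measurable]: "(minus_log_abs :: 'a \<Rightarrow> complex) \<in> borel_measurable borel"
proof -
  have "continuous_on UNIV (absv :: 'a \<Rightarrow> real)"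
    unfolding absv_def by (intro continuous_intros)
  then have [measurable]: "(absv :: 'a \<Rightarrow> real) \<in> borel_measurable borel"
    by (rule borel_measurable_continuous_onI)
  show ?thesis unfolding minus_log_abs_def[abs_def] by measurable
qed

text \<open>On the ball \<open>B m\<close>, \<open>- log \<bar>x\<bar>\<close> is \<open>- m log p\<close> plus \<open>log p\<close> times the number of smaller balls containing \<open>x\<close>.\<close>

lemma log_ball_aux:
  fixes y :: 'a
  assumes y: "absv y = pw n"
  shows "integrable \<mu> (\<lambda>x. minus_log_abs x * (indicator (B m) x *\<^sub>R \<psi> (x * y)))"
    and "log_ball m y = of_real (- real_of_int m * ln (real p) * (if m \<le> - n then pw m else 0)
           + ln (real p) * (pw (min (m - 1) (- n)) * (real p / (real p - 1))))"
proof -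
  \<comment> \<open>The balls start at \<open>B (m - 1)\<close>, so that a point with absolute value
    \<open>pw k\<close>, \<open>k \<le> m\<close>, lies in exactly \<open>m - k\<close> of
    them.\<close>
  define f where "f j x = indicator (B (m - 1 - int j)) x *\<^sub>R \<psi> (x * y)" for j :: nat and x
  have [measurable]: "f j \<in> borel_measurable borel" for j unfolding f_def by measurable
  have f_int: "integrable \<mu> (f j)" for j
    unfolding f_def by (rule integrable_B[where C = 1]) auto
  have pwj: "pw (a - int j) = pw a * (1 / real p) ^ j" for a j
    using p_gt_1 by (simp add: power_int_diff divide_inverse power_inverse)
  have fsum: "(\<lambda>j. f j x) sums (of_nat (nat (m - k)) * (indicator (B m) x *\<^sub>R \<psi> (x * y)))"
    if x: "absv x = pw k" for x k
  proof -
    have "(\<lambda>j. f j x) sums (\<Sum>j<nat (m - k). f j x)"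
      by (rule sums_finite) (auto simp: f_def mem_B_iff[OF x])
    also have "(\<Sum>j<nat (m - k). f j x) = (\<Sum>j<nat (m - k). \<psi> (x * y))"
      by (intro sum.cong refl) (auto simp: f_def mem_B_iff[OF x])
    also have "\<dots> = of_nat (nat (m - k)) * (indicator (B m) x *\<^sub>R \<psi> (x * y))"
      by (auto simp: mem_B_iff[OF x] indicator_def)
    finally show ?thesis .
  qed
  have nf: "norm (f j x) = indicator (B (m - 1 - int j)) x" for j x
    by (simp add: f_def)
  have s1: "AE x in \<mu>. summable (\<lambda>j. norm (f j x))"
    using AE_nonzero
  proof eventually_elim
    case (elim x)
    then obtain k where k: "absv x = pw k" by (rule value_group)
    show ?case
      by (rule summable_finite[of "{..<nat (m - k)}"]) (auto simp: nf mem_B_iff[OF k])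
  qed
  have "(LINT x|\<mu>. norm (f j x)) = pw (m - 1) * (1 / real p) ^ j" for j
    unfolding nf by (simp add: measure_B pwj)
  then have s2: "summable (\<lambda>j. LINT x|\<mu>. norm (f j x))"
    using p_gt_1 by (simp add: summable_mult summable_geometric)
  note F = integrable_suminf[OF f_int s1 s2] sums_integral[OF f_int s1 s2]
  let ?h = "\<lambda>x. of_real (- real_of_int m * ln (real p)) * (indicator (B m) x *\<^sub>R \<psi> (x * y)) + of_real (ln (real p)) * (\<Sum>j. f j x)"
  have B_int: "integrable \<mu> (\<lambda>x. indicator (B m) x *\<^sub>R \<psi> (x * y))"
    by (rule integrable_B[where C = 1]) auto
  have h_int: "integrable \<mu> ?h"
    by (intro Bochner_Integration.integrable_add integrable_mult_right F B_int)
  have ae: "AE x in \<mu>. minus_log_abs x * (indicator (B m) x *\<^sub>R \<psi> (x * y)) = ?h x"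
    using AE_nonzero
  proof eventually_elim
    case (elim x)
    then obtain k where k: "absv x = pw k" by (rule value_group)
    have lnk: "ln (pw k) = real_of_int k * ln (real p)"
      by (rule ln_pw)
    show ?case
    proof (cases "x \<in> B m")
      case True
      then have "k \<le> m" by (simp add: mem_B_iff[OF k])
      show ?thesis
      proof -
        have fs: "(\<Sum>j. f j x) = of_int (m - k) * \<psi> (x * y)"
          using True \<open>k \<le> m\<close> sums_unique[OF fsum[OF k]] by simp
        show ?thesis using True unfolding fs by (simp add: minus_log_abs_def k lnk algebra_simps)
      qed
    next
      case False
      then show ?thesis using sums_unique[OF fsum[OF k]] by simp
    qed
  qed
  show "integrable \<mu> (\<lambda>x. minus_log_abs x * (indicator (B m) x *\<^sub>R \<psi> (x * y)))"
    using h_int by (subst integrable_cong_AE[OF _ _ ae]) auto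
  have "log_ball m y = (LINT x|\<mu>. ?h x)"
    unfolding log_ball_def using ae by (intro integral_cong_AE) auto
  also have "\<dots> = of_real (- real_of_int m * ln (real p)) * (LINT x|\<mu>. indicator (B m) x *\<^sub>R \<psi> (x * y))
      + of_real (ln (real p)) * (LINT x|\<mu>. (\<Sum>j. f j x))"
    by (subst Bochner_Integration.integral_add[OF integrable_mult_right[OF B_int] integrable_mult_right[OF F(1)]])
       (simp only: integral_mult_right_zero)
  also have "(LINT x|\<mu>. (\<Sum>j. f j x)) = of_real (pw (min (m - 1) (- n)) * (real p / (real p - 1)))"
  proof (rule sums_unique2[OF F(2)])
    \<comment> \<open>\<open>t\<close> is the first index at which \<open>y\<close> belongs to the
      dual of \<open>B (m - 1 - int j)\<close>. The sum is a geometric tail with ratio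
      \<open>1 / p\<close> from there on; truncation by \<open>nat\<close> covers the case in which
      no term is lost and produces the minimum in the result.\<close>
    define t where "t = nat (m - 1 + n)"
    have v: "integral\<^sup>L \<mu> (f j) = of_real (if t \<le> j then pw (m - 1) * (1 / real p) ^ j else 0)" for j
      unfolding f_def integral_B_psi by (auto simp: pwj mem_B_iff[OF y] t_def indicator_def)
    have "(\<lambda>j. pw (m - 1) * (1 / real p) ^ t * (1 / real p) ^ j) sums (pw (m - 1) * (1 / real p) ^ t * (1 / (1 - 1 / real p)))"
      using p_gt_1 by (intro sums_mult geometric_sums) auto
    also have "(\<lambda>j. pw (m - 1) * (1 / real p) ^ t * (1 / real p) ^ j) = (\<lambda>j. if t \<le> j + t then pw (m - 1) * (1 / real p) ^ (j + t) else 0)"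
      by (auto simp: power_add)
    also have "pw (m - 1) * (1 / real p) ^ t = pw (min (m - 1) (- n))"
      unfolding pwj[symmetric] t_def by (rule arg_cong[of _ _ pw]) auto
    also have "1 / (1 - 1 / real p) = real p / (real p - 1)" using p_gt_1 by (simp add: field_simps)
    finally have "(\<lambda>j. if t \<le> j then pw (m - 1) * (1 / real p) ^ j else 0) sums (pw (min (m - 1) (- n)) * (real p / (real p - 1)))"
      by (subst (asm) sums_iff_shift) simp
    then show "(\<lambda>j. integral\<^sup>L \<mu> (f j)) sums of_real (pw (min (m - 1) (- n)) * (real p / (real p - 1)))"
      unfolding v by (rule sums_of_real)
  qed
  finally show "log_ball m y = of_real (- real_of_int m * ln (real p) * (if m \<le> - n then pw m else 0)
           + ln (real p) * (pw (min (m - 1) (- n)) * (real p / (real p - 1))))"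
    unfolding integral_B_psi by (simp add: mem_B_iff[OF y] indicator_def)
qed

text \<open>Pairs the transform of the sphere of radius \<open>pw k\<close> with
  \<open>- ln |x|\<close>. Spheres outside that of \<open>y\<close> receive weight
  \<open>ln p\<close> and those inside \<open>ln p * pw (k - n)\<close>, as in
  \<open>padic_term\<close>; the value \<open>n * ln p = ln |y|\<close> on the sphere of
  \<open>y\<close> itself will cancel the summand
  \<open>minus_log_abs y * lift_abs g y\<close>.\<close>

lemma log_ball_difference:
  fixes y :: 'a
  assumes y: "absv y = pw n"
  shows "of_real (pw k) * log_ball (- k) y - of_real (pw (k - 1)) * log_ball (1 - k) y =
     of_real (ln (real p) * (if k > n then 1 else if k = n then real_of_int n else pw (k - n)))"
proof -
  have P: "real p > 1" using p_gt_1 by simp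
  have e: "pw (k - 1) = pw k / real p" "pw (- k - 1) = 1 / pw k / real p" "pw (1 - k) = real p / pw k" "pw (- k) = 1 / pw k" "pw (k - n) = pw k / pw n" "pw (- n) = 1 / pw n"
    using P by (simp_all add: power_int_diff power_int_minus divide_inverse)
  consider "k > n" | "k = n" | "k < n" by linarith
  then have "pw k * (- real_of_int (- k) * ln (real p) * (if - k \<le> - n then pw (- k) else 0)
           + ln (real p) * (pw (min (- k - 1) (- n)) * (real p / (real p - 1))))
      - pw (k - 1) * (- real_of_int (1 - k) * ln (real p) * (if 1 - k \<le> - n then pw (1 - k) else 0)
           + ln (real p) * (pw (min (1 - k - 1) (- n)) * (real p / (real p - 1))))
     = ln (real p) * (if k > n then 1 else if k = n then real_of_int n else pw (k - n))"
  proof cases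
    case 1
    then have "min (- k - 1) (- n) = - k - 1" "min (1 - k - 1) (- n) = - k" by auto
    \<comment> \<open>The quotient \<open>p / (p - 1)\<close> is abstracted to \<open>r\<close>: the
      two geometric tails cancel here whatever \<open>r\<close> is. Only for \<open>k < n\<close>
      does its value matter.\<close>
    moreover have "pw k * (real_of_int k * L * (1 / pw k) + L * (1 / pw k / real p * r))
        - pw k / real p * ((real_of_int k - 1) * L * (real p / pw k) + L * (1 / pw k * r)) = L" for L r
      using P pw_pos[of k] by (simp add: field_simps)
    from this[of "ln (real p)" "real p / (real p - 1)"]
    have "pw k * (real_of_int k * ln (real p) * pw (- k) + ln (real p) * (pw (- k - 1) * (real p / (real p - 1))))
        - pw (k - 1) * ((real_of_int k - 1) * ln (real p) * pw (1 - k) + ln (real p) * (pw (- k) * (real p / (real p - 1)))) = ln (real p)"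
      unfolding e .
    ultimately show ?thesis using 1 by simp
  next
    case 2
    then have "min (- k - 1) (- n) = - k - 1" "min (1 - k - 1) (- n) = - k" by auto
    moreover have "pw k * (real_of_int k * L * (1 / pw k) + L * (1 / pw k / real p * r))
        - pw k / real p * (L * (1 / pw k * r)) = L * real_of_int k" for L r
      using P pw_pos[of k] by (simp add: field_simps)
    from this[of "ln (real p)" "real p / (real p - 1)"]
    have "pw k * (real_of_int k * ln (real p) * pw (- k) + ln (real p) * (pw (- k - 1) * (real p / (real p - 1))))
        - pw (k - 1) * (ln (real p) * (pw (- k) * (real p / (real p - 1)))) = ln (real p) * real_of_int k"
      unfolding e .
    ultimately show ?thesis using 2 by simp
  next
    case 3
    then have "min (- k - 1) (- n) = - n" "min (1 - k - 1) (- n) = - n" by auto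
    then show ?thesis using 3 P pw_pos[of k] pw_pos[of n] by (simp add: e) (simp add: divide_simps, simp add: algebra_simps)
  qed
  then show ?thesis unfolding log_ball_aux(2)[OF y] by (simp only: of_real_mult[symmetric] of_real_diff[symmetric])
qed

text \<open>Summing the contributions of the spheres: the term \<open>k = n\<close> cancels against
  the logarithmic summand, \<open>k = n + 1 + j\<close> lies outside and
  \<open>k = n - 1 - j\<close> inside the sphere of \<open>y\<close>. The window of half-width
  \<open>J\<close> makes all sums finite.\<close>

lemma fourier_log_lift_abs:
  fixes y :: 'a
  assumes y: "absv y = pw n" and J: "\<And>k. k \<notin> {n - int J..n + int J} \<Longrightarrow> g (pw k) = 0"
  shows "minus_log_abs y * lift_abs g y + fourier \<mu> \<psi> (\<lambda>x. minus_log_abs x * inverse_fourier \<mu> \<psi> (lift_abs g) x) y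
    = of_real (ln (real p)) * ((\<Sum>j<J. g (pw (n + 1 + int j))) + (\<Sum>j<J. of_real (pw (- 1 - int j)) * g (pw (n - 1 - int j))))"
proof -
  define S where "S = {n - int J..n + int J}"
  have finS: "finite S" by (simp add: S_def)
  have gS: "\<And>k. k \<notin> S \<Longrightarrow> g (pw k) = 0" using J by (simp add: S_def)
  have Phi: "inverse_fourier \<mu> \<psi> (lift_abs g) x =
     (\<Sum>k\<in>S. g (pw k) * (of_real (pw k * indicator (B (- k)) x) - of_real (pw (k - 1) * indicator (B (1 - k)) x)))" for x
    by (rule inverse_fourier_lift_abs[OF finS]) (rule gS)
  let ?f = "\<lambda>m x. minus_log_abs x * (indicator (B m) x *\<^sub>R \<psi> (x * y))"
  have i: "integrable \<mu> (?f m)" for m by (rule log_ball_aux(1)[OF y])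
  have i1: "integrable \<mu> (\<lambda>x. of_real (pw k) * ?f (- k) x)" and i2: "integrable \<mu> (\<lambda>x. of_real (pw (k - 1)) * ?f (1 - k) x)" for k
    by (intro integrable_mult_right i)+
  have "fourier \<mu> \<psi> (\<lambda>x. minus_log_abs x * inverse_fourier \<mu> \<psi> (lift_abs g) x) y
     = (LINT x|\<mu>. (\<Sum>k\<in>S. g (pw k) * (of_real (pw k) * ?f (- k) x - of_real (pw (k - 1)) * ?f (1 - k) x)))"
    unfolding fourier_def Phi sum_distrib_left sum_distrib_right
    by (intro Bochner_Integration.integral_cong sum.cong refl) (simp add: scaleR_conv_of_real algebra_simps)
  also have "\<dots> = (\<Sum>k\<in>S. LINT x|\<mu>. g (pw k) * (of_real (pw k) * ?f (- k) x - of_real (pw (k - 1)) * ?f (1 - k) x))"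
    by (intro Bochner_Integration.integral_sum integrable_mult_right Bochner_Integration.integrable_diff i1 i2)
  also have "\<dots> = (\<Sum>k\<in>S. g (pw k) * (of_real (pw k) * log_ball (- k) y - of_real (pw (k - 1)) * log_ball (1 - k) y))"
    unfolding log_ball_def by (simp only: integral_mult_right_zero Bochner_Integration.integral_diff[OF i1 i2])
  also have "\<dots> = (\<Sum>k\<in>S. g (pw k) * of_real (ln (real p) * (if k > n then 1 else if k = n then real_of_int n else pw (k - n))))"
    unfolding log_ball_difference[OF y] ..
  also have "\<dots> = (\<Sum>k\<in>insert n ((\<lambda>j. n + 1 + int j) ` {..<J} \<union> (\<lambda>j. n - 1 - int j) ` {..<J}).
     g (pw k) * of_real (ln (real p) * (if k > n then 1 else if k = n then real_of_int n else pw (k - n))))"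
  proof (rule sum.cong[OF _ refl], intro equalityI subsetI)
    fix k assume k: "k \<in> S"
    consider "k = n" | "k > n" | "k < n" by linarith
    then show "k \<in> insert n ((\<lambda>j. n + 1 + int j) ` {..<J} \<union> (\<lambda>j. n - 1 - int j) ` {..<J})"
    proof cases
      case 2
      then show ?thesis using k by (intro insertI2 UnI1 image_eqI[of _ _ "nat (k - n - 1)"]) (auto simp: S_def)
    next
      case 3
      then show ?thesis using k by (intro insertI2 UnI2 image_eqI[of _ _ "nat (n - 1 - k)"]) (auto simp: S_def)
    qed simp
  qed (auto simp: S_def)
  also have "\<dots> = g (pw n) * of_real (ln (real p) * real_of_int n)
     + ((\<Sum>j<J. g (pw (n + 1 + int j)) * of_real (ln (real p))) + (\<Sum>j<J. g (pw (n - 1 - int j)) * of_real (ln (real p) * pw (- 1 - int j))))"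
  proof (subst sum.insert)
    show "n \<notin> (\<lambda>j. n + 1 + int j) ` {..<J} \<union> (\<lambda>j. n - 1 - int j) ` {..<J}" by auto
    have "(\<lambda>j. n + 1 + int j) ` {..<J} \<inter> (\<lambda>j. n - 1 - int j) ` {..<J} = {}" by auto
    moreover have "inj_on (\<lambda>j. n + 1 + int j) {..<J}" "inj_on (\<lambda>j. n - 1 - int j) {..<J}" by (auto simp: inj_on_def)
    ultimately show "g (pw n) * of_real (ln (real p) * (if n > n then 1 else if n = n then real_of_int n else pw (n - n))) +
      (\<Sum>k\<in>(\<lambda>j. n + 1 + int j) ` {..<J} \<union> (\<lambda>j. n - 1 - int j) ` {..<J}.
       g (pw k) * of_real (ln (real p) * (if k > n then 1 else if k = n then real_of_int n else pw (k - n)))) =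
      g (pw n) * of_real (ln (real p) * real_of_int n)
     + ((\<Sum>j<J. g (pw (n + 1 + int j)) * of_real (ln (real p))) + (\<Sum>j<J. g (pw (n - 1 - int j)) * of_real (ln (real p) * pw (- 1 - int j))))"
      by (subst sum.union_disjoint) (auto simp: sum.reindex o_def intro!: sum.cong)
  qed auto
  finally have F: "fourier \<mu> \<psi> (\<lambda>x. minus_log_abs x * inverse_fourier \<mu> \<psi> (lift_abs g) x) y = \<dots>" .
  have "y \<noteq> 0" using y pw_pos[of n] by (metis absv_0 less_irrefl)
  moreover have "ln (pw n) = real_of_int n * ln (real p)" by (rule ln_pw)
  ultimately have "minus_log_abs y * lift_abs g y = - (g (pw n) * of_real (ln (real p) * real_of_int n))"
    by (simp add: minus_log_abs_def lift_abs_def y)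
  then show ?thesis unfolding F by (simp add: sum_distrib_left distrib_left mult_ac)
qed

end

lemma (in padic_field) padic_term_pw:
  assumes J: "\<And>k. k \<notin> {n - int J..n + int J} \<Longrightarrow> g (pw k) = 0"
  shows "padic_term p g (pw n) = of_real (ln (real p)) *
    ((\<Sum>j<J. g (pw (n + 1 + int j))) + (\<Sum>j<J. of_real (pw (- 1 - int j)) * g (pw (n - 1 - int j))))"
proof -
  have P: "real p \<noteq> 0" using p_gt_1 by simp
  have e1: "pw n * real p ^ Suc j = pw (n + 1 + int j)" for j
    using P by (simp add: power_int_add)
  have e2: "pw n / real p ^ Suc j = pw (n - 1 - int j)" for j
    using P by (simp add: power_int_diff)
  have e3: "(1 / real p) ^ Suc j = pw (- 1 - int j)" for j
    using P by (simp add: power_int_diff power_int_minus power_one_over divide_inverse power_inverse)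
  have "(\<Sum>j. g (pw (n + 1 + int j))) = (\<Sum>j<J. g (pw (n + 1 + int j)))"
    by (rule suminf_finite) (auto intro!: J)
  moreover have "(\<Sum>j. of_real (pw (- 1 - int j)) * g (pw (n - 1 - int j))) = (\<Sum>j<J. of_real (pw (- 1 - int j)) * g (pw (n - 1 - int j)))"
    by (rule suminf_finite) (auto intro!: J)
  ultimately show ?thesis unfolding padic_term_def e1 e2 e3 by (simp only:)
qed

lemma (in padic_field) test_function_vanishes:
  assumes "is_test_function g"
  obtains J where "\<And>k. k \<notin> {n - int J..n + int J} \<Longrightarrow> g (pw k) = 0"
proof -
  obtain R where R: "0 < R" "\<And>v. R \<le> \<bar>v\<bar> \<Longrightarrow> g (exp v) = 0"
    using test_function_log_continuous(2)[OF assms] by auto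
  have lp: "0 < ln (real p)" using p_gt_1 by simp
  define N where "N = nat \<lceil>R / ln (real p)\<rceil>"
  \<comment> \<open>\<open>N\<close> bounds the exponents at which \<open>g\<close> can be nonzero
    around 0; adding \<open>|n|\<close> makes the window centred at \<open>n\<close> contain that
    one.\<close>
  define J where "J = N + nat \<bar>n\<bar>"
  have N: "\<lceil>R / ln (real p)\<rceil> \<le> int N" unfolding N_def by linarith
  have J: "int J = int N + \<bar>n\<bar>" by (simp add: J_def)
  have "g (pw k) = 0" if "k \<notin> {n - int J..n + int J}" for k
  proof -
    have "\<bar>k\<bar> \<ge> \<lceil>R / ln (real p)\<rceil>" using that N J by simp linarith
    then have "R / ln (real p) \<le> \<bar>real_of_int k\<bar>" by linarith
    then have "R \<le> \<bar>real_of_int k * ln (real p)\<bar>" using lp by (simp add: pos_divide_le_eq abs_mult)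
    then have "g (exp (ln (pw k))) = 0" unfolding ln_pw by (rule R(2))
    then show ?thesis by simp
  qed
  then show ?thesis using that by blast
qed

lemma (in padic_field) W_at_eq:
  fixes y :: 'a
  assumes g: "is_test_function g" and c: "0 < c" "c < 1" and y: "y \<noteq> 0"
  shows "W_at (Prime_Place p) c g y = padic_term p g (absv y)"
    and "W_at (Prime_Place p) c g y = minus_log_abs y * lift_abs g y +
             fourier \<mu> \<psi> (\<lambda>x. minus_log_abs x * inverse_fourier \<mu> \<psi> (lift_abs g) x) y"
    and "W_at (Prime_Place p) c g y = minus_log_abs y * lift_abs g y + distribution_conv (G_dist \<mu> \<psi>) (lift_abs g) y"
proof -
  obtain n where n: "absv y = pw n" using value_group[OF y] by blast
  obtain J where J: "\<And>k. k \<notin> {n - int J..n + int J} \<Longrightarrow> g (pw k) = 0"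
    using test_function_vanishes[OF g] by metis
  show 1: "W_at (Prime_Place p) c g y = padic_term p g (absv y)"
    unfolding W_at_def by (rule vertical_integral_padic_term[OF g p_gt_1 c absv_pos[OF y]])
  show 2: "W_at (Prime_Place p) c g y = minus_log_abs y * lift_abs g y +
             fourier \<mu> \<psi> (\<lambda>x. minus_log_abs x * inverse_fourier \<mu> \<psi> (lift_abs g) x) y"
  proof -
    have "padic_term p g (pw n) = of_real (ln (real p)) *
      ((\<Sum>j<J. g (pw (n + 1 + int j))) + (\<Sum>j<J. of_real (pw (- 1 - int j)) * g (pw (n - 1 - int j))))"
      by (rule padic_term_pw) (rule J)
    also have "\<dots> = minus_log_abs y * lift_abs g y +
             fourier \<mu> \<psi> (\<lambda>x. minus_log_abs x * inverse_fourier \<mu> \<psi> (lift_abs g) x) y"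
      by (rule fourier_log_lift_abs[OF n, symmetric]) (rule J)
    finally show ?thesis unfolding 1 n .
  qed
  have "distribution_conv (G_dist \<mu> \<psi>) (lift_abs g) y =
     fourier \<mu> \<psi> (\<lambda>x. minus_log_abs x * inverse_fourier \<mu> \<psi> (lift_abs g) x) y"
    by (rule distribution_conv_G_dist[of "{n - int J..n + int J}"]) (use J in auto)
  then show "W_at (Prime_Place p) c g y = minus_log_abs y * lift_abs g y + distribution_conv (G_dist \<mu> \<psi>) (lift_abs g) y"
    using 2 by simp
qed

lemma (in padic_field) W_local_eq:
  assumes g: "is_test_function g" and c: "0 < c" "c < 1"
  shows "W_local (Prime_Place p) g = W_at (Prime_Place p) c g (1::'a)"
    and "W_local (Prime_Place p) g = distribution_conv (G_dist \<mu> \<psi>) (lift_abs g) 1"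
proof -
  show 1: "W_local (Prime_Place p) g = W_at (Prime_Place p) c g (1::'a)"
    using W_local_padic_term[OF g p_gt_1] W_at_eq(1)[OF g c, of 1] by simp
  show "W_local (Prime_Place p) g = distribution_conv (G_dist \<mu> \<psi>) (lift_abs g) 1"
    unfolding 1 using W_at_eq(3)[OF g c, of 1] by (simp add: minus_log_abs_def)
qed

section \<open>Gamma and Beta integrals\<close>

text \<open>Set to 0 for nonpositive \<open>t\<close>, so that integrals over half-lines and
  intervals become integrals over the whole line without indicators.\<close>

definition cpow :: "real \<Rightarrow> complex \<Rightarrow> complex" where
  "cpow t z = (if 0 < t then exp (z * of_real (ln t)) else 0)"

lemma cpow_measurable [measurable]: "(\<lambda>x. cpow (f x) (h x)) \<in> borel_measurable M"
  if [measurable]: "f \<in> borel_measurable M" "h \<in> borel_measurable M"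
  unfolding cpow_def by measurable

lemma cpow_nonpos [simp]: "t \<le> 0 \<Longrightarrow> cpow t z = 0"
  by (simp add: cpow_def)

lemma cpow_eq_powr: "0 < t \<Longrightarrow> cpow t z = of_real t powr z"
  by (simp add: cpow_def powr_def Ln_of_real)

lemma cpow_add: "cpow t (z + w) = cpow t z * cpow t w"
  by (simp add: cpow_def distrib_right exp_add)

lemma cpow_mult: "0 < s \<Longrightarrow> 0 < t \<Longrightarrow> cpow (s * t) z = cpow s z * cpow t z"
  by (simp add: cpow_def ln_mult distrib_left exp_add)

lemma cpow_one: "0 < t \<Longrightarrow> cpow t 1 = of_real t"
  by (simp add: cpow_def exp_of_real)

lemma cpow_of_real: "cpow t (of_real a) = of_real (if 0 < t then t powr a else 0)"
  by (simp add: cpow_def powr_def exp_of_real flip: of_real_mult)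

lemma norm_cpow: "norm (cpow t z) = (if 0 < t then t powr Re z else 0)"
  by (simp add: cpow_def powr_def)

lemma cpow_norm_eq: "of_real (norm (cpow t z)) = cpow t (of_real (Re z))"
  by (simp add: norm_cpow cpow_of_real)

lemma cpow_minus: "0 < t \<Longrightarrow> cpow t (- z) = inverse (cpow t z)"
  by (simp add: cpow_def exp_minus)

text \<open>Carries the change of variables for absolutely integrable functions over to Bochner
  integrals on the whole line; the vanishing of \<open>F\<close> off \<open>S\<close> and of
  \<open>f\<close> off its image takes the place of indicators.\<close>

lemma has_bochner_integral_substitution:
  fixes f :: "real \<Rightarrow> complex"
  assumes S [measurable]: "S \<in> sets borel" and T [measurable]: "g ` S \<in> sets borel"
    and der: "\<And>x. x \<in> S \<Longrightarrow> (g has_field_derivative h x) (at x within S)" and inj: "inj_on g S"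
    and f [measurable]: "f \<in> borel_measurable borel"
    and F: "\<And>x. x \<in> S \<Longrightarrow> F x = \<bar>h x\<bar> *\<^sub>R f (g x)" "\<And>x. x \<notin> S \<Longrightarrow> F x = 0"
    and f0: "\<And>y. y \<notin> g ` S \<Longrightarrow> f y = 0"
    and int: "has_bochner_integral lborel F I"
  shows "has_bochner_integral lborel f I"
proof -
  have "F \<in> borel_measurable borel" using int by (auto dest: borel_measurable_has_bochner_integral)
  then have [measurable]: "F \<in> borel_measurable lborel" by simp
  have F': "(\<lambda>x. indicator S x *\<^sub>R F x) = F" and f': "(\<lambda>y. indicator (g ` S) y *\<^sub>R f y) = f"
    using F(2) f0 by (auto simp: indicator_def fun_eq_iff)
  have intF: "set_integrable lborel S F"
    using int by (simp add: set_integrable_def F' has_bochner_integral_iff)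
  then have "F absolutely_integrable_on S"
    unfolding set_integrable_def by (subst integrable_completion) auto
  moreover have "integral S F = I"
    using set_borel_integral_eq_integral(2)[OF intF] int
    by (simp add: set_lebesgue_integral_def F' has_bochner_integral_iff)
  ultimately have "(\<lambda>x. \<bar>h x\<bar> *\<^sub>R f (g x)) absolutely_integrable_on S \<and> integral S (\<lambda>x. \<bar>h x\<bar> *\<^sub>R f (g x)) = I"
    using F(1) by (auto cong: set_integrable_cong integral_cong)
  then have "f absolutely_integrable_on g ` S \<and> integral (g ` S) f = I"
    by (subst (asm) has_absolute_integral_change_of_variables_real[OF _ der inj]) auto
  moreover from this have T_int: "set_integrable lborel (g ` S) f"
    unfolding set_integrable_def by (subst (asm) integrable_completion) auto
  ultimately show ?thesis
    using set_borel_integral_eq_integral(2)[OF T_int]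
    by (simp add: set_lebesgue_integral_def set_integrable_def f' has_bochner_integral_iff)
qed

lemma Gamma_integral_cpow:
  assumes z: "0 < Re z" and x: "0 < x"
  shows "has_bochner_integral lborel (\<lambda>t. cpow t (z - 1) * of_real (exp (- (x * t)))) (Gamma z * cpow x (- z))"
proof -
  define f where "f t = cpow t (z - 1) * of_real (exp (- t))" for t
  have [measurable]: "f \<in> borel_measurable borel" unfolding f_def by measurable
  have fe: "f t = indicator {0<..} t *\<^sub>R (complex_of_real t powr (z - 1) / of_real (exp t))" for t
    by (simp add: f_def indicator_def cpow_eq_powr exp_minus field_simps)
  have f0: "(\<lambda>t. indicator {0<..} t *\<^sub>R f t) = f" by (auto simp: f_def indicator_def)
  have "set_integrable lebesgue {0<..} (\<lambda>t. complex_of_real t powr (z - 1) / of_real (exp t))"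
    by (rule absolutely_integrable_Gamma_integral'[OF z])
  then have "integrable lebesgue f" by (simp add: set_integrable_def fe[abs_def])
  then have int: "integrable lborel f" using integrable_completion[of f lborel] by simp
  then have s: "set_integrable lborel {0<..} f" by (simp add: set_integrable_def f0)
  have "(f has_integral Gamma z) {0<..}"
    by (rule has_integral_eq[OF _ Gamma_integral_complex'[OF z]]) (simp add: fe)
  then have "(LINT t|lborel. f t) = Gamma z"
    using set_borel_integral_eq_integral(2)[OF s] by (simp add: set_lebesgue_integral_def f0 integral_unique)
  then have B: "has_bochner_integral lborel f (Gamma z)" using int by (simp add: has_bochner_integral_iff)
  have "has_bochner_integral lborel (\<lambda>t. f (0 + x * t)) (Gamma z /\<^sub>R \<bar>x\<bar>)"
    using B x lborel_has_bochner_integral_real_affine_iff[of x f "Gamma z" 0] by simp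
  then have "has_bochner_integral lborel (\<lambda>t. cpow x (1 - z) * f (0 + x * t)) (cpow x (1 - z) * (Gamma z /\<^sub>R \<bar>x\<bar>))"
    by (rule has_bochner_integral_mult_right)
  also have "(\<lambda>t. cpow x (1 - z) * f (0 + x * t)) = (\<lambda>t. cpow t (z - 1) * of_real (exp (- (x * t))))"
  proof
    fix t
    show "cpow x (1 - z) * f (0 + x * t) = cpow t (z - 1) * of_real (exp (- (x * t)))"
    proof (cases "0 < t")
      case True
      have "cpow x (1 - z) * cpow x (z - 1) = 1" using x by (simp add: cpow_add[symmetric]) (simp add: cpow_def)
      then show ?thesis using True x by (simp add: f_def cpow_mult)
    next
      case False
      then show ?thesis using x by (simp add: f_def mult_le_0_iff)
    qed
  qed
  also have "cpow x (1 - z) * (Gamma z /\<^sub>R \<bar>x\<bar>) = Gamma z * cpow x (- z)"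
    using x cpow_add[of x 1 "- z"] by (simp add: cpow_one scaleR_conv_of_real field_simps)
  finally show ?thesis .
qed

text \<open>The modulus of the integrand is the same integrand at the real point
  \<open>Re z\<close>. The value provides absolute convergence for Fubini's theorem.\<close>

lemma norm_Gamma_integral_cpow:
  assumes z: "0 < Re z" and x: "0 < x"
  shows "has_bochner_integral lborel (\<lambda>t. norm (cpow t (z - 1) * of_real (exp (- (x * t))))) (Gamma (Re z) * x powr (- Re z))"
proof -
  have "has_bochner_integral lborel (\<lambda>t. cpow t (of_real (Re z) - 1) * of_real (exp (- (x * t)))) (Gamma (of_real (Re z)) * cpow x (- of_real (Re z)))"
    by (rule Gamma_integral_cpow) (use z x in auto)
  also have "(\<lambda>t. cpow t (of_real (Re z) - 1) * of_real (exp (- (x * t)))) = (\<lambda>t. complex_of_real (norm (cpow t (z - 1) * of_real (exp (- (x * t))))))"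
    using cpow_of_real[of _ "Re z - 1"] by (auto simp: norm_mult norm_cpow)
  also have "Gamma (of_real (Re z)) * cpow x (- of_real (Re z)) = complex_of_real (Gamma (Re z) * x powr (- Re z))"
    using cpow_of_real[of x "- Re z"] x by (simp add: Gamma_complex_of_real)
  finally have "has_bochner_integral lborel (\<lambda>t. Re (complex_of_real (norm (cpow t (z - 1) * of_real (exp (- (x * t))))))) (Re (complex_of_real (Gamma (Re z) * x powr (- Re z))))"
    by (rule has_bochner_integral_bounded_linear[OF bounded_linear_Re])
  then show ?thesis by simp
qed

text \<open>Integrate \<open>x powr (a + b - 1) * r powr (b - 1) * exp (- (x * (1 + r)))\<close> in
  both orders: over \<open>r\<close> and then \<open>x\<close> it gives
  \<open>Gamma a * Gamma b\<close>, while over \<open>x\<close> first it gives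
  \<open>Gamma (a + b)\<close> times the integrand.\<close>

lemma Beta_integral_half_line:
  assumes a: "0 < Re a" and b: "0 < Re b"
  shows "has_bochner_integral lborel (\<lambda>r. cpow r (b - 1) * cpow (1 + r) (- (a + b))) (Gamma a * Gamma b / Gamma (a + b))"
proof -
  define f where "f x r = cpow x (a + b - 1) * cpow r (b - 1) * of_real (exp (- (x * (1 + r))))" for x r
  have [measurable]: "case_prod f \<in> borel_measurable (lborel \<Otimes>\<^sub>M lborel)"
    unfolding f_def by measurable
  have ab: "0 < Re (a + b)" using a b by simp
  have f1: "f x r = (cpow x (a + b - 1) * of_real (exp (- x))) * (cpow r (b - 1) * of_real (exp (- (x * r))))" for x r
  proof -
    have "exp (- (x * (1 + r))) = exp (- x) * exp (- (x * r))" by (simp add: exp_add[symmetric] algebra_simps)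
    then show ?thesis by (simp add: f_def mult_ac)
  qed
  have f2: "f x r = cpow r (b - 1) * (cpow x (a + b - 1) * of_real (exp (- ((1 + r) * x))))" for x r
    by (simp add: f_def mult_ac)
  have fx: "has_bochner_integral lborel (\<lambda>r. f x r) (Gamma b * (cpow x (a - 1) * of_real (exp (- (1 * x)))))" for x
  proof (cases "0 < x")
    case True
    have "has_bochner_integral lborel (\<lambda>r. f x r) ((cpow x (a + b - 1) * of_real (exp (- x))) * (Gamma b * cpow x (- b)))"
      unfolding f1 by (intro has_bochner_integral_mult_right Gamma_integral_cpow b True)
    moreover have "cpow x (a + b - 1) * cpow x (- b) = cpow x (a - 1)" by (simp flip: cpow_add)
    then have "(cpow x (a + b - 1) * of_real (exp (- x))) * (Gamma b * cpow x (- b)) = Gamma b * (cpow x (a - 1) * of_real (exp (- (1 * x))))"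
      by (simp add: mult_ac)
    ultimately show ?thesis by (simp only:)
  qed (simp add: f_def has_bochner_integral_zero)
  have fx_norm: "(LINT r|lborel. norm (f x r)) = Gamma (Re b) * norm (cpow x (a - 1) * of_real (exp (- (1 * x))))" for x
  proof (cases "0 < x")
    case True
    have "has_bochner_integral lborel (\<lambda>r. norm (f x r)) (norm (cpow x (a + b - 1) * of_real (exp (- x))) * (Gamma (Re b) * x powr (- Re b)))"
      unfolding f1 norm_mult[of "_ * _" "_ * _"] by (intro has_bochner_integral_mult_right norm_Gamma_integral_cpow b True)
    moreover have "x powr (Re a + Re b - 1) * x powr (- Re b) = x powr (Re a - 1)" by (simp flip: powr_add)
    ultimately show ?thesis using True by (simp add: has_bochner_integral_iff norm_mult norm_cpow mult_ac)
  qed (simp add: f_def)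
  have prod_int: "integrable (lborel \<Otimes>\<^sub>M lborel) (case_prod f)"
  proof (rule lborel_pair.Fubini_integrable)
    show "integrable lborel (\<lambda>x. LINT r|lborel. norm (case_prod f (x, r)))"
      using norm_Gamma_integral_cpow[OF a zero_less_one] by (simp add: fx_norm has_bochner_integral_iff)
    show "AE x in lborel. integrable lborel (\<lambda>r. case_prod f (x, r))"
      using fx by (simp add: has_bochner_integral_iff)
  qed measurable
  have fr: "(LINT x|lborel. f x r) = Gamma (a + b) * (cpow r (b - 1) * cpow (1 + r) (- (a + b)))" for r
  proof (cases "0 < r")
    case True
    have "has_bochner_integral lborel (\<lambda>x. f x r) (cpow r (b - 1) * (Gamma (a + b) * cpow (1 + r) (- (a + b))))"
      unfolding f2 using True by (intro has_bochner_integral_mult_right Gamma_integral_cpow ab) auto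
    then show ?thesis by (simp add: has_bochner_integral_iff mult_ac)
  qed (simp add: f_def)
  have G: "Gamma (a + b) \<noteq> 0"
  proof
    assume "Gamma (a + b) = 0"
    then obtain n where "a + b = of_int n" "n \<le> 0" by (auto simp: Gamma_eq_zero_iff elim!: nonpos_Ints_cases)
    then have "Re (a + b) \<le> 0" by simp
    then show False using ab by simp
  qed
  have "integrable lborel (\<lambda>r. LINT x|lborel. f x r)"
    using lborel_pair.integrable_snd[OF prod_int] by simp
  then have "integrable lborel (\<lambda>r. inverse (Gamma (a + b)) * (Gamma (a + b) * (cpow r (b - 1) * cpow (1 + r) (- (a + b)))))"
    unfolding fr by (rule integrable_mult_right)
  then have int: "integrable lborel (\<lambda>r. cpow r (b - 1) * cpow (1 + r) (- (a + b)))"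
    using G by (simp flip: mult.assoc)
  have "Gamma (a + b) * (LINT r|lborel. cpow r (b - 1) * cpow (1 + r) (- (a + b))) = (LINT r|lborel. LINT x|lborel. f x r)"
    unfolding fr by simp
  also have "\<dots> = (LINT x|lborel. LINT r|lborel. f x r)"
    by (rule lborel_pair.Fubini_integral[OF prod_int])
  also have "\<dots> = (LINT x|lborel. Gamma b * (cpow x (a - 1) * of_real (exp (- (1 * x)))))"
    using fx by (simp add: has_bochner_integral_iff)
  also have "\<dots> = Gamma a * Gamma b"
    using Gamma_integral_cpow[OF a zero_less_one] by (simp add: has_bochner_integral_iff cpow_def)
  finally show ?thesis using int G by (simp add: has_bochner_integral_iff field_simps)
qed

text \<open>The substitution \<open>x = 1 / (1 + r)\<close> maps the half-line onto the unit
  interval.\<close>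

lemma Beta_integral_unit_interval:
  assumes a: "0 < Re a" and b: "0 < Re b"
  shows "has_bochner_integral lborel (\<lambda>x. cpow x (a - 1) * cpow (1 - x) (b - 1)) (Gamma a * Gamma b / Gamma (a + b))"
proof (rule has_bochner_integral_substitution[where S = "{0<..}" and g = "\<lambda>r. 1 / (1 + r)" and h = "\<lambda>r. - (1 / (1 + r)\<^sup>2)"])
  have img: "(\<lambda>r. 1 / (1 + r)) ` {0<..} = {0<..<1::real}"
  proof (intro equalityI subsetI)
    fix y :: real assume "y \<in> {0<..<1}"
    then show "y \<in> (\<lambda>r. 1 / (1 + r)) ` {0<..}" by (intro image_eqI[of _ _ "1 / y - 1"]) (auto simp: field_simps)
  qed auto
  then show "(\<lambda>r. 1 / (1 + r)) ` {0<..} \<in> sets (borel :: real measure)" by simp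
  show "cpow y (a - 1) * cpow (1 - y) (b - 1) = 0" if "y \<notin> (\<lambda>r. 1 / (1 + r)) ` {0<..}" for y
    using that unfolding img by (auto simp: not_less)
  show "((\<lambda>r. 1 / (1 + r)) has_real_derivative - (1 / (1 + x)\<^sup>2)) (at x within {0<..})" if "x \<in> {0<..}" for x :: real
    using that by (auto intro!: derivative_eq_intros simp: power2_eq_square)
  show "inj_on (\<lambda>r. 1 / (1 + r)) {0::real<..}"
    by (rule inj_on_inverseI[where g = "\<lambda>y. 1 / y - 1"]) auto
  show "has_bochner_integral lborel (\<lambda>r. cpow r (b - 1) * cpow (1 + r) (- (a + b))) (Gamma a * Gamma b / Gamma (a + b))"
    by (rule Beta_integral_half_line[OF a b])
  show "cpow x (b - 1) * cpow (1 + x) (- (a + b)) =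
         \<bar>- (1 / (1 + x)\<^sup>2)\<bar> *\<^sub>R (cpow (1 / (1 + x)) (a - 1) * cpow (1 - 1 / (1 + x)) (b - 1))" if "x \<in> {0<..}" for x
  proof -
    have x: "0 < x" using that by simp
    then have "1 - 1 / (1 + x) = x * (1 / (1 + x))" by (simp add: field_simps)
    then have 1: "cpow (1 - 1 / (1 + x)) (b - 1) = cpow x (b - 1) * cpow (1 / (1 + x)) (b - 1)"
      using x cpow_mult[of x "1 / (1 + x)"] by simp
    have 2: "cpow (1 / (1 + x)) z = cpow (1 + x) (- z)" for z
      using x by (simp add: cpow_def ln_div)
    have 3: "complex_of_real (1 / (1 + x)\<^sup>2) = cpow (1 + x) (- 1) * cpow (1 + x) (- 1)"
      using x by (simp add: cpow_minus cpow_one power2_eq_square inverse_eq_divide)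
    have "cpow (1 + x) (- (a + b)) = cpow (1 + x) (- 1) * cpow (1 + x) (- 1) * cpow (1 + x) (- (a - 1)) * cpow (1 + x) (- (b - 1))"
      by (simp flip: cpow_add)
    then show ?thesis unfolding 1 2 by (simp add: scaleR_conv_of_real 3[simplified] mult_ac)
  qed
qed auto

text \<open>Expanding the fraction by \<open>Gamma ((1 + s) / 2)\<close> makes the duplication
  formula apply above and the reflection formula below. The result is the factor in the functional
  equation of the zeta function, the form in which Beta integrals combine.\<close>

lemma Gamma_local_real_eq:
  assumes s: "0 < Re s" "Re s < 1"
  shows "Gamma_local Real_Place s = 2 * cpow (2 * pi) (- s) * Gamma s * cos (of_real pi * s / 2)"
    and "Gamma s \<noteq> 0" and "L_local Real_Place s \<noteq> 0"
proof -
  have np: "z \<notin> \<int>\<^sub>\<le>\<^sub>0" if "0 < Re z" for z :: complex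
    using that by (auto elim!: nonpos_Ints_cases)
  have G: "Gamma (s / 2) \<noteq> 0" "Gamma s \<noteq> 0" "Gamma ((1 - s) / 2) \<noteq> 0" "Gamma ((1 + s) / 2) \<noteq> 0"
    using s by (auto simp: Gamma_eq_zero_iff intro!: np)
  show "Gamma s \<noteq> 0" by (rule G)
  show "L_local Real_Place s \<noteq> 0" using G by simp
  have refl: "Gamma ((1 - s) / 2) * Gamma ((1 + s) / 2) = of_real pi / cos (of_real pi * s / 2)"
  proof -
    have sine: "sin (of_real pi * ((1 - s) / 2)) = cos (of_real pi * s / 2)"
      using cos_sin_eq[of "of_real pi * s / 2"] by (simp add: algebra_simps diff_divide_distrib)
    have e: "1 - (1 - s) / 2 = (1 + s) / 2" by (simp add: field_simps)
    show ?thesis using Gamma_reflection_complex[of "(1 - s) / 2"] unfolding sine e .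
  qed
  have c: "cos (of_real pi * s / 2) \<noteq> 0" using refl G by auto
  have dup: "Gamma (s / 2) * Gamma ((1 + s) / 2) = exp ((1 - s) * of_real (ln 2)) * of_real (sqrt pi) * Gamma s"
    using Gamma_legendre_duplication[OF np np, of "s / 2"] s by (simp add: add_divide_distrib add.commute)
  have "Gamma_local Real_Place s = (of_real pi powr (- s / 2) / of_real pi powr (- (1 - s) / 2)) * (Gamma (s / 2) / Gamma ((1 - s) / 2))"
    by (simp add: Gamma_local_def)
  also have "Gamma (s / 2) / Gamma ((1 - s) / 2) = (Gamma (s / 2) * Gamma ((1 + s) / 2)) / (Gamma ((1 - s) / 2) * Gamma ((1 + s) / 2))"
    using G by simp
  also have "\<dots> = exp ((1 - s) * of_real (ln 2)) * of_real (sqrt pi) * Gamma s * cos (of_real pi * s / 2) / of_real pi"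
    unfolding dup refl by simp
  also have "of_real pi powr (- s / 2) / of_real pi powr (- (1 - s) / 2) = exp ((1 / 2 - s) * of_real (ln pi))"
    by (simp add: powr_def Ln_of_real exp_diff[symmetric] field_simps)
  also have "complex_of_real (sqrt pi) = exp (1 / 2 * of_real (ln pi))"
  proof -
    have "exp (1 / 2 * complex_of_real (ln pi)) = of_real (exp (ln pi / 2))" by (simp flip: exp_of_real)
    also have "exp (ln pi / 2) = sqrt pi" by (simp add: ln_sqrt[symmetric])
    finally show ?thesis by simp
  qed
  also have "exp ((1 / 2 - s) * of_real (ln pi)) * (exp ((1 - s) * of_real (ln 2)) * exp (1 / 2 * of_real (ln pi)) * Gamma s * cos (of_real pi * s / 2) / of_real pi)
      = (exp ((1 / 2 - s) * of_real (ln pi)) * exp ((1 - s) * of_real (ln 2)) * exp (1 / 2 * of_real (ln pi))) / of_real pi * (Gamma s * cos (of_real pi * s / 2))"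
    by simp
  also have "exp ((1 / 2 - s) * of_real (ln pi)) * exp ((1 - s) * of_real (ln 2)) * exp (1 / 2 * of_real (ln pi))
      = exp (of_real (ln pi)) * exp (of_real (ln 2)) * exp (- s * (of_real (ln 2) + of_real (ln pi)))"
    unfolding exp_add[symmetric] by (simp add: algebra_simps)
  also have "\<dots> = of_real pi * 2 * cpow (2 * pi) (- s)"
    by (simp add: cpow_def ln_mult exp_of_real)
  finally show "Gamma_local Real_Place s = 2 * cpow (2 * pi) (- s) * Gamma s * cos (of_real pi * s / 2)"
    by simp
qed

text \<open>The classical identity for the angles of a triangle, written with half-angles. It turns
  a sum of three Beta integrals into a product of local factors.\<close>

lemma sin_double_sum:
  fixes x y z :: complex
  assumes "x + y + z = of_real (pi / 2)"
  shows "sin (2 * x) + sin (2 * y) + sin (2 * z) = 4 * cos x * cos y * cos z"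
proof -
  have z: "z = of_real (pi / 2) - (x + y)" using assms by (simp add: algebra_simps)
  have cz: "cos z = sin (x + y)" unfolding z by (simp add: cos_diff cos_of_real_pi_half sin_of_real_pi_half)
  have sz: "sin z = cos (x + y)" unfolding z by (simp add: sin_diff cos_of_real_pi_half sin_of_real_pi_half)
  have sx: "sin x ^ 2 = 1 - cos x ^ 2" "sin y ^ 2 = 1 - cos y ^ 2" by (simp_all add: sin_squared_eq)
  show ?thesis
    unfolding sin_double cz sz sin_add cos_add using sx by algebra
qed

text \<open>The Riesz kernel \<open>|1 - z| powr (w - 1)\<close> folded onto the half-line, as it
  acts on even functions at the point 1.\<close>

definition riesz :: "real \<Rightarrow> real \<Rightarrow> real" where
  "riesz w z = \<bar>1 - z\<bar> powr (w - 1) + \<bar>1 + z\<bar> powr (w - 1)"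

lemma riesz_measurable [measurable]: "riesz w \<in> borel_measurable borel"
  unfolding riesz_def[abs_def] by measurable

lemma riesz_nonneg: "0 \<le> riesz w z" by (simp add: riesz_def)

text \<open>On the half-line the kernel consists of powers of \<open>1 + z\<close>, of
  \<open>z - 1\<close> beyond 1 and of \<open>1 - z\<close> below 1: three Beta integrals in
  \<open>A = w\<close>, \<open>B = 1 - s\<close>, \<open>C = s - w\<close>. As
  \<open>A + B + C = 1\<close>, reflection rewrites their sum as
  \<open>Gamma A * Gamma B * Gamma C / pi\<close> times a sum of sines, and that sum factors into
  cosines.\<close>

lemma mellin_riesz:
  assumes w: "0 < w" "w < Re s" and s: "Re s < 1"
  shows "has_bochner_integral lborel (\<lambda>z. cpow z (- s) * of_real (riesz w z))
           (Gamma_local Real_Place (of_real w) * Gamma_local Real_Place (1 - s) * Gamma_local Real_Place (s - of_real w))"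
proof -
  define A where "A = complex_of_real w"
  define B where "B = 1 - s"
  define C where "C = s - of_real w"
  have ABC: "0 < Re A" "0 < Re B" "0 < Re C" "Re A < 1" "Re B < 1" "Re C < 1" and sum: "A + B + C = 1"
    using assms by (auto simp: A_def B_def C_def)
  have I1: "has_bochner_integral lborel (\<lambda>z. cpow z (B - 1) * cpow (1 + z) (- (C + B))) (Gamma C * Gamma B / Gamma (C + B))"
    by (rule Beta_integral_half_line) (use ABC in auto)
  have "has_bochner_integral lborel (\<lambda>r. cpow r (A - 1) * cpow (1 + r) (- (C + A))) (Gamma C * Gamma A / Gamma (C + A))"
    by (rule Beta_integral_half_line) (use ABC in auto)
  then have I2: "has_bochner_integral lborel (\<lambda>z. cpow (-1 + 1 * z) (A - 1) * cpow (1 + (-1 + 1 * z)) (- (C + A))) (Gamma C * Gamma A / Gamma (C + A))"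
    by (subst (asm) lborel_has_bochner_integral_real_affine_iff[where c = 1 and t = "-1"]) auto
  have I3: "has_bochner_integral lborel (\<lambda>z. cpow z (B - 1) * cpow (1 - z) (A - 1)) (Gamma B * Gamma A / Gamma (B + A))"
    by (rule Beta_integral_unit_interval) (use ABC in auto)
  have e: "C + B = 1 - A" "C + A = 1 - B" "B + A = 1 - C" "- (C + B) = A - 1" "- (C + A) = - s" "B - 1 = - s"
    using sum by (auto simp: A_def B_def C_def algebra_simps)
  have integrand: "cpow z (B - 1) * cpow (1 + z) (- (C + B)) + cpow (-1 + 1 * z) (A - 1) * cpow (1 + (-1 + 1 * z)) (- (C + A)) + cpow z (B - 1) * cpow (1 - z) (A - 1)
       = cpow z (- s) * of_real (riesz w z)" for z
  proof (cases "0 < z")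
    case True
    have p: "complex_of_real (x powr (w - 1)) = cpow x (A - 1)" if "0 < x" for x
      using cpow_of_real[of x "w - 1"] that by (simp add: A_def)
    \<comment> \<open>At \<open>z = 1\<close> both sides agree because the power of 0 is 0 for
      \<open>powr\<close> as well as for \<open>cpow\<close>.\<close>
    have "of_real (riesz w z) = cpow (1 + z) (A - 1) + cpow (z - 1) (A - 1) + cpow (1 - z) (A - 1)"
      using True p[of "1 + z"] p[of "1 - z"] p[of "z - 1"] by (cases z "1::real" rule: linorder_cases) (auto simp: riesz_def)
    then show ?thesis unfolding e by (simp add: algebra_simps e(6))
  qed simp
  have refl: "Gamma (1 - z) = of_real pi / (sin (of_real pi * z) * Gamma z)" if "Gamma z \<noteq> 0" for z :: complex
  proof -
    have "Gamma (1 - z) = (Gamma z * Gamma (1 - z)) / Gamma z" using that by simp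
    then show ?thesis by (simp only: Gamma_reflection_complex divide_divide_eq_left)
  qed
  note nz = Gamma_local_real_eq(2)[OF ABC(1,4)] Gamma_local_real_eq(2)[OF ABC(2,5)] Gamma_local_real_eq(2)[OF ABC(3,6)]
  have val: "Gamma C * Gamma B / Gamma (C + B) + Gamma C * Gamma A / Gamma (C + A) + Gamma B * Gamma A / Gamma (B + A)
     = Gamma_local Real_Place A * Gamma_local Real_Place B * Gamma_local Real_Place C"
  proof -
    let ?a = "of_real pi * A / 2" and ?b = "of_real pi * B / 2" and ?c = "of_real pi * C / 2"
    have "?a + ?b + ?c = of_real (pi / 2) * (A + B + C)" by (simp add: algebra_simps add_divide_distrib)
    then have trig: "sin (2 * ?a) + sin (2 * ?b) + sin (2 * ?c) = 4 * cos ?a * cos ?b * cos ?c"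
      by (intro sin_double_sum) (simp add: sum)
    have "Gamma C * Gamma B / Gamma (C + B) + Gamma C * Gamma A / Gamma (C + A) + Gamma B * Gamma A / Gamma (B + A)
       = Gamma A * Gamma B * Gamma C / of_real pi * (sin (2 * ?a) + sin (2 * ?b) + sin (2 * ?c))"
      unfolding e(1-3) refl[OF nz(1)] refl[OF nz(2)] refl[OF nz(3)] by (simp add: field_simps)
    also have "\<dots> = 4 / of_real pi * (Gamma A * cos ?a) * (Gamma B * cos ?b) * (Gamma C * cos ?c)"
      unfolding trig by simp
    \<comment> \<open>The exponents sum to -1, so both sides are \<open>8 / (2 * pi)\<close>; this
      distributes the constant over the three local factors.\<close>
    also have "4 / complex_of_real pi = 8 * (cpow (2 * pi) (- A) * cpow (2 * pi) (- B) * cpow (2 * pi) (- C))"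
    proof -
      have "cpow (2 * pi) (- A) * cpow (2 * pi) (- B) * cpow (2 * pi) (- C) = cpow (2 * pi) (- (A + B + C))"
        by (simp flip: cpow_add)
      also have "\<dots> = 1 / (2 * of_real pi)" unfolding sum by (simp add: cpow_minus cpow_one inverse_eq_divide)
      finally show ?thesis by simp
    qed
    finally show ?thesis
      unfolding Gamma_local_real_eq(1)[OF ABC(1,4)] Gamma_local_real_eq(1)[OF ABC(2,5)] Gamma_local_real_eq(1)[OF ABC(3,6)]
      by (simp add: mult_ac)
  qed
  show ?thesis
    using has_bochner_integral_add[OF has_bochner_integral_add[OF I1 I2] I3]
    unfolding integrand val unfolding A_def B_def C_def .
qed

text \<open>The triangle inequality under the integral: since the kernel is nonnegative, its Mellin
  transform on a vertical line is largest at the real point.\<close>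

lemma norm_mellin_riesz_le:
  assumes w: "0 < w" "w < Re s" and s: "Re s < 1"
  shows "norm (Gamma_local Real_Place (of_real w) * Gamma_local Real_Place (1 - s) * Gamma_local Real_Place (s - of_real w))
     \<le> norm (Gamma_local Real_Place (of_real w) * Gamma_local Real_Place (1 - of_real (Re s)) * Gamma_local Real_Place (of_real (Re s - w)))"
proof -
  note M = mellin_riesz[OF assms]
  have M': "has_bochner_integral lborel (\<lambda>z. cpow z (- of_real (Re s)) * of_real (riesz w z))
     (Gamma_local Real_Place (of_real w) * Gamma_local Real_Place (1 - of_real (Re s)) * Gamma_local Real_Place (of_real (Re s) - of_real w))"
    by (rule mellin_riesz) (use assms in auto)
  have n: "complex_of_real (norm (cpow z (- s) * of_real (riesz w z))) = cpow z (- of_real (Re s)) * of_real (riesz w z)" for z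
    using cpow_norm_eq[of z "- s"] riesz_nonneg[of w z] by (simp add: norm_mult)
  have "norm (Gamma_local Real_Place (of_real w) * Gamma_local Real_Place (1 - s) * Gamma_local Real_Place (s - of_real w))
     \<le> (LINT z|lborel. norm (cpow z (- s) * of_real (riesz w z)))"
    using M integral_norm_bound[of lborel "\<lambda>z. cpow z (- s) * of_real (riesz w z)"] by (simp add: has_bochner_integral_iff)
  also have "\<dots> \<le> norm (complex_of_real (LINT z|lborel. norm (cpow z (- s) * of_real (riesz w z))))" by simp
  also have "complex_of_real (LINT z|lborel. norm (cpow z (- s) * of_real (riesz w z))) = (LINT z|lborel. cpow z (- of_real (Re s)) * of_real (riesz w z))"
    unfolding n[symmetric] by (rule integral_complex_of_real[symmetric])
  also have "\<dots> = Gamma_local Real_Place (of_real w) * Gamma_local Real_Place (1 - of_real (Re s)) * Gamma_local Real_Place (of_real (Re s) - of_real w)"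
    using M' by (simp add: has_bochner_integral_iff)
  finally show ?thesis by simp
qed

section \<open>The logarithmic derivative of the real Gamma factor\<close>

text \<open>This is \<open>- L' / L\<close> at the real place, with the sign of the integrand of
  \<open>W_local\<close>.\<close>

definition L_log_deriv :: "complex \<Rightarrow> complex" where
  "L_log_deriv s = of_real (ln pi) / 2 - Digamma (s / 2) / 2"

lemma pos_not_nonpos_Ints: "0 < Re z \<Longrightarrow> z \<notin> \<int>\<^sub>\<le>\<^sub>0"
proof
  assume z: "0 < Re z" and "z \<in> \<int>\<^sub>\<le>\<^sub>0"
  then obtain n where n: "z = of_int n" "n \<le> 0" by (auto elim: nonpos_Ints_cases)
  then have "Re z = real_of_int n" by simp
  then show False using z n by simp
qed

lemma L_real_deriv:
  assumes s: "0 < Re s"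
  shows "L_local Real_Place s \<noteq> 0"
    and "(L_local Real_Place has_field_derivative - L_local Real_Place s * L_log_deriv s) (at s)"
proof -
  have np: "s / 2 \<notin> \<int>\<^sub>\<le>\<^sub>0" using s by (intro pos_not_nonpos_Ints) simp
  show "L_local Real_Place s \<noteq> 0" using np by (simp add: Gamma_eq_zero_iff)
  have "((\<lambda>s. exp (- s / 2 * of_real (ln pi)) * Gamma (s / 2)) has_field_derivative
     - (exp (- s / 2 * of_real (ln pi)) * Gamma (s / 2)) * L_log_deriv s) (at s)"
    using np by (auto intro!: derivative_eq_intros simp: L_log_deriv_def algebra_simps)
  moreover have E: "exp (- s / 2 * of_real (ln pi)) * Gamma (s / 2) = L_local Real_Place s" for s
    by (simp add: powr_def Ln_of_real)
  ultimately show "(L_local Real_Place has_field_derivative - L_local Real_Place s * L_log_deriv s) (at s)"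
    by (simp only: E)
qed

lemma minus_L_log_deriv: "0 < Re s \<Longrightarrow> - deriv (L_local Real_Place) s / L_local Real_Place s = L_log_deriv s"
  using L_real_deriv(1)[of s] DERIV_imp_deriv[OF L_real_deriv(2)[of s]] by (simp del: L_local.simps)

lemma Lambda_real:
  assumes s: "0 < Re s" "Re s < 1"
  shows "Lambda_local Real_Place s = L_log_deriv s + L_log_deriv (1 - s)"
    and "(Gamma_local Real_Place has_field_derivative - Gamma_local Real_Place s * Lambda_local Real_Place s) (at s)"
proof -
  have s': "0 < Re (1 - s)" using s by simp
  note D = Lambda_local_eq[OF L_real_deriv(2)[OF s(1)] L_real_deriv(2)[OF s'] L_real_deriv(1)[OF s(1)] L_real_deriv(1)[OF s']]
  show 1: "Lambda_local Real_Place s = L_log_deriv s + L_log_deriv (1 - s)" by (rule D(1))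
  show "(Gamma_local Real_Place has_field_derivative - Gamma_local Real_Place s * Lambda_local Real_Place s) (at s)"
    unfolding 1 by (rule D(2))
qed

lemma L_log_deriv_holomorphic: "L_log_deriv holomorphic_on {s. 0 < Re s}"
  unfolding L_log_deriv_def[abs_def]
proof (intro holomorphic_intros)
  have "Digamma holomorphic_on {z::complex. 0 < Re z}"
    by (rule holomorphic_on_Polygamma) (simp add: disjoint_iff pos_not_nonpos_Ints)
  then have "(Digamma \<circ> (\<lambda>s. s / 2)) holomorphic_on {s. 0 < Re s}"
    by (intro holomorphic_on_compose_gen[where t = "{z::complex. 0 < Re z}" and g = Digamma]) (auto intro!: holomorphic_intros)
  then show "(\<lambda>s. Digamma (s / 2)) holomorphic_on {s. 0 < Re s}" by (simp add: o_def)
qed auto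

text \<open>Comparison with the real point \<open>x\<close>: in the series for
  \<open>Digamma z - Digamma x\<close> the terms are at most
  \<open>|z - x| / (x + k)\<^sup>2\<close>. The bound is far from sharp, but the cubic decay of the
  Mellin transform absorbs it.\<close>

lemma Digamma_linear_bound:
  assumes x: "0 < x"
  obtains K where "0 \<le> K" "\<And>z :: complex. x \<le> Re z \<Longrightarrow> norm (Digamma z) \<le> K * (1 + norm z)"
proof -
  define S where "S = (\<Sum>k. inverse ((x + real k)\<^sup>2))"
  have sm: "summable (\<lambda>k. inverse ((x + real k)\<^sup>2))"
    using sums_summable[OF Polygamma_LIMSEQ[of x 1]] x by (simp add: numeral_2_eq_2)
  have S: "0 \<le> S" unfolding S_def by (rule suminf_nonneg[OF sm]) simp
  define K where "K = norm (Digamma (of_real x :: complex)) + (1 + x) * S"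
  show ?thesis
  proof (rule that[of K])
    show "0 \<le> K" using x S by (simp add: K_def)
    fix z :: complex assume z: "x \<le> Re z"
    have zk: "z + of_nat k \<noteq> 0" "norm (z + of_nat k) \<ge> x + real k" for k
    proof -
      have "x + real k \<le> Re (z + of_nat k)" using z by simp
      also have "\<dots> \<le> norm (z + of_nat k)" by (rule complex_Re_le_cmod)
      finally show "norm (z + of_nat k) \<ge> x + real k" .
      then show "z + of_nat k \<noteq> 0" using x by auto
    qed
    have "z \<noteq> 0" "complex_of_real x \<noteq> 0" using z x by auto
    then have "Digamma z - Digamma (of_real x) =
       (\<Sum>k. (inverse (of_nat (Suc k)) - inverse (z + of_nat k)) - (inverse (of_nat (Suc k)) - inverse (of_real x + of_nat k)))"
      unfolding Digamma_def by (subst suminf_diff[symmetric, OF summable_Digamma summable_Digamma]) auto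
    also have "\<dots> = (\<Sum>k. inverse (of_real x + of_nat k) - inverse (z + of_nat k))"
      by simp
    also have "norm \<dots> \<le> (\<Sum>k. norm (z - of_real x) * inverse ((x + real k)\<^sup>2))"
    proof (rule norm_suminf_le)
      show "summable (\<lambda>k. norm (z - of_real x) * inverse ((x + real k)\<^sup>2))" by (rule summable_mult[OF sm])
      fix k
      have xk: "complex_of_real x + of_nat k \<noteq> 0" "norm (complex_of_real x + of_nat k) = x + real k"
      proof -
        have "complex_of_real x + of_nat k = of_real (x + real k)" by simp
        then show "complex_of_real x + of_nat k \<noteq> 0" "norm (complex_of_real x + of_nat k) = x + real k"
          using x by (simp_all only: norm_of_real of_real_eq_0_iff)
      qed
      have "inverse (of_real x + of_nat k) - inverse (z + of_nat k) = (z - of_real x) / ((of_real x + of_nat k) * (z + of_nat k))"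
        using xk(1) zk(1)[of k] by (simp add: field_simps)
      then have "norm (inverse (of_real x + of_nat k) - inverse (z + of_nat k)) = norm (z - of_real x) / ((x + real k) * norm (z + of_nat k))"
        by (simp add: norm_divide norm_mult xk(2))
      also have "\<dots> \<le> norm (z - of_real x) / ((x + real k) * (x + real k))"
        using x zk(2)[of k] by (intro divide_left_mono mult_left_mono mult_pos_pos) auto
      finally show "norm (inverse (of_real x + of_nat k) - inverse (z + of_nat k)) \<le> norm (z - of_real x) * inverse ((x + real k)\<^sup>2)"
        by (simp add: power2_eq_square divide_inverse)
    qed
    also have "\<dots> = norm (z - of_real x) * S" unfolding S_def by (rule suminf_mult[OF sm])
    also have "\<dots> \<le> ((1 + x) * (1 + norm z)) * S"
    proof (rule mult_right_mono[OF _ S])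
      have "norm (z - of_real x) \<le> norm z + x" using norm_triangle_ineq4[of z "of_real x"] x by simp
      also have "\<dots> \<le> (1 + x) * (1 + norm z)" using x by (simp add: algebra_simps)
      finally show "norm (z - of_real x) \<le> (1 + x) * (1 + norm z)" .
    qed
    finally have "norm (Digamma z) \<le> norm (Digamma (of_real x :: complex)) + (1 + x) * (1 + norm z) * S"
      using norm_triangle_ineq[of "Digamma z - Digamma (of_real x)" "Digamma (of_real x)"] by simp
    also have "\<dots> \<le> norm (Digamma (of_real x :: complex)) * (1 + norm z) + (1 + x) * (1 + norm z) * S"
      using mult_left_mono[of 1 "1 + norm z" "norm (Digamma (of_real x :: complex))"] by simp
    finally show "norm (Digamma z) \<le> K * (1 + norm z)" by (simp add: K_def algebra_simps)
  qed
qed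

lemma L_log_deriv_bound:
  assumes x: "0 < x"
  obtains K where "0 \<le> K" "\<And>s. x \<le> Re s \<Longrightarrow> Re s \<le> 2 \<Longrightarrow> norm (L_log_deriv s) \<le> K * (1 + \<bar>Im s\<bar>)"
proof -
  obtain K where K: "0 \<le> K" "\<And>z :: complex. x / 2 \<le> Re z \<Longrightarrow> norm (Digamma z) \<le> K * (1 + norm z)"
    using Digamma_linear_bound[of "x / 2"] x by auto
  show ?thesis
  proof (rule that[of "\<bar>ln pi\<bar> + 3 * K"])
    show "0 \<le> \<bar>ln pi\<bar> + 3 * K" using K by simp
    fix s assume s: "x \<le> Re s" "Re s \<le> 2"
    have "norm (L_log_deriv s) \<le> \<bar>ln pi\<bar> / 2 + norm (Digamma (s / 2)) / 2"
      unfolding L_log_deriv_def using norm_triangle_ineq4[of "of_real (ln pi) / 2" "Digamma (s / 2) / 2"] by (simp add: norm_divide)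
    also have "\<dots> \<le> \<bar>ln pi\<bar> + norm (Digamma (s / 2))"
      using abs_ge_zero[of "ln pi"] norm_ge_zero[of "Digamma (s / 2)"] by linarith
    also have "norm (Digamma (s / 2)) \<le> K * (1 + norm (s / 2))" using s by (intro K(2)) simp
    also have "\<dots> \<le> K * (3 * (1 + \<bar>Im s\<bar>))"
      using K(1) s x cmod_le[of s] by (intro mult_left_mono) (auto simp: norm_divide)
    also have "\<bar>ln pi\<bar> + K * (3 * (1 + \<bar>Im s\<bar>)) \<le> \<bar>ln pi\<bar> * (1 + \<bar>Im s\<bar>) + K * (3 * (1 + \<bar>Im s\<bar>))"
      using mult_left_mono[of 1 "1 + \<bar>Im s\<bar>" "\<bar>ln pi\<bar>"] by simp
    finally show "norm (L_log_deriv s) \<le> (\<bar>ln pi\<bar> + 3 * K) * (1 + \<bar>Im s\<bar>)" by (simp add: algebra_simps)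
  qed
qed

lemma Lambda_real_bound:
  assumes x: "0 < x" "x' < 1"
  obtains K where "0 \<le> K" "\<And>s. x \<le> Re s \<Longrightarrow> Re s \<le> x' \<Longrightarrow> norm (Lambda_local Real_Place s) \<le> K * (1 + \<bar>Im s\<bar>)"
proof -
  obtain K1 where K1: "0 \<le> K1" "\<And>s. x \<le> Re s \<Longrightarrow> Re s \<le> 2 \<Longrightarrow> norm (L_log_deriv s) \<le> K1 * (1 + \<bar>Im s\<bar>)"
    using L_log_deriv_bound[OF x(1)] by metis
  obtain K2 where K2: "0 \<le> K2" "\<And>s. 1 - x' \<le> Re s \<Longrightarrow> Re s \<le> 2 \<Longrightarrow> norm (L_log_deriv s) \<le> K2 * (1 + \<bar>Im s\<bar>)"
    using L_log_deriv_bound[of "1 - x'"] x by auto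
  show ?thesis
  proof (rule that[of "K1 + K2"])
    fix s assume s: "x \<le> Re s" "Re s \<le> x'"
    have "norm (Lambda_local Real_Place s) \<le> norm (L_log_deriv s) + norm (L_log_deriv (1 - s))"
      using s x by (subst Lambda_real(1)) (auto intro: norm_triangle_ineq)
    also have "\<dots> \<le> K1 * (1 + \<bar>Im s\<bar>) + K2 * (1 + \<bar>Im (1 - s)\<bar>)"
      using s x by (intro add_mono K1 K2) auto
    finally show "norm (Lambda_local Real_Place s) \<le> (K1 + K2) * (1 + \<bar>Im s\<bar>)" by (simp add: algebra_simps)
  qed (use K1 K2 in auto)
qed

text \<open>On the convex right half-plane \<open>h\<close> has a primitive \<open>H\<close>.
  Truncated integrals over the two lines then differ by increments of \<open>H\<close> along
  horizontal edges of length \<open>b - a\<close>, which tend to 0 by the decay of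
  \<open>h\<close>.\<close>

lemma vertical_integral_shift:
  assumes hol: "h holomorphic_on {s. 0 < Re s}" and ab: "0 < a" "a \<le> b"
    and bound: "\<And>s. a \<le> Re s \<Longrightarrow> Re s \<le> b \<Longrightarrow> norm (h s) \<le> C / (1 + (Im s)\<^sup>2)"
  shows "(LINT \<tau>|lborel. h (Complex a \<tau>)) = (LINT \<tau>|lborel. h (Complex b \<tau>))"
proof -
  have half: "{s. 0 < Re s} = {s::complex. 0 < 1 \<bullet> s}" by (auto simp: inner_complex_def)
  have op: "open {s::complex. 0 < Re s}" unfolding half by (rule open_halfspace_gt)
  have cv: "convex {s::complex. 0 < Re s}" unfolding half by (rule convex_halfspace_gt)
  obtain H where H: "\<And>s. 0 < Re s \<Longrightarrow> (H has_field_derivative h s) (at s)"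
    using holomorphic_convex_primitive'[OF cv op hol] at_within_open[OF _ op] by (metis mem_Collect_eq)
  have conth: "continuous_on {s. 0 < Re s} h" by (rule holomorphic_on_imp_continuous_on[OF hol])
  have cont: "continuous_on UNIV (\<lambda>\<tau>. h (Complex \<sigma> \<tau>))" if "0 < \<sigma>" for \<sigma>
    by (rule continuous_on_compose2[OF conth]) (use that in \<open>auto simp: Complex_eq intro!: continuous_intros\<close>)
  have int: "integrable lborel (\<lambda>\<tau>. h (Complex \<sigma> \<tau>))" if \<sigma>: "a \<le> \<sigma>" "\<sigma> \<le> b" for \<sigma>
  proof (rule Bochner_Integration.integrable_bound)
    show "integrable lborel (\<lambda>\<tau>. C * (1 / (1 + \<tau>\<^sup>2)))"
      by (rule integrable_mult_right[OF integrable_inverse_square])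
    show "(\<lambda>\<tau>. h (Complex \<sigma> \<tau>)) \<in> borel_measurable lborel"
      using cont[of \<sigma>] \<sigma> ab by (simp add: borel_measurable_continuous_onI)
    show "AE \<tau> in lborel. norm (h (Complex \<sigma> \<tau>)) \<le> norm (C * (1 / (1 + \<tau>\<^sup>2)))"
    proof (rule AE_I2)
      fix \<tau>
      have "norm (h (Complex \<sigma> \<tau>)) \<le> C * (1 / (1 + \<tau>\<^sup>2))"
        using bound[of "Complex \<sigma> \<tau>"] \<sigma> by simp
      then show "norm (h (Complex \<sigma> \<tau>)) \<le> norm (C * (1 / (1 + \<tau>\<^sup>2)))"
        by (rule order_trans) (simp only: real_norm_def abs_ge_self)
    qed
  qed
  have fin: "(LINT \<tau>|lborel. indicator {-real n..real n} \<tau> *\<^sub>R h (Complex \<sigma> \<tau>)) = - \<i> * (H (Complex \<sigma> (real n)) - H (Complex \<sigma> (- real n)))"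
    if \<sigma>: "a \<le> \<sigma>" for \<sigma> n
  proof -
    have "(LINT \<tau>|lborel. indicator {-real n..real n} \<tau> *\<^sub>R h (Complex \<sigma> \<tau>)) = - \<i> * H (Complex \<sigma> (real n)) - - \<i> * H (Complex \<sigma> (- real n))"
    proof (rule integral_FTC_Icc)
      fix \<tau> :: real
      have c: "((\<lambda>\<tau>. Complex \<sigma> \<tau>) has_vector_derivative \<i>) (at \<tau> within {- real n..real n})"
        unfolding Complex_eq by (auto intro!: derivative_eq_intros)
      have "((H \<circ> (\<lambda>\<tau>. Complex \<sigma> \<tau>)) has_vector_derivative \<i> * h (Complex \<sigma> \<tau>)) (at \<tau> within {- real n..real n})"
        by (rule field_vector_diff_chain_within[OF c has_field_derivative_at_within[OF H]]) (use \<sigma> ab in auto)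
      then have "((\<lambda>\<tau>. - \<i> * H (Complex \<sigma> \<tau>)) has_vector_derivative - \<i> * (\<i> * h (Complex \<sigma> \<tau>))) (at \<tau> within {- real n..real n})"
        unfolding o_def by (rule has_vector_derivative_mult_right)
      then show "((\<lambda>\<tau>. - \<i> * H (Complex \<sigma> \<tau>)) has_vector_derivative h (Complex \<sigma> \<tau>)) (at \<tau> within {- real n..real n})"
        by (simp flip: mult.assoc)
    qed (use cont[of \<sigma>] \<sigma> ab in \<open>auto intro: continuous_on_subset\<close>)
    then show ?thesis by (simp add: algebra_simps)
  qed
  have lim: "(\<lambda>n. LINT \<tau>|lborel. indicator {-real n..real n} \<tau> *\<^sub>R h (Complex \<sigma> \<tau>)) \<longlonglongrightarrow> (LINT \<tau>|lborel. h (Complex \<sigma> \<tau>))"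
    if \<sigma>: "a \<le> \<sigma>" "\<sigma> \<le> b" for \<sigma>
  proof (rule integral_dominated_convergence[where w = "\<lambda>\<tau>. norm (h (Complex \<sigma> \<tau>))"])
    note [measurable] = borel_measurable_continuous_onI[OF cont[of \<sigma>]]
    show "(\<lambda>\<tau>. h (Complex \<sigma> \<tau>)) \<in> borel_measurable lborel"
      "(\<lambda>\<tau>. indicator {-real n..real n} \<tau> *\<^sub>R h (Complex \<sigma> \<tau>)) \<in> borel_measurable lborel" for n
      using \<sigma> ab by simp_all
    show "AE \<tau> in lborel. (\<lambda>n. indicator {-real n..real n} \<tau> *\<^sub>R h (Complex \<sigma> \<tau>)) \<longlonglongrightarrow> h (Complex \<sigma> \<tau>)"
    proof (rule AE_I2)
      fix \<tau> :: real
      obtain N where "\<bar>\<tau>\<bar> \<le> real N" using real_arch_simple by blast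
      then have "\<forall>\<^sub>F n in sequentially. indicator {-real n..real n} \<tau> *\<^sub>R h (Complex \<sigma> \<tau>) = h (Complex \<sigma> \<tau>)"
        by (intro eventually_sequentiallyI[of N]) (auto simp: indicator_def)
      then show "(\<lambda>n. indicator {-real n..real n} \<tau> *\<^sub>R h (Complex \<sigma> \<tau>)) \<longlonglongrightarrow> h (Complex \<sigma> \<tau>)"
        by (rule tendsto_eventually)
    qed
  qed (use int[OF \<sigma>] in \<open>auto simp: indicator_def\<close>)
  have edge: "norm (H (Complex b t) - H (Complex a t)) \<le> C / (1 + t\<^sup>2) * (b - a)" for t
  proof -
    have seg: "a \<le> Re s \<and> Re s \<le> b \<and> Im s = t" if s: "s \<in> closed_segment (Complex a t) (Complex b t)" for s
    proof -
      obtain u where u: "0 \<le> u" "u \<le> 1" "s = (1 - u) *\<^sub>R Complex a t + u *\<^sub>R Complex b t"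
        using s by (auto simp: closed_segment_def)
      have "Re s = (1 - u) * a + u * b" unfolding u(3) by simp
      then have "Re s = a + u * (b - a)" by (simp add: algebra_simps)
      moreover have "u * (b - a) \<le> 1 * (b - a)" by (intro mult_right_mono) (use u ab in auto)
      moreover have "0 \<le> u * (b - a)" using u ab by simp
      moreover have "Im s = (1 - u) * t + u * t" unfolding u(3) by simp
      then have "Im s = t" by (simp add: algebra_simps)
      ultimately show ?thesis by auto
    qed
    have "norm (H (Complex b t) - H (Complex a t)) \<le> C / (1 + t\<^sup>2) * norm (Complex b t - Complex a t)"
    proof (rule field_differentiable_bound[where S = "closed_segment (Complex a t) (Complex b t)" and f' = h])
      fix s assume s: "s \<in> closed_segment (Complex a t) (Complex b t)"
      show "(H has_field_derivative h s) (at s within closed_segment (Complex a t) (Complex b t))"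
        using seg[OF s] ab by (intro has_field_derivative_at_within[OF H]) auto
      show "norm (h s) \<le> C / (1 + t\<^sup>2)" using seg[OF s] bound[of s] by auto
    qed auto
    also have "Complex b t - Complex a t = of_real (b - a)" by (simp add: complex_eq_iff)
    finally show ?thesis using ab by (simp only: norm_of_real abs_of_nonneg)
  qed
  have edge0: "(\<lambda>n. C / (1 + (real n)\<^sup>2) * (b - a)) \<longlonglongrightarrow> 0" by real_asymp
  have e1: "(\<lambda>n. H (Complex b (real n)) - H (Complex a (real n))) \<longlonglongrightarrow> 0"
    by (rule Lim_null_comparison[OF always_eventually edge0]) (use edge in blast)
  have e2: "(\<lambda>n. H (Complex b (- real n)) - H (Complex a (- real n))) \<longlonglongrightarrow> 0"
    by (rule Lim_null_comparison[OF always_eventually edge0]) (metis edge power2_minus)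
  have "(\<lambda>n. (LINT \<tau>|lborel. indicator {-real n..real n} \<tau> *\<^sub>R h (Complex b \<tau>)) - (LINT \<tau>|lborel. indicator {-real n..real n} \<tau> *\<^sub>R h (Complex a \<tau>)))
      = (\<lambda>n. - \<i> * ((H (Complex b (real n)) - H (Complex a (real n))) - (H (Complex b (- real n)) - H (Complex a (- real n)))))"
    unfolding fin[OF order_refl] fin[OF ab(2)] by (simp add: algebra_simps)
  moreover have "\<dots> \<longlonglongrightarrow> - \<i> * (0 - 0)" by (intro tendsto_intros e1 e2)
  ultimately have z: "(\<lambda>n. (LINT \<tau>|lborel. indicator {-real n..real n} \<tau> *\<^sub>R h (Complex b \<tau>)) - (LINT \<tau>|lborel. indicator {-real n..real n} \<tau> *\<^sub>R h (Complex a \<tau>))) \<longlonglongrightarrow> 0"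
    by simp
  have "(LINT \<tau>|lborel. h (Complex b \<tau>)) - (LINT \<tau>|lborel. h (Complex a \<tau>)) = 0"
    by (rule LIMSEQ_unique[OF tendsto_diff[OF lim lim] z]) (use ab in auto)
  then show ?thesis by simp
qed

text \<open>The half with \<open>mellin g s\<close> is moved to \<open>Re s = c\<close>, the half
  with \<open>mellin g (1 - s)\<close> to \<open>Re s = 1 - c\<close>. Reversing \<tau> in the
  latter brings it to the line \<open>Re s = c\<close>, now with \<open>L_log_deriv (1 - s)\<close>.
  No residue arises because \<open>L_log_deriv\<close> is holomorphic for positive real
  part.\<close>

lemma W_local_real:
  assumes g: "is_test_function g" and c: "0 < c" "c < 1"
  shows "W_local Real_Place g = W_at Real_Place c g (1::real)"
proof -
  define x where "x = min c (1 - c)"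
  have x: "0 < x" using c by (simp add: x_def)
  obtain K where K: "0 \<le> K" "\<And>s. x \<le> Re s \<Longrightarrow> Re s \<le> 2 \<Longrightarrow> norm (L_log_deriv s) \<le> K * (1 + \<bar>Im s\<bar>)"
    using L_log_deriv_bound[OF x] by metis
  obtain C where C: "0 \<le> C" "\<And>s. \<bar>Re s\<bar> \<le> 2 \<Longrightarrow> norm (mellin g s) * (1 + \<bar>Im s\<bar>) \<le> C / (1 + (Im s)\<^sup>2)"
    using mellin_decay_product[OF g, of 2] by metis
  define h1 where "h1 s = L_log_deriv s * mellin g s" for s
  define h2 where "h2 s = L_log_deriv s * mellin g (1 - s)" for s
  have bnd: "norm (L_log_deriv s * mellin g z) \<le> (K * C) / (1 + (Im s)\<^sup>2)"
    if "x \<le> Re s" "Re s \<le> 2" "\<bar>Re z\<bar> \<le> 2" "\<bar>Im z\<bar> = \<bar>Im s\<bar>" for s z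
  proof -
    have "norm (L_log_deriv s * mellin g z) \<le> (K * (1 + \<bar>Im s\<bar>)) * norm (mellin g z)"
      unfolding norm_mult using that by (intro mult_right_mono K) auto
    also have "\<dots> = K * (norm (mellin g z) * (1 + \<bar>Im z\<bar>))" using that by simp
    also have "\<dots> \<le> K * (C / (1 + (Im z)\<^sup>2))" using that K by (intro mult_left_mono C) auto
    also have "(Im z)\<^sup>2 = (Im s)\<^sup>2" by (metis power2_abs that(4))
    finally show ?thesis by simp
  qed
  have b1: "norm (h1 s) \<le> (K * C) / (1 + (Im s)\<^sup>2)" and b2: "norm (h2 s) \<le> (K * C) / (1 + (Im s)\<^sup>2)"
    if "x \<le> Re s" "Re s \<le> 3/2" for s
    unfolding h1_def h2_def using that x by (auto intro!: bnd)
  have "mellin g \<circ> (\<lambda>s. 1 - s) holomorphic_on {s. 0 < Re s}"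
    by (intro holomorphic_on_compose_gen[OF _ mellin_holomorphic[OF g, of UNIV]] holomorphic_intros) auto
  then have hol: "h1 holomorphic_on {s. 0 < Re s}" "h2 holomorphic_on {s. 0 < Re s}"
    unfolding h1_def h2_def by (auto intro!: holomorphic_intros L_log_deriv_holomorphic mellin_holomorphic[OF g] simp: o_def)
  have int: "integrable lborel (\<lambda>\<tau>. h (Complex \<sigma> \<tau>))"
    if h: "h holomorphic_on {s. 0 < Re s}" "\<And>s. x \<le> Re s \<Longrightarrow> Re s \<le> 3/2 \<Longrightarrow> norm (h s) \<le> (K * C) / (1 + (Im s)\<^sup>2)"
      and \<sigma>: "x \<le> \<sigma>" "\<sigma> \<le> 3/2" for h :: "complex \<Rightarrow> complex" and \<sigma>
  proof (rule Bochner_Integration.integrable_bound)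
    show "integrable lborel (\<lambda>\<tau>. (K * C) * (1 / (1 + \<tau>\<^sup>2)))"
      by (rule integrable_mult_right[OF integrable_inverse_square])
    have "continuous_on UNIV (\<lambda>\<tau>. h (Complex \<sigma> \<tau>))"
      by (rule continuous_on_compose2[OF holomorphic_on_imp_continuous_on[OF h(1)]])
         (use \<sigma> x in \<open>auto simp: Complex_eq intro!: continuous_intros\<close>)
    then show "(\<lambda>\<tau>. h (Complex \<sigma> \<tau>)) \<in> borel_measurable lborel"
      by (simp add: borel_measurable_continuous_onI)
    show "AE \<tau> in lborel. norm (h (Complex \<sigma> \<tau>)) \<le> norm ((K * C) * (1 / (1 + \<tau>\<^sup>2)))"
    proof (rule AE_I2)
      fix \<tau>
      have "norm (h (Complex \<sigma> \<tau>)) \<le> (K * C) * (1 / (1 + \<tau>\<^sup>2))"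
        using h(2)[of "Complex \<sigma> \<tau>"] \<sigma> by simp
      then show "norm (h (Complex \<sigma> \<tau>)) \<le> norm ((K * C) * (1 / (1 + \<tau>\<^sup>2)))"
        by (rule order_trans) (simp only: real_norm_def abs_ge_self)
    qed
  qed
  note i1 = int[OF hol(1) b1] and i2 = int[OF hol(2) b2]
  have "vertical_integral (3 / 2) (\<lambda>s. - deriv (L_local Real_Place) s / L_local Real_Place s * (mellin g s + mellin g (1 - s)))
     = (LINT \<tau>|lborel. h1 (Complex (3/2) \<tau>) * \<i> + h2 (Complex (3/2) \<tau>) * \<i>)"
    unfolding vertical_integral_def h1_def h2_def
    by (intro Bochner_Integration.integral_cong refl, subst minus_L_log_deriv) (auto simp: algebra_simps)
  also have "\<dots> = (LINT \<tau>|lborel. h1 (Complex (3/2) \<tau>)) * \<i> + (LINT \<tau>|lborel. h2 (Complex (3/2) \<tau>)) * \<i>"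
  proof -
    have "integrable lborel (\<lambda>\<tau>. h1 (Complex (3/2) \<tau>))" "integrable lborel (\<lambda>\<tau>. h2 (Complex (3/2) \<tau>))"
      using c by (auto intro!: i1 i2 simp: x_def min_def)
    from Bochner_Integration.integral_add[OF integrable_mult_left[OF this(1)] integrable_mult_left[OF this(2)]]
    show ?thesis by simp
  qed
  also have "(LINT \<tau>|lborel. h1 (Complex (3/2) \<tau>)) = (LINT \<tau>|lborel. h1 (Complex c \<tau>))"
    by (rule vertical_integral_shift[OF hol(1), symmetric, where C = "K * C"]) (use c b1 in \<open>auto simp: x_def\<close>)
  also have "(LINT \<tau>|lborel. h2 (Complex (3/2) \<tau>)) = (LINT \<tau>|lborel. h2 (Complex (1 - c) \<tau>))"
    by (rule vertical_integral_shift[OF hol(2), symmetric, where C = "K * C"]) (use c b2 in \<open>auto simp: x_def\<close>)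
  also have "\<dots> = (LINT \<tau>|lborel. h2 (Complex (1 - c) (0 + (-1) * \<tau>)))"
    by (subst lborel_integral_real_affine[where c = "-1" and t = 0]) simp_all
  also have "(LINT \<tau>|lborel. h1 (Complex c \<tau>)) * \<i> + (LINT \<tau>|lborel. h2 (Complex (1 - c) (0 + (-1) * \<tau>))) * \<i>
     = (LINT \<tau>|lborel. h1 (Complex c \<tau>) * \<i> + h2 (Complex (1 - c) (0 + (-1) * \<tau>)) * \<i>)"
  proof -
    have j2: "integrable lborel (\<lambda>\<tau>. h2 (Complex (1 - c) (0 + (-1) * \<tau>)))"
      by (rule lborel_integrable_real_affine) (use c in \<open>auto intro!: i2 simp: x_def\<close>)
    have j1: "integrable lborel (\<lambda>\<tau>. h1 (Complex c \<tau>))" using c by (intro i1) (auto simp: x_def)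
    from Bochner_Integration.integral_add[OF integrable_mult_left[OF j1] integrable_mult_left[OF j2]]
    show ?thesis by (simp only: integral_mult_left_zero)
  qed
  also have "\<dots> = vertical_integral c (\<lambda>s. Lambda_local Real_Place s * mellin g s * of_real (absv (1::real)) powr (- s))"
    unfolding vertical_integral_def
  proof (intro Bochner_Integration.integral_cong refl)
    fix \<tau>
    have e: "Complex (1 - c) (0 + (-1) * \<tau>) = 1 - Complex c \<tau>" by (simp add: complex_eq_iff)
    show "h1 (Complex c \<tau>) * \<i> + h2 (Complex (1 - c) (0 + (-1) * \<tau>)) * \<i>
       = Lambda_local Real_Place (Complex c \<tau>) * mellin g (Complex c \<tau>) * of_real (absv (1::real)) powr (- Complex c \<tau>) * \<i>"
      unfolding e h1_def h2_def using c by (subst Lambda_real(1)) (auto simp: absv_def algebra_simps)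
  qed
  finally show ?thesis by (simp only: W_local_def W_at_def)
qed

section \<open>The symbol of the Riesz potential near \<open>w = 0\<close>, and auxiliary
  integrability\<close>

abbreviation \<Gamma>\<^sub>r :: "complex \<Rightarrow> complex" where "\<Gamma>\<^sub>r \<equiv> Gamma_local Real_Place"

lemma Gamma_real_reciprocal:
  assumes "0 < Re s" "Re s < 1"
  shows "\<Gamma>\<^sub>r (1 - s) * \<Gamma>\<^sub>r s = 1"
  using L_real_deriv(1)[of s] L_real_deriv(1)[of "1 - s"] assms by (simp add: Gamma_local_def del: L_local.simps)

text \<open>The derivative of \<open>\<Gamma>\<^sub>r\<close> is
  \<open>- \<Gamma>\<^sub>r * \<Lambda>\<close>, and the inner function \<open>s - w\<close>
  restores the sign. The exponential factor, which is \<open>y powr w\<close> for real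
  \<open>w\<close> and positive \<open>y\<close>, adds \<open>ln y\<close>, the origin of the
  logarithmic summand of the theorem.\<close>

lemma riesz_symbol_deriv:
  fixes y :: real and s w :: complex
  assumes "0 < Re (s - w)" "Re (s - w) < 1"
  shows "((\<lambda>w. exp (w * of_real (ln y)) * \<Gamma>\<^sub>r (1 - s) * \<Gamma>\<^sub>r (s - w)) has_field_derivative
     exp (w * of_real (ln y)) * \<Gamma>\<^sub>r (1 - s) * \<Gamma>\<^sub>r (s - w) * (of_real (ln y) + Lambda_local Real_Place (s - w))) (at w within S)"
proof -
  have "((\<lambda>w. \<Gamma>\<^sub>r (s - w)) has_field_derivative (- \<Gamma>\<^sub>r (s - w) * Lambda_local Real_Place (s - w)) * (- 1)) (at w)"
    by (rule DERIV_chain2[where f = "\<Gamma>\<^sub>r" and g = "\<lambda>w. s - w", OF Lambda_real(2)[OF assms]]) (auto intro!: derivative_eq_intros)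
  then have "((\<lambda>w. exp (w * of_real (ln y)) * \<Gamma>\<^sub>r (1 - s) * \<Gamma>\<^sub>r (s - w)) has_field_derivative
     exp (w * of_real (ln y)) * \<Gamma>\<^sub>r (1 - s) * \<Gamma>\<^sub>r (s - w) * (of_real (ln y) + Lambda_local Real_Place (s - w))) (at w)"
    by (auto intro!: derivative_eq_intros simp: algebra_simps)
  then show ?thesis by (rule has_field_derivative_at_within)
qed

lemma riesz_symbol_limit:
  fixes y :: real
  assumes s: "0 < Re s" "Re s < 1" and X: "X \<longlonglongrightarrow> 0" "\<And>n. 0 < X n"
  shows "(\<lambda>n. (exp (of_real (X n) * of_real (ln y)) * \<Gamma>\<^sub>r (1 - s) * \<Gamma>\<^sub>r (s - of_real (X n)) - 1) / of_real (X n))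
     \<longlonglongrightarrow> of_real (ln y) + Lambda_local Real_Place s"
proof -
  have "((\<lambda>w. exp (w * of_real (ln y)) * \<Gamma>\<^sub>r (1 - s) * \<Gamma>\<^sub>r (s - w)) has_field_derivative
     exp (0 * of_real (ln y)) * \<Gamma>\<^sub>r (1 - s) * \<Gamma>\<^sub>r (s - 0) * (of_real (ln y) + Lambda_local Real_Place (s - 0))) (at 0)"
    by (rule riesz_symbol_deriv) (use s in auto)
  then have L: "((\<lambda>w. (exp (w * of_real (ln y)) * \<Gamma>\<^sub>r (1 - s) * \<Gamma>\<^sub>r (s - w) - 1) / w) \<longlongrightarrow> of_real (ln y) + Lambda_local Real_Place s) (at 0)"
    using Gamma_real_reciprocal[OF s] by (simp add: DERIV_def)
  have "(\<lambda>n. complex_of_real (X n)) \<longlonglongrightarrow> of_real 0" by (intro tendsto_of_real X)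
  then have "filterlim (\<lambda>n. complex_of_real (X n)) (at 0) sequentially"
    using X(2) by (auto simp: filterlim_at intro!: always_eventually) (metis less_irrefl)
  from filterlim_compose[OF L this] show ?thesis .
qed

text \<open>The mean value inequality on the segment from 0 to \<open>w\<close>, at whose start the
  symbol is 1. The derivative is the symbol, bounded uniformly in \<tau>, times a factor of at most
  linear growth; \<open>w \<le> c / 2\<close> keeps \<open>Re (s - w)\<close> between
  \<open>c / 2\<close> and \<open>c\<close>.\<close>

lemma riesz_symbol_bound:
  fixes y :: real
  assumes c: "0 < c" "c < 1"
  obtains K where "0 \<le> K" "\<And>\<tau> w. 0 < w \<Longrightarrow> w \<le> c / 2 \<Longrightarrow>
     norm ((exp (of_real w * of_real (ln y)) * \<Gamma>\<^sub>r (1 - Complex c \<tau>) * \<Gamma>\<^sub>r (Complex c \<tau> - of_real w) - 1) / of_real w) \<le> K * (1 + \<bar>\<tau>\<bar>)"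
proof -
  obtain K1 where K1: "0 \<le> K1" "\<And>s. c / 2 \<le> Re s \<Longrightarrow> Re s \<le> c \<Longrightarrow> norm (Lambda_local Real_Place s) \<le> K1 * (1 + \<bar>Im s\<bar>)"
    using Lambda_real_bound[of "c / 2" c] c by auto
  \<comment> \<open>Positivity of the kernel reduces the whole vertical line to its real point, and
    there continuity in \<open>w\<close> on a compact interval gives a bound.\<close>
  have "compact ((\<lambda>w. \<Gamma>\<^sub>r (1 - of_real c) * \<Gamma>\<^sub>r (of_real (c - w))) ` {0..c / 2})"
  proof (intro compact_continuous_image)
    have cg: "continuous_on {s. 0 < Re s \<and> Re s < 1} \<Gamma>\<^sub>r"
      by (rule DERIV_continuous_on[OF has_field_derivative_at_within[OF Lambda_real(2)]]) auto
    show "continuous_on {0..c / 2} (\<lambda>w. \<Gamma>\<^sub>r (1 - of_real c) * \<Gamma>\<^sub>r (of_real (c - w)))"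
      by (intro continuous_intros continuous_on_compose2[OF cg]) (use c in auto)
  qed auto
  then obtain M where M: "\<And>w. w \<in> {0..c / 2} \<Longrightarrow> norm (\<Gamma>\<^sub>r (1 - of_real c) * \<Gamma>\<^sub>r (of_real (c - w))) \<le> M"
    using compact_imp_bounded bounded_iff by (metis (no_types, lifting) imageI)
  have symb: "norm (\<Gamma>\<^sub>r (1 - Complex c \<tau>) * \<Gamma>\<^sub>r (Complex c \<tau> - of_real w)) \<le> max M 1" if w: "0 \<le> w" "w \<le> c / 2" for w \<tau>
  proof (cases "w = 0")
    case True
    then show ?thesis using Gamma_real_reciprocal[of "Complex c \<tau>"] c by simp
  next
    case False
    \<comment> \<open>Dividing by \<open>\<Gamma>\<^sub>r w\<close> isolates the product to be
      bounded; the pole of this factor at 0 is why \<open>w = 0\<close> is treated apart.\<close>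
    have nz: "\<Gamma>\<^sub>r (of_real w) \<noteq> 0"
      using Gamma_real_reciprocal[of "of_real w"] False w c by auto
    have "norm (\<Gamma>\<^sub>r (of_real w) * \<Gamma>\<^sub>r (1 - Complex c \<tau>) * \<Gamma>\<^sub>r (Complex c \<tau> - of_real w))
      \<le> norm (\<Gamma>\<^sub>r (of_real w) * \<Gamma>\<^sub>r (1 - of_real (Re (Complex c \<tau>))) * \<Gamma>\<^sub>r (of_real (Re (Complex c \<tau>) - w)))"
      by (rule norm_mellin_riesz_le) (use False w c in auto)
    then have "norm (\<Gamma>\<^sub>r (1 - Complex c \<tau>) * \<Gamma>\<^sub>r (Complex c \<tau> - of_real w)) \<le> norm (\<Gamma>\<^sub>r (1 - of_real c) * \<Gamma>\<^sub>r (of_real (c - w)))"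
      using nz by (simp add: norm_mult mult.assoc)
    then show ?thesis using M[of w] w by force
  qed
  define E where "E = exp \<bar>ln y\<bar>"
  define K where "K = E * max M 1 * (\<bar>ln y\<bar> + K1)"
  show ?thesis
  proof (rule that[of K])
    show "0 \<le> K" using K1 by (auto simp: K_def E_def intro!: mult_nonneg_nonneg)
    fix \<tau> w :: real assume w: "0 < w" "w \<le> c / 2"
    define s where "s = Complex c \<tau>"
    let ?G = "\<lambda>w. exp (w * of_real (ln y)) * \<Gamma>\<^sub>r (1 - s) * \<Gamma>\<^sub>r (s - w)"
    have seg: "\<exists>v. z = of_real v \<and> 0 \<le> v \<and> v \<le> w" if z: "z \<in> closed_segment 0 (complex_of_real w)" for z
    proof -
      obtain u where "0 \<le> u" "u \<le> 1" "z = of_real (u * w)"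
        using z by (auto simp: closed_segment_def scaleR_conv_of_real)
      then show ?thesis using w by (intro exI[of _ "u * w"]) (auto intro: mult_left_le_one_le)
    qed
    have "norm (?G (of_real w) - ?G 0) \<le> (K * (1 + \<bar>\<tau>\<bar>)) * norm (complex_of_real w - 0)"
    proof (rule field_differentiable_bound[where S = "closed_segment 0 (complex_of_real w)"])
      fix z assume "z \<in> closed_segment 0 (complex_of_real w)"
      then obtain v where v: "z = of_real v" "0 \<le> v" "v \<le> w" using seg by blast
      show "(?G has_field_derivative ?G z * (of_real (ln y) + Lambda_local Real_Place (s - z))) (at z within closed_segment 0 (complex_of_real w))"
        by (rule riesz_symbol_deriv) (use v w c in \<open>auto simp: s_def\<close>)
      have "norm (exp (z * of_real (ln y))) \<le> E"
      proof -
        have "v * ln y \<le> v * \<bar>ln y\<bar>" using v by (intro mult_left_mono) auto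
        also have "\<dots> \<le> 1 * \<bar>ln y\<bar>" using v w c by (intro mult_right_mono) auto
        finally have "v * ln y \<le> \<bar>ln y\<bar>" by simp
        then show ?thesis by (simp add: v E_def)
      qed
      moreover have "norm (\<Gamma>\<^sub>r (1 - s) * \<Gamma>\<^sub>r (s - z)) \<le> max M 1"
        unfolding v s_def using v w by (intro symb) auto
      moreover have "norm (of_real (ln y) + Lambda_local Real_Place (s - z)) \<le> (\<bar>ln y\<bar> + K1) * (1 + \<bar>\<tau>\<bar>)"
      proof -
        have "norm (of_real (ln y) + Lambda_local Real_Place (s - z)) \<le> \<bar>ln y\<bar> + K1 * (1 + \<bar>Im (s - z)\<bar>)"
          using v w c by (intro order_trans[OF norm_triangle_ineq] add_mono K1) (auto simp: s_def)
        also have "\<bar>Im (s - z)\<bar> = \<bar>\<tau>\<bar>" by (simp add: s_def v)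
        also have "\<bar>ln y\<bar> + K1 * (1 + \<bar>\<tau>\<bar>) \<le> (\<bar>ln y\<bar> + K1) * (1 + \<bar>\<tau>\<bar>)"
          by (simp add: algebra_simps)
        finally show ?thesis .
      qed
      ultimately have "norm (exp (z * of_real (ln y))) * norm (\<Gamma>\<^sub>r (1 - s) * \<Gamma>\<^sub>r (s - z)) * norm (of_real (ln y) + Lambda_local Real_Place (s - z))
        \<le> E * max M 1 * ((\<bar>ln y\<bar> + K1) * (1 + \<bar>\<tau>\<bar>))"
        by (intro mult_mono) (auto simp: E_def)
      then show "norm (?G z * (of_real (ln y) + Lambda_local Real_Place (s - z))) \<le> K * (1 + \<bar>\<tau>\<bar>)"
        by (simp add: norm_mult K_def mult_ac)
    qed auto
    moreover have "?G 0 = 1" using Gamma_real_reciprocal[of s] c by (simp add: s_def)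
    ultimately show "norm ((exp (of_real w * of_real (ln y)) * \<Gamma>\<^sub>r (1 - Complex c \<tau>) * \<Gamma>\<^sub>r (Complex c \<tau> - of_real w) - 1) / of_real w) \<le> K * (1 + \<bar>\<tau>\<bar>)"
      using w by (simp add: s_def norm_divide pos_divide_le_eq)
  qed
qed

text \<open>\<open>g\<close> vanishes near 0, so the even extension is smooth across 0 with all
  derivatives 0 there. Elsewhere each differentiation of a function of \<open>|v|\<close>
  contributes a sign, whence the factor \<open>sgn v ^ n\<close>.\<close>

lemma lift_abs_real_derivs:
  assumes "is_test_function g"
  obtains P R where "P (0::nat) = (lift_abs g :: real \<Rightarrow> complex)" "0 < R"
    "\<And>n v. (P n has_vector_derivative P (Suc n) v) (at v)"
    "\<And>n v. R \<le> \<bar>v\<bar> \<Longrightarrow> P n v = (0 :: complex)"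
proof -
  obtain D a b where D: "D 0 = g"
    "\<And>n u. 0 < u \<Longrightarrow> (D n has_vector_derivative D (Suc n) u) (at u)"
    and ab: "0 < a" "\<And>n u. 0 < u \<Longrightarrow> u \<notin> {a..b} \<Longrightarrow> D n u = (0 :: complex)"
    by (rule test_function_derivs[OF assms], rule that) assumption+
  define P where "P n v = (if v = 0 then 0 else of_real (sgn v ^ n) * D n \<bar>v\<bar>)" for n and v :: real
  show ?thesis
  proof (rule that[of P "\<bar>b\<bar> + 1"])
    show "P 0 = lift_abs g" by (auto simp: P_def lift_abs_def absv_def D)
    show "P n v = 0" if v: "\<bar>b\<bar> + 1 \<le> \<bar>v\<bar>" for n v
    proof -
      have "\<bar>v\<bar> \<notin> {a..b}" using v by auto
      then show ?thesis using ab(2)[of "\<bar>v\<bar>" n] by (cases "v = 0") (auto simp: P_def)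
    qed
    fix n and v :: real
    consider "v > 0" | "v < 0" | "v = 0" by linarith
    then show "(P n has_vector_derivative P (Suc n) v) (at v)"
    proof cases
      case 1
      have "(D n has_vector_derivative P (Suc n) v) (at v)"
        using D(2)[OF 1, of n] 1 by (simp add: P_def)
      then show ?thesis
        by (rule has_vector_derivative_transform_within_open[of _ _ _ "{0<..}"]) (use 1 in \<open>auto simp: P_def\<close>)
    next
      case 2
      have "(uminus has_real_derivative -1) (at v)" by (auto intro!: derivative_eq_intros)
      then have "((D n \<circ> uminus) has_vector_derivative (-1) *\<^sub>R D (Suc n) (- v)) (at v)"
        using D(2)[of "- v" n] 2
        by (intro vector_diff_chain_at) (auto simp: has_real_derivative_iff_has_vector_derivative)
      then have "((\<lambda>v. (-1) ^ n * (D n \<circ> uminus) v) has_vector_derivative (-1) ^ n * ((-1) *\<^sub>R D (Suc n) (- v))) (at v)"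
        by (rule has_vector_derivative_mult_right)
      then have "((\<lambda>v. (-1) ^ n * D n (- v)) has_vector_derivative P (Suc n) v) (at v)"
        using 2 by (simp add: P_def o_def)
      then show ?thesis
        by (rule has_vector_derivative_transform_within_open[of _ _ _ "{..<0}"]) (use 2 in \<open>auto simp: P_def\<close>)
    next
      case 3
      have "((\<lambda>_. 0) has_vector_derivative P (Suc n) v) (at v)" using 3 by (simp add: P_def)
      then show ?thesis
        by (rule has_vector_derivative_transform_within_open[of _ _ _ "{-a<..<a}"])
           (use 3 ab in \<open>auto simp: P_def not_le abs_less_iff\<close>)
    qed
  qed auto
qed

text \<open>Comparison with \<open>|x| powr \<alpha>\<close> near 0, where
  \<open>-1 < \<alpha>\<close> is used, and with \<open>|x| powr (\<alpha> - 2)\<close> at infinity,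
  where \<open>\<alpha> < 1\<close> is used.\<close>

lemma integrable_powr_kernel:
  assumes \<alpha>: "-1 < \<alpha>" "\<alpha> < (1::real)"
  shows "integrable lborel (\<lambda>x::real. \<bar>x\<bar> powr \<alpha> / (1 + x\<^sup>2))"
proof -
  have nonneg_int: "integrable lborel (\<lambda>x. indicator S x * f x)"
    if "(f has_integral I) S" "S \<in> sets borel" "f \<in> borel_measurable borel" "\<And>x. x \<in> S \<Longrightarrow> 0 \<le> f x" for f :: "real \<Rightarrow> real" and I S
  proof -
    note [measurable] = that(2,3)
    have "f absolutely_integrable_on S"
      using that by (intro nonnegative_absolutely_integrable_1) (auto simp: integrable_on_def)
    then show ?thesis unfolding set_integrable_def by (subst (asm) integrable_completion) auto
  qed
  define h where "h x = indicator {0..1} x * x powr \<alpha> + indicator {1..} x * x powr (\<alpha> - 2)" for x :: real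
  have h: "integrable lborel h"
  proof -
    have "((\<lambda>x. x powr \<alpha>) has_integral (1 powr (\<alpha> + 1) / (\<alpha> + 1))) {0..1}"
      "((\<lambda>x. x powr (\<alpha> - 2)) has_integral - (1 powr (\<alpha> - 2 + 1)) / (\<alpha> - 2 + 1)) {1..}"
      by (rule has_integral_powr_from_0 has_integral_powr_to_inf; use \<alpha> in simp)+
    then show ?thesis
      unfolding h_def by (intro Bochner_Integration.integrable_add nonneg_int) auto
  qed
  have "integrable lborel (\<lambda>x. h (0 + (-1) * x))" by (rule lborel_integrable_real_affine[OF h]) simp
  then have "integrable lborel (\<lambda>x. h x + h (0 + (-1) * x))" using h by (intro Bochner_Integration.integrable_add)
  then show ?thesis
  proof (rule Bochner_Integration.integrable_bound)
    have hn: "0 \<le> h x" for x by (simp add: h_def)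
    have hp: "\<bar>x\<bar> powr \<alpha> / (1 + x\<^sup>2) \<le> h \<bar>x\<bar>" for x :: real
    proof (cases "\<bar>x\<bar> \<le> 1")
      case True
      have "\<bar>x\<bar> powr \<alpha> / (1 + x\<^sup>2) \<le> \<bar>x\<bar> powr \<alpha> / 1" by (intro divide_left_mono) (auto simp: add_pos_nonneg)
      also have "\<dots> \<le> h \<bar>x\<bar>" using True by (simp add: h_def)
      finally show ?thesis .
    next
      case False
      have "\<bar>x\<bar> powr \<alpha> / (1 + x\<^sup>2) \<le> \<bar>x\<bar> powr \<alpha> / x\<^sup>2" using False by (intro divide_left_mono) (auto simp: add_pos_nonneg)
      also have "\<dots> = \<bar>x\<bar> powr \<alpha> / \<bar>x\<bar> powr 2" using False by (simp add: powr_numeral)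
      also have "\<dots> = \<bar>x\<bar> powr (\<alpha> - 2)" by (simp add: powr_diff)
      also have "\<dots> \<le> h \<bar>x\<bar>" using False by (simp add: h_def)
      finally show ?thesis .
    qed
    show "AE x in lborel. norm (\<bar>x\<bar> powr \<alpha> / (1 + x\<^sup>2)) \<le> norm (h x + h (0 + (-1) * x))"
    proof (rule AE_I2)
      fix x :: real
      have "h \<bar>x\<bar> \<le> h x + h (- x)" using hn[of x] hn[of "- x"] by (cases "0 \<le> x") auto
      then show "norm (\<bar>x\<bar> powr \<alpha> / (1 + x\<^sup>2)) \<le> norm (h x + h (0 + (-1) * x))"
        using hp[of x] hn[of x] hn[of "- x"] by simp
    qed
  qed measurable
qed

section \<open>Fourier analysis at the real place\<close>

text \<open>Since \<open>k\<close> is nonnegative, the absolute double integral is that of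
  \<open>norm (u x) * m x\<close>. The representation of \<open>m\<close> is asked only almost
  everywhere because the powers represented later are singular at one point.\<close>

lemma integral_kernel_swap:
  fixes u :: "real \<Rightarrow> complex" and k :: "real \<Rightarrow> real \<Rightarrow> real"
  assumes k [measurable]: "case_prod k \<in> borel_measurable (lborel \<Otimes>\<^sub>M lborel)" and u [measurable]: "u \<in> borel_measurable lborel"
    and m: "AE x in lborel. has_bochner_integral lborel (k x) (m x)" and k_nonneg: "\<And>x t. 0 \<le> k x t"
    and int: "integrable lborel (\<lambda>x. norm (u x) * m x)" and m_meas [measurable]: "m \<in> borel_measurable lborel"
  shows "(LINT x|lborel. u x * of_real (m x)) = (LINT t|lborel. LINT x|lborel. u x * of_real (k x t))"
proof -
  have ae: "AE x in lborel. integrable lborel (\<lambda>t. u x * of_real (k x t)) \<and> (LINT t|lborel. u x * of_real (k x t)) = u x * of_real (m x)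
      \<and> (LINT t|lborel. norm (u x * of_real (k x t))) = norm (u x) * m x"
    using m
  proof eventually_elim
    case (elim x)
    have "norm (u x * of_real (k x t)) = norm (u x) * k x t" for t
      using k_nonneg[of x t] by (simp add: norm_mult)
    moreover have "integrable lborel (\<lambda>t. complex_of_real (k x t))" using elim by (auto simp: has_bochner_integral_iff)
    moreover have "(LINT t|lborel. complex_of_real (k x t)) = of_real (m x)"
      using elim by (simp add: has_bochner_integral_iff)
    ultimately show ?case using elim by (auto simp: has_bochner_integral_iff)
  qed
  have prod: "integrable (lborel \<Otimes>\<^sub>M lborel) (\<lambda>(x, t). u x * of_real (k x t))"
  proof (rule lborel_pair.Fubini_integrable)
    show "integrable lborel (\<lambda>x. LINT t|lborel. norm (case (x, t) of (x, t) \<Rightarrow> u x * of_real (k x t)))"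
    proof (subst integrable_cong_AE[where g = "\<lambda>x. norm (u x) * m x"])
      show "AE x in lborel. (LINT t|lborel. norm (case (x, t) of (x, t) \<Rightarrow> u x * of_real (k x t))) = norm (u x) * m x"
        using ae by eventually_elim simp
    qed (use int in auto)
    show "AE x in lborel. integrable lborel (\<lambda>t. case (x, t) of (x, t) \<Rightarrow> u x * of_real (k x t))"
      using ae by eventually_elim simp
  qed measurable
  have "(LINT x|lborel. u x * of_real (m x)) = (LINT x|lborel. LINT t|lborel. u x * of_real (k x t))"
    by (rule integral_cong_AE) (use ae in \<open>auto elim: eventually_mono\<close>)
  also have "\<dots> = (LINT t|lborel. LINT x|lborel. u x * of_real (k x t))"
    by (rule lborel_pair.Fubini_integral[OF prod, symmetric])
  finally show ?thesis .
qed

definition rpow :: "real \<Rightarrow> real \<Rightarrow> real" where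
  "rpow t a = (if 0 < t then t powr a else 0)"

lemma rpow_measurable [measurable]: "(\<lambda>x. rpow (f x) a) \<in> borel_measurable M"
  if [measurable]: "f \<in> borel_measurable M"
  unfolding rpow_def by measurable

lemma rpow_nonneg [simp]: "0 \<le> rpow t a" by (simp add: rpow_def)

lemma real_Gamma_integral:
  assumes a: "0 < a" and x: "0 < x"
  shows "has_bochner_integral lborel (\<lambda>t. rpow t (a - 1) * exp (- (x * t))) (Gamma a * x powr (- a))"
  using norm_Gamma_integral_cpow[of "of_real a" x] a x by (simp add: norm_mult norm_cpow rpow_def cong: if_cong)

text \<open>The Gamma integral under \<open>t \<mapsto> 1 / t\<close>: transforming a Gaussian
  inverts its width parameter, so this form arises on the other side of the Fourier
  transform.\<close>

lemma real_Gamma_integral_inverted: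
  assumes a: "0 < a" and x: "0 < x"
  shows "has_bochner_integral lborel (\<lambda>t. rpow t (- a - 1) * exp (- (x / t))) (Gamma a * x powr (- a))"
proof -
  have img: "(\<lambda>r. 1 / r) ` {0<..} = {0::real<..}"
  proof (intro equalityI subsetI)
    fix y :: real assume "y \<in> {0<..}"
    then show "y \<in> (\<lambda>r. 1 / r) ` {0<..}" by (intro image_eqI[of _ _ "1 / y"]) auto
  qed auto
  have "has_bochner_integral lborel (\<lambda>t. complex_of_real (rpow t (- a - 1) * exp (- (x / t)))) (of_real (Gamma a * x powr (- a)))"
  proof (rule has_bochner_integral_substitution[where S = "{0<..}" and g = "\<lambda>r. 1 / r" and h = "\<lambda>r. - (1 / r\<^sup>2)"])
    show "(\<lambda>r. 1 / r) ` {0<..} \<in> sets (borel :: real measure)" unfolding img by simp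
    show "complex_of_real (rpow y (- a - 1) * exp (- (x / y))) = 0" if "y \<notin> (\<lambda>r. 1 / r) ` {0<..}" for y
      using that unfolding img by (simp add: rpow_def)
    show "((\<lambda>r. 1 / r) has_real_derivative - (1 / r\<^sup>2)) (at r within {0<..})" if "r \<in> {0<..}" for r :: real
      using that by (auto intro!: derivative_eq_intros simp: power2_eq_square)
    show "inj_on (\<lambda>r. 1 / r) {0::real<..}" by (rule inj_on_inverseI[where g = "\<lambda>y. 1 / y"]) auto
    show "has_bochner_integral lborel (\<lambda>r. complex_of_real (rpow r (a - 1) * exp (- (x * r)))) (of_real (Gamma a * x powr (- a)))"
      by (rule has_bochner_integral_bounded_linear[OF bounded_linear_of_real real_Gamma_integral[OF a x]])
    show "complex_of_real (rpow r (a - 1) * exp (- (x * r))) = \<bar>- (1 / r\<^sup>2)\<bar> *\<^sub>R complex_of_real (rpow (1 / r) (- a - 1) * exp (- (x / (1 / r))))"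
      if "r \<in> {0<..}" for r
    proof -
      have r: "0 < r" using that by simp
      have "(1 / r) powr b = r powr (- b)" for b
        using r by (simp add: powr_divide powr_minus_divide)
      from this[of "- a - 1"] have "1 / r\<^sup>2 * (1 / r) powr (- a - 1) = r powr (-2) * r powr (a + 1)"
        using r by (simp add: powr_minus_divide powr_numeral add.commute)
      also have "\<dots> = r powr (a - 1)" by (simp flip: powr_add)
      finally have q: "1 / r\<^sup>2 * (1 / r) powr (- a - 1) = r powr (a - 1)" .
      have "\<bar>- (1 / r\<^sup>2)\<bar> *\<^sub>R complex_of_real (rpow (1 / r) (- a - 1) * exp (- (x / (1 / r))))
        = complex_of_real ((1 / r\<^sup>2 * (1 / r) powr (- a - 1)) * exp (- (x * r)))"
        using r by (simp add: rpow_def scaleR_conv_of_real)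
      then show ?thesis unfolding q using r by (simp add: rpow_def)
    qed
  qed (auto simp: rpow_def)
  then have "has_bochner_integral lborel (\<lambda>t. Re (complex_of_real (rpow t (- a - 1) * exp (- (x / t))))) (Re (of_real (Gamma a * x powr (- a))))"
    by (rule has_bochner_integral_bounded_linear[OF bounded_linear_Re])
  then show ?thesis by simp
qed

definition L_real :: "real \<Rightarrow> real" where "L_real w = pi powr (- w / 2) * Gamma (w / 2)"

lemma L_real_eq: "L_local Real_Place (of_real w) = of_real (L_real w)"
proof -
  have "complex_of_real pi powr (- of_real w / 2) = of_real (pi powr (- w / 2))"
    using powr_of_real[of pi "- w / 2"] by simp
  moreover have "Gamma (complex_of_real w / 2) = of_real (Gamma (w / 2))"
    using Gamma_complex_of_real[of "w / 2"] by simp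
  ultimately show ?thesis by (simp add: L_real_def)
qed

lemma L_real_pos: "0 < w \<Longrightarrow> 0 < L_real w"
  by (simp add: L_real_def Gamma_real_pos)

lemma AE_lborel_neq: "AE x in lborel. x \<noteq> (a::real)"
  by (rule AE_I'[of "{a}"]) auto

text \<open>The solutions \<open>2 * pi\<close> and \<open>- 2 * pi\<close> for \<open>\<kappa>\<close> give the two standard characters.\<close>

locale real_fourier =
  fixes g :: "real \<Rightarrow> complex" and \<kappa> :: real
  assumes g: "is_test_function g" and kappa: "\<kappa>\<^sup>2 = 4 * pi\<^sup>2"
begin

abbreviation \<phi> :: "real \<Rightarrow> complex" where "\<phi> \<equiv> lift_abs g"

definition e :: "real \<Rightarrow> complex" where "e x = exp (\<i> * of_real (\<kappa> * x))"

definition \<Phi> :: "real \<Rightarrow> complex" where "\<Phi> x = (LINT v|lborel. \<phi> v * e (- (x * v)))"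

lemma e_measurable [measurable]: "e \<in> borel_measurable borel"
  unfolding e_def[abs_def] by (intro borel_measurable_continuous_onI continuous_intros)

lemma e_add: "e (x + y) = e x * e y"
  by (simp add: e_def distrib_left exp_add[symmetric] algebra_simps)

lemma norm_e [simp]: "norm (e x) = 1" by (simp add: e_def)

lemma kappa_abs: "\<bar>\<kappa>\<bar> = 2 * pi"
proof -
  have "\<bar>\<kappa>\<bar>\<^sup>2 = (2 * pi)\<^sup>2" by (simp add: kappa power_mult_distrib)
  then show ?thesis by (subst (asm) power2_eq_iff_nonneg) auto
qed

lemma phi_minus: "\<phi> (- v) = \<phi> v"
  by (simp add: lift_abs_def absv_def)

lemma phi_support: obtains R where "0 < R" "\<And>v. R \<le> \<bar>v\<bar> \<Longrightarrow> \<phi> v = 0"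
proof -
  obtain P R where P: "P (0::nat) = \<phi>" "0 < R"
    "\<And>n v. (P n has_vector_derivative P (Suc n) v) (at v)"
    "\<And>n v. R \<le> \<bar>v\<bar> \<Longrightarrow> P n v = (0 :: complex)"
    by (rule lift_abs_real_derivs[OF g], rule that) assumption+
  then show thesis using that[of R] by metis
qed

lemma phi_cont: "continuous_on UNIV \<phi>"
proof -
  obtain P R where P: "P (0::nat) = \<phi>" "0 < (R :: real)"
    "\<And>n v. (P n has_vector_derivative P (Suc n) v) (at v)"
    "\<And>n v. R \<le> \<bar>v\<bar> \<Longrightarrow> P n v = (0 :: complex)"
    by (rule lift_abs_real_derivs[OF g], rule that) assumption+
  have "continuous_on UNIV (P 0)"
    using P(3) by (intro continuous_at_imp_continuous_on ballI has_vector_derivative_continuous)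
  then show ?thesis by (simp add: P(1))
qed

lemma phi_measurable [measurable]: "\<phi> \<in> borel_measurable borel"
  by (rule borel_measurable_continuous_onI[OF phi_cont])

lemma phi_bounded: obtains M where "0 \<le> M" "\<And>v. norm (\<phi> v) \<le> M"
  using phi_support bounded_compact_support[OF phi_cont] by metis

lemma phi_integrable: "integrable lborel \<phi>"
  using phi_support integrable_compact_support[OF phi_cont] by metis

lemma Phi_measurable [measurable]: "\<Phi> \<in> borel_measurable borel"
  unfolding \<Phi>_def[abs_def] by measurable

text \<open>Two integrations by parts against the character give the factor
  \<open>(\<kappa> * x)\<^sup>2\<close>, which dominates \<open>x\<^sup>2\<close>.\<close>

lemma Phi_decay: obtains M where "0 \<le> M" "\<And>x. norm (\<Phi> x) \<le> M / (1 + x\<^sup>2)"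
proof -
  obtain P R where P: "P (0::nat) = \<phi>" "0 < R"
    "\<And>n v. (P n has_vector_derivative P (Suc n) v) (at v)"
    "\<And>n v. R \<le> \<bar>v\<bar> \<Longrightarrow> P n v = (0 :: complex)"
    by (rule lift_abs_real_derivs[OF g], rule that) assumption+
  have cont: "continuous_on UNIV (P n)" for n
    using P(3) by (intro continuous_at_imp_continuous_on ballI has_vector_derivative_continuous)
  define I where "I n x = (LINT v|lborel. P n v * exp ((- \<i> * of_real (\<kappa> * x)) * of_real v))" for n x
  have step: "I (Suc n) x = - (- \<i> * of_real (\<kappa> * x)) * I n x" for n x
    unfolding I_def by (rule integral_exp_by_parts[where R = R, OF P(3) cont P(4) P(4) P(2)])
  have "I 2 x = (\<i> * of_real (\<kappa> * x)) * ((\<i> * of_real (\<kappa> * x)) * I 0 x)" for x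
    using step[of 0 x] step[of 1 x] by (simp add: numeral_2_eq_2)
  then have n2: "norm (I 2 x) = (\<kappa> * x)\<^sup>2 * norm (I 0 x)" for x
    by (simp add: norm_mult power2_eq_square abs_mult mult_ac)
  have I0: "I 0 x = \<Phi> x" for x
    by (simp add: I_def \<Phi>_def P e_def mult_ac)
  define N where "N n = (LINT v|lborel. norm (P n v)) * exp (0 * R)" for n
  have N: "norm (I n x) \<le> N n" for n x
    unfolding I_def N_def by (rule norm_integral_exp_le[OF cont P(4) P(2)]) auto
  have N0: "0 \<le> N n" for n by (simp add: N_def)
  have k1: "1 \<le> \<kappa>\<^sup>2"
  proof -
    have "1 * 1 \<le> pi * pi" by (intro mult_mono) (use pi_ge_two in auto)
    then show ?thesis unfolding kappa by (simp add: power2_eq_square)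
  qed
  show thesis
  proof (rule that[of "N 0 + N 2"])
    fix x
    have "x\<^sup>2 * norm (\<Phi> x) \<le> (\<kappa> * x)\<^sup>2 * norm (\<Phi> x)"
      using mult_right_mono[OF k1, of "x\<^sup>2"] by (intro mult_right_mono) (auto simp: power_mult_distrib)
    also have "\<dots> \<le> N 2" using N[of 2 x] n2[of x] I0 by simp
    finally have "norm (\<Phi> x) * (1 + x\<^sup>2) \<le> N 0 + N 2" using N[of 0 x] I0 by (simp add: algebra_simps)
    then show "norm (\<Phi> x) \<le> (N 0 + N 2) / (1 + x\<^sup>2)"
      using sum_power2_gt_zero_iff[of 1 x] by (simp add: pos_le_divide_eq)
  qed (use N0 in auto)
qed

text \<open>The range of \<alpha> covers the multiplier \<open>|x| powr (- w)\<close> and the powers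
  1/2 and -1/2 that dominate its difference quotient.\<close>

lemma Phi_powr_integrable:
  assumes "-1 < \<alpha>" "\<alpha> < 1"
  shows "integrable lborel (\<lambda>x. norm (\<Phi> x) * \<bar>x\<bar> powr \<alpha>)"
proof -
  obtain M where M: "0 \<le> M" "\<And>x. norm (\<Phi> x) \<le> M / (1 + x\<^sup>2)" using Phi_decay by metis
  show ?thesis
  proof (rule Bochner_Integration.integrable_bound[OF integrable_mult_right[OF integrable_powr_kernel[OF assms], of M]])
    show "AE x in lborel. norm (norm (\<Phi> x) * \<bar>x\<bar> powr \<alpha>) \<le> norm (M * (\<bar>x\<bar> powr \<alpha> / (1 + x\<^sup>2)))"
    proof (rule AE_I2)
      fix x
      have "norm (\<Phi> x) * \<bar>x\<bar> powr \<alpha> \<le> M / (1 + x\<^sup>2) * \<bar>x\<bar> powr \<alpha>" by (intro mult_right_mono M) auto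
      then show "norm (norm (\<Phi> x) * \<bar>x\<bar> powr \<alpha>) \<le> norm (M * (\<bar>x\<bar> powr \<alpha> / (1 + x\<^sup>2)))"
        using M(1) by (simp add: abs_mult)
    qed
  qed measurable
qed

lemma Phi_integrable: "integrable lborel \<Phi>"
proof (rule Bochner_Integration.integrable_bound[OF Phi_powr_integrable[of 0]])
  show "AE x in lborel. norm (\<Phi> x) \<le> norm (norm (\<Phi> x) * \<bar>x\<bar> powr 0)"
    using AE_lborel_neq[of 0] by eventually_elim simp
qed auto

text \<open>Substituting \<open>\<tau> = - \<kappa> * x\<close> turns the transform of the general
  inversion theorem into \<open>\<Phi>\<close>, and the Jacobian \<open>|\<kappa>| = 2 * pi\<close>
  cancels the factor \<open>2 * pi\<close>.\<close>

lemma fourier_inversion: "(LINT x|lborel. \<Phi> x * e (x * y)) = \<phi> y"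
proof -
  obtain R where R: "0 < R" "\<And>v. R \<le> \<bar>v\<bar> \<Longrightarrow> \<phi> v = 0" using phi_support by metis
  define H where "H \<tau> = (LINT v|lborel. \<phi> v * exp (\<i> * of_real (\<tau> * v)))" for \<tau>
  have k0: "\<kappa> \<noteq> 0" using kappa by auto
  have H: "H (0 + (- \<kappa>) * x) = \<Phi> x" for x
    by (simp add: H_def \<Phi>_def e_def mult.assoc)
  have Hi: "integrable lborel H"
    using Phi_integrable k0 unfolding H[symmetric, abs_def]
    by (subst (asm) lborel_integrable_real_affine_iff) (auto simp: H)
  have "2 * of_real pi * \<phi> y = (LINT \<tau>|lborel. H \<tau> * exp (- (\<i> * of_real (\<tau> * y))))"
    by (rule fourier_inversion_compact_support[OF phi_cont R(2) H_def Hi, symmetric])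
  also have "\<dots> = \<bar>- \<kappa>\<bar> *\<^sub>R (LINT x|lborel. H (0 + (- \<kappa>) * x) * exp (- (\<i> * of_real ((0 + (- \<kappa>) * x) * y))))"
    using k0 by (intro lborel_integral_real_affine) auto
  also have "\<dots> = 2 * of_real pi * (LINT x|lborel. \<Phi> x * e (x * y))"
    unfolding H by (simp add: kappa_abs e_def scaleR_conv_of_real mult.assoc)
  finally show ?thesis by simp
qed

text \<open>A Gaussian multiplier on the Fourier side is an average against the transformed
  Gaussian. Only the square of \<kappa> enters that transform, so both standard characters give the
  same self-dual normalisation.\<close>

lemma gaussian_mollification:
  assumes t: "0 < t"
  shows "(LINT x|lborel. \<Phi> x * e (x * y) * of_real (exp (- (pi * x\<^sup>2 * t))))
     = (LINT v|lborel. \<phi> v * of_real (sqrt (1 / t) * exp (- (pi * (y - v)\<^sup>2 / t))))"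
proof -
  have pt: "0 < pi * t" using t by simp
  define G where "G x = complex_of_real (exp (- (pi * t * x\<^sup>2)))" for x
  have [measurable]: "G \<in> borel_measurable borel" unfolding G_def by measurable
  have "(LINT x|lborel. \<Phi> x * e (x * y) * of_real (exp (- (pi * x\<^sup>2 * t))))
     = (LINT x|lborel. LINT v|lborel. \<phi> v * (G x * e (x * (y - v))))"
  proof (intro Bochner_Integration.integral_cong refl)
    fix x
    have "\<Phi> x * (e (x * y) * G x) = (LINT v|lborel. \<phi> v * e (- (x * v)) * (e (x * y) * G x))"
      unfolding \<Phi>_def by simp
    also have "\<dots> = (LINT v|lborel. \<phi> v * (G x * e (x * (y - v))))"
      using e_add[of "- (x * _)" "x * y"] by (intro Bochner_Integration.integral_cong refl) (simp add: algebra_simps)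
    finally show "\<Phi> x * e (x * y) * of_real (exp (- (pi * x\<^sup>2 * t))) = (LINT v|lborel. \<phi> v * (G x * e (x * (y - v))))"
      by (simp add: G_def mult_ac)
  qed
  also have "\<dots> = (LINT v|lborel. LINT x|lborel. \<phi> v * (G x * e (x * (y - v))))"
  proof (rule lborel_pair.Fubini_integral, rule integrable_pair_bound[where u = "\<lambda>v. norm (\<phi> v)" and w = "\<lambda>x. exp (- (pi * t * x\<^sup>2))"])
    show "integrable lborel (\<lambda>v. norm (\<phi> v))" by (intro integrable_norm phi_integrable)
    show "integrable lborel (\<lambda>x. exp (- (pi * t * x\<^sup>2)))" by (rule gaussian_fourier(2)[OF pt])
  qed (auto simp: G_def norm_mult)
  also have "\<dots> = (LINT v|lborel. \<phi> v * of_real (sqrt (1 / t) * exp (- (pi * (y - v)\<^sup>2 / t))))"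
  proof (intro Bochner_Integration.integral_cong refl)
    fix v
    have "(LINT x|lborel. G x * e (x * (y - v))) = (LINT x|lborel. of_real (exp (- ((pi * t) * x\<^sup>2))) * exp (\<i> * of_real (x * (\<kappa> * (y - v)))))"
      by (simp add: G_def e_def mult_ac)
    also have "\<dots> = of_real (sqrt (pi / (pi * t)) * exp (- ((\<kappa> * (y - v))\<^sup>2 / (4 * (pi * t)))))"
      by (rule gaussian_fourier(1)[OF pt])
    also have "(\<kappa> * (y - v))\<^sup>2 / (4 * (pi * t)) = pi * (y - v)\<^sup>2 / t"
    proof -
      have "(\<kappa> * (y - v))\<^sup>2 / (4 * (pi * t)) = (4 * pi\<^sup>2) * (y - v)\<^sup>2 / (4 * (pi * t))"
        by (simp only: power_mult_distrib kappa)
      also have "\<dots> = pi * (y - v)\<^sup>2 / t" using t by (simp add: power2_eq_square[of pi])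
      finally show ?thesis .
    qed
    finally show "(LINT x|lborel. \<phi> v * (G x * e (x * (y - v)))) = \<phi> v * of_real (sqrt (1 / t) * exp (- (pi * (y - v)\<^sup>2 / t)))"
      by simp
  qed
  finally show ?thesis .
qed

lemma phi_riesz_integrable:
  assumes w: "0 < w" "w < 1"
  shows "integrable lborel (\<lambda>v. norm (\<phi> v) * \<bar>y - v\<bar> powr (w - 1))"
proof -
  obtain R where R: "0 < R" "\<And>v. R \<le> \<bar>v\<bar> \<Longrightarrow> \<phi> v = 0" using phi_support by metis
  obtain M where M: "0 \<le> M" "\<And>v. norm (\<phi> v) \<le> M" using phi_bounded by metis
  \<comment> \<open>On the support of \<open>\<phi>\<close> the distance \<open>|y - v|\<close> is
    at most \<open>N\<close>, so \<open>1 + N\<^sup>2\<close> compensates the denominator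
    \<open>1 + (y - v)\<^sup>2\<close> of the integrable kernel.\<close>
  define N where "N = \<bar>y\<bar> + R"
  have "integrable lborel (\<lambda>x::real. \<bar>x\<bar> powr (w - 1) / (1 + x\<^sup>2))" by (rule integrable_powr_kernel) (use w in auto)
  then have "integrable lborel (\<lambda>v::real. \<bar>y + (- 1) * v\<bar> powr (w - 1) / (1 + (y + (- 1) * v)\<^sup>2))"
    by (rule lborel_integrable_real_affine) simp
  then have "integrable lborel (\<lambda>v. M * (1 + N\<^sup>2) * (\<bar>y - v\<bar> powr (w - 1) / (1 + (y - v)\<^sup>2)))"
    by (intro integrable_mult_right) simp
  then show ?thesis
  proof (rule Bochner_Integration.integrable_bound)
    show "AE v in lborel. norm (norm (\<phi> v) * \<bar>y - v\<bar> powr (w - 1)) \<le> norm (M * (1 + N\<^sup>2) * (\<bar>y - v\<bar> powr (w - 1) / (1 + (y - v)\<^sup>2)))"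
    proof (rule AE_I2)
      fix v
      have pos: "0 < 1 + (y - v)\<^sup>2" using sum_power2_gt_zero_iff[of 1 "y - v"] by simp
      have "norm (\<phi> v) \<le> M * (1 + N\<^sup>2) * (1 / (1 + (y - v)\<^sup>2))"
      proof (cases "R \<le> \<bar>v\<bar>")
        case True
        then show ?thesis using R(2)[of v] M(1) pos by (simp add: mult_nonneg_nonneg add_nonneg_nonneg divide_nonneg_pos)
      next
        case False
        then have "\<bar>y - v\<bar> \<le> \<bar>N\<bar>" by (simp add: N_def)
        then have "(y - v)\<^sup>2 \<le> N\<^sup>2" by (simp add: abs_le_square_iff)
        then have "1 \<le> (1 + N\<^sup>2) * (1 / (1 + (y - v)\<^sup>2))" using pos by (simp add: pos_le_divide_eq)
        then have "M * 1 \<le> M * ((1 + N\<^sup>2) * (1 / (1 + (y - v)\<^sup>2)))" using M(1) by (rule mult_left_mono)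
        then show ?thesis using M(2)[of v] by (simp add: mult.assoc)
      qed
      then have "norm (\<phi> v) * \<bar>y - v\<bar> powr (w - 1) \<le> M * (1 + N\<^sup>2) * (1 / (1 + (y - v)\<^sup>2)) * \<bar>y - v\<bar> powr (w - 1)"
        by (rule mult_right_mono) simp
      then show "norm (norm (\<phi> v) * \<bar>y - v\<bar> powr (w - 1)) \<le> norm (M * (1 + N\<^sup>2) * (\<bar>y - v\<bar> powr (w - 1) / (1 + (y - v)\<^sup>2)))"
        using M(1) by (simp add: abs_mult)
    qed
  qed measurable
qed

text \<open>Writing \<open>\<bar>x\<bar> powr (- w)\<close> as a superposition of Gaussians turns the multiplication by it into the
  convolution with a Riesz kernel.\<close>

lemma riesz_potential:
  assumes w: "0 < w" "w < 1"
  shows "of_real (L_real w) * (LINT x|lborel. \<Phi> x * e (x * y) * of_real (\<bar>x\<bar> powr (- w)))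
     = of_real (L_real (1 - w)) * (LINT v|lborel. \<phi> v * of_real (\<bar>y - v\<bar> powr (w - 1)))"
proof -
  \<comment> \<open>The Gamma integral with parameter \<open>w / 2\<close> at the point
    \<open>pi * x\<^sup>2\<close> has the value \<open>L_real w * |x| powr (- w)\<close>.\<close>
  have "(LINT x|lborel. (\<Phi> x * e (x * y)) * of_real (L_real w * \<bar>x\<bar> powr (- w)))
     = (LINT t|lborel. LINT x|lborel. (\<Phi> x * e (x * y)) * of_real (rpow t (w / 2 - 1) * exp (- (pi * x\<^sup>2 * t))))"
  proof (rule integral_kernel_swap)
    show "AE x in lborel. has_bochner_integral lborel (\<lambda>t. rpow t (w / 2 - 1) * exp (- (pi * x\<^sup>2 * t))) (L_real w * \<bar>x\<bar> powr (- w))"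
      using AE_lborel_neq[of 0]
    proof eventually_elim
      case (elim x)
      have "has_bochner_integral lborel (\<lambda>t. rpow t (w / 2 - 1) * exp (- (pi * x\<^sup>2 * t))) (Gamma (w / 2) * (pi * x\<^sup>2) powr (- (w / 2)))"
        by (rule real_Gamma_integral) (use w elim in auto)
      also have "(pi * x\<^sup>2) powr (- (w / 2)) = pi powr (- (w / 2)) * (\<bar>x\<bar> powr 2) powr (- (w / 2))"
        using elim by (simp add: powr_mult powr_numeral)
      also have "(\<bar>x\<bar> powr 2) powr (- (w / 2)) = \<bar>x\<bar> powr (- w)" unfolding powr_powr by simp
      finally show ?case by (simp add: L_real_def mult_ac)
    qed
    show "integrable lborel (\<lambda>x. norm (\<Phi> x * e (x * y)) * (L_real w * \<bar>x\<bar> powr (- w)))"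
      using integrable_mult_right[OF Phi_powr_integrable[of "- w"], of "L_real w"] w by (simp add: norm_mult mult_ac)
  qed auto
  also have "\<dots> = (LINT t|lborel. LINT v|lborel. \<phi> v * of_real (rpow t (- ((1 - w) / 2) - 1) * exp (- ((pi * (y - v)\<^sup>2) / t))))"
  proof (rule Bochner_Integration.integral_cong[OF refl])
    fix t
    show "(LINT x|lborel. (\<Phi> x * e (x * y)) * of_real (rpow t (w / 2 - 1) * exp (- (pi * x\<^sup>2 * t))))
      = (LINT v|lborel. \<phi> v * of_real (rpow t (- ((1 - w) / 2) - 1) * exp (- ((pi * (y - v)\<^sup>2) / t))))"
    proof (cases "0 < t")
      case True
      \<comment> \<open>The factor \<open>sqrt (1 / t)\<close> of the transformed Gaussian shifts
        the exponent to that of the inverted Gamma integral with parameter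
        \<open>(1 - w) / 2\<close>; hence \<open>L_real (1 - w)\<close>.\<close>
      have p: "rpow t (w / 2 - 1) * sqrt (1 / t) = rpow t (- ((1 - w) / 2) - 1)"
      proof -
        have sq: "sqrt (1 / t) = t powr (- (1 / 2))" using True by (simp add: powr_minus_divide powr_half_sqrt real_sqrt_divide)
        have "rpow t (w / 2 - 1) * sqrt (1 / t) = t powr (w / 2 - 1) * t powr (- (1 / 2))"
          unfolding sq using True by (simp add: rpow_def)
        also have "\<dots> = t powr (w / 2 - 1 + - (1 / 2))" by (rule powr_add[symmetric])
        also have "w / 2 - 1 + - (1 / 2) = - ((1 - w) / 2) - 1" by (simp add: field_simps)
        finally show ?thesis using True by (simp add: rpow_def)
      qed
      have "(LINT x|lborel. (\<Phi> x * e (x * y)) * of_real (rpow t (w / 2 - 1) * exp (- (pi * x\<^sup>2 * t))))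
        = (LINT x|lborel. of_real (rpow t (w / 2 - 1)) * (\<Phi> x * e (x * y) * of_real (exp (- (pi * x\<^sup>2 * t)))))"
        by (simp add: mult_ac)
      also have "\<dots> = of_real (rpow t (w / 2 - 1)) * (LINT v|lborel. \<phi> v * of_real (sqrt (1 / t) * exp (- (pi * (y - v)\<^sup>2 / t))))"
        unfolding integral_mult_right_zero gaussian_mollification[OF True] ..
      also have "\<dots> = (LINT v|lborel. of_real (rpow t (w / 2 - 1)) * (\<phi> v * of_real (sqrt (1 / t) * exp (- (pi * (y - v)\<^sup>2 / t)))))"
        by (rule integral_mult_right_zero[symmetric])
      also have "\<dots> = (LINT v|lborel. \<phi> v * of_real ((rpow t (w / 2 - 1) * sqrt (1 / t)) * exp (- ((pi * (y - v)\<^sup>2) / t))))"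
        by (simp add: mult_ac)
      finally show ?thesis unfolding p .
    qed (simp add: rpow_def)
  qed
  also have "\<dots> = (LINT v|lborel. \<phi> v * of_real (L_real (1 - w) * \<bar>y - v\<bar> powr (w - 1)))"
  proof (rule integral_kernel_swap[symmetric])
    show "AE v in lborel. has_bochner_integral lborel (\<lambda>t. rpow t (- ((1 - w) / 2) - 1) * exp (- ((pi * (y - v)\<^sup>2) / t))) (L_real (1 - w) * \<bar>y - v\<bar> powr (w - 1))"
      using AE_lborel_neq[of y]
    proof eventually_elim
      case (elim v)
      have "has_bochner_integral lborel (\<lambda>t. rpow t (- ((1 - w) / 2) - 1) * exp (- ((pi * (y - v)\<^sup>2) / t))) (Gamma ((1 - w) / 2) * (pi * (y - v)\<^sup>2) powr (- ((1 - w) / 2)))"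
        by (rule real_Gamma_integral_inverted) (use w elim in auto)
      also have "(pi * (y - v)\<^sup>2) powr (- ((1 - w) / 2)) = pi powr (- ((1 - w) / 2)) * (\<bar>y - v\<bar> powr 2) powr (- ((1 - w) / 2))"
        using elim by (simp add: powr_mult powr_numeral)
      also have "(\<bar>y - v\<bar> powr 2) powr (- ((1 - w) / 2)) = \<bar>y - v\<bar> powr (w - 1)"
      proof -
        have q: "2 * (- ((1 - w) / 2)) = w - 1" by (simp add: field_simps)
        show ?thesis unfolding powr_powr q ..
      qed
      moreover have "- (1 - w) / 2 = - ((1 - w) / 2)" by (rule minus_divide_left[symmetric])
      ultimately show ?case by (simp only: L_real_def mult_ac)
    qed
    show "integrable lborel (\<lambda>v. norm (\<phi> v) * (L_real (1 - w) * \<bar>y - v\<bar> powr (w - 1)))"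
      using integrable_mult_right[OF phi_riesz_integrable[OF w, of y], of "L_real (1 - w)"] by (simp add: mult_ac)
  qed auto
  finally have "(LINT x|lborel. of_real (L_real w) * (\<Phi> x * e (x * y) * of_real (\<bar>x\<bar> powr (- w))))
     = (LINT v|lborel. of_real (L_real (1 - w)) * (\<phi> v * of_real (\<bar>y - v\<bar> powr (w - 1))))"
    by (simp add: mult_ac)
  then show ?thesis by (simp only: integral_mult_right_zero)
qed

lemma Complex_measurable [measurable]: "(\<lambda>x. Complex a (f x)) \<in> borel_measurable M"
  if [measurable]: "f \<in> borel_measurable M"
  unfolding Complex_eq by measurable

text \<open>Evenness folds the integral onto the half-line and scaling by \<open>|y|\<close> leaves
  the kernel \<open>riesz w\<close>. Mellin inversion expands \<open>g\<close> in powers, and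
  \<open>mellin_riesz\<close> integrates each power against the kernel.\<close>

lemma phi_riesz_mellin:
  assumes w: "0 < w" "w < c" and c: "c < 1" and y: "y \<noteq> 0"
  shows "2 * of_real pi * (LINT v|lborel. \<phi> v * of_real (\<bar>y - v\<bar> powr (w - 1)))
    = (LINT \<tau>|lborel. mellin g (Complex c \<tau>) * of_real \<bar>y\<bar> powr (- Complex c \<tau>) *
         (of_real (\<bar>y\<bar> powr w) * (\<Gamma>\<^sub>r (of_real w) * \<Gamma>\<^sub>r (1 - Complex c \<tau>) * \<Gamma>\<^sub>r (Complex c \<tau> - of_real w))))"
proof -
  define Y where "Y = \<bar>y\<bar>"
  have Y: "0 < Y" using y by (simp add: Y_def)
  define gp where "gp v = (if 0 < v then \<phi> v else 0)" for v
  have [measurable]: "gp \<in> borel_measurable borel" unfolding gp_def[abs_def] by measurable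
  have split: "\<phi> v = gp v + gp (- v)" for v
    using phi_minus[of v] by (cases v "0::real" rule: linorder_cases) (auto simp: gp_def lift_abs_def)
  have gp_int: "integrable lborel (\<lambda>v. gp v * of_real (\<bar>u - v\<bar> powr (w - 1)))" for u
    by (rule Bochner_Integration.integrable_bound[OF phi_riesz_integrable[of w u]])
       (use w c in \<open>auto simp: gp_def norm_mult\<close>)
  have gp_int1: "integrable lborel (\<lambda>v. gp v * of_real (\<bar>y + v\<bar> powr (w - 1)))"
    using gp_int[of "- y"] by (simp add: abs_minus_commute[of "- y"] add.commute)
  have "integrable lborel (\<lambda>v. gp (0 + (-1) * v) * of_real (\<bar>y + (0 + (-1) * v)\<bar> powr (w - 1)))"
    by (rule lborel_integrable_real_affine[OF gp_int1]) simp
  then have gp_int2: "integrable lborel (\<lambda>v. gp (- v) * of_real (\<bar>y - v\<bar> powr (w - 1)))" by simp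
  have "(LINT v|lborel. \<phi> v * of_real (\<bar>y - v\<bar> powr (w - 1)))
     = (LINT v|lborel. gp v * of_real (\<bar>y - v\<bar> powr (w - 1))) + (LINT v|lborel. gp (- v) * of_real (\<bar>y - v\<bar> powr (w - 1)))"
    unfolding split distrib_right by (rule Bochner_Integration.integral_add[OF gp_int gp_int2])
  also have "(LINT v|lborel. gp (- v) * of_real (\<bar>y - v\<bar> powr (w - 1))) = (LINT v|lborel. gp v * of_real (\<bar>y + v\<bar> powr (w - 1)))"
    by (subst (2) lborel_integral_real_affine[where c = "-1" and t = 0]) simp_all
  also have "(LINT v|lborel. gp v * of_real (\<bar>y - v\<bar> powr (w - 1))) + (LINT v|lborel. gp v * of_real (\<bar>y + v\<bar> powr (w - 1)))
     = (LINT v|lborel. gp v * of_real (\<bar>y - v\<bar> powr (w - 1)) + gp v * of_real (\<bar>y + v\<bar> powr (w - 1)))"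
    by (rule Bochner_Integration.integral_add[OF gp_int gp_int1, symmetric])
  also have "\<dots> = (LINT v|lborel. gp v * of_real (\<bar>Y - v\<bar> powr (w - 1) + \<bar>Y + v\<bar> powr (w - 1)))"
  proof (intro Bochner_Integration.integral_cong refl)
    fix v
    have "\<bar>y - v\<bar> powr (w - 1) + \<bar>y + v\<bar> powr (w - 1) = \<bar>Y - v\<bar> powr (w - 1) + \<bar>Y + v\<bar> powr (w - 1)"
    proof (cases "0 \<le> y")
      case False
      then have "\<bar>y - v\<bar> = \<bar>Y + v\<bar>" "\<bar>y + v\<bar> = \<bar>Y - v\<bar>" by (auto simp: Y_def)
      then show ?thesis by simp
    qed (simp add: Y_def)
    then show "gp v * of_real (\<bar>y - v\<bar> powr (w - 1)) + gp v * of_real (\<bar>y + v\<bar> powr (w - 1)) = gp v * of_real (\<bar>Y - v\<bar> powr (w - 1) + \<bar>Y + v\<bar> powr (w - 1))"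
      by (simp flip: distrib_left of_real_add)
  qed
  also have "\<dots> = \<bar>Y\<bar> *\<^sub>R (LINT z|lborel. gp (0 + Y * z) * of_real (\<bar>Y - (0 + Y * z)\<bar> powr (w - 1) + \<bar>Y + (0 + Y * z)\<bar> powr (w - 1)))"
    using Y by (intro lborel_integral_real_affine) simp
  also have "\<dots> = of_real (Y powr w) * (LINT z|lborel. gp (Y * z) * of_real (riesz w z))"
  proof -
    have "\<bar>Y - (0 + Y * z)\<bar> powr (w - 1) + \<bar>Y + (0 + Y * z)\<bar> powr (w - 1) = Y powr (w - 1) * riesz w z" for z
    proof -
      have "\<bar>Y - (0 + Y * z)\<bar> = Y * \<bar>1 - z\<bar>" "\<bar>Y + (0 + Y * z)\<bar> = Y * \<bar>1 + z\<bar>"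
        using Y abs_mult[of Y "1 - z"] abs_mult[of Y "1 + z"] by (simp_all add: algebra_simps)
      then show ?thesis using Y by (simp add: powr_mult riesz_def distrib_left)
    qed
    then have "\<bar>Y\<bar> *\<^sub>R (LINT z|lborel. gp (0 + Y * z) * of_real (\<bar>Y - (0 + Y * z)\<bar> powr (w - 1) + \<bar>Y + (0 + Y * z)\<bar> powr (w - 1)))
       = of_real Y * (LINT z|lborel. of_real (Y powr (w - 1)) * (gp (Y * z) * of_real (riesz w z)))"
      using Y by (simp add: scaleR_conv_of_real mult_ac)
    also have "\<dots> = of_real (Y * Y powr (w - 1)) * (LINT z|lborel. gp (Y * z) * of_real (riesz w z))"
      by (subst integral_mult_right_zero) simp
    also have "Y * Y powr (w - 1) = Y powr w" using Y by (simp add: powr_diff)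
    finally show ?thesis .
  qed
  finally have R: "(LINT v|lborel. \<phi> v * of_real (\<bar>y - v\<bar> powr (w - 1))) = of_real (Y powr w) * (LINT z|lborel. gp (Y * z) * of_real (riesz w z))" .
  define M where "M \<tau> = mellin g (Complex c \<tau>) * of_real Y powr (- Complex c \<tau>)" for \<tau>
  have M_int: "integrable lborel M" unfolding M_def by (rule mellin_inversion(2)[OF g Y])
  note [measurable] = borel_measurable_integrable[OF M_int]
  have gpM: "2 * of_real pi * gp (Y * z) = (LINT \<tau>|lborel. M \<tau> * cpow z (- Complex c \<tau>))" for z
  proof (cases "0 < z")
    case True
    then have "gp (Y * z) = g (Y * z)" using Y by (simp add: gp_def lift_abs_def absv_def)
    then have "2 * of_real pi * gp (Y * z) = (LINT \<tau>|lborel. mellin g (Complex c \<tau>) * of_real (Y * z) powr (- Complex c \<tau>))"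
      using mellin_inversion(1)[OF g, of "Y * z" c] True Y by simp
    also have "\<dots> = (LINT \<tau>|lborel. M \<tau> * cpow z (- Complex c \<tau>))"
    proof (intro Bochner_Integration.integral_cong refl)
      fix \<tau>
      have "complex_of_real (Y * z) powr (- Complex c \<tau>) = of_real Y powr (- Complex c \<tau>) * cpow z (- Complex c \<tau>)"
        using cpow_eq_powr[of "Y * z" "- Complex c \<tau>"] cpow_eq_powr[of Y "- Complex c \<tau>"] cpow_mult[of Y z "- Complex c \<tau>"] True Y by simp
      then show "mellin g (Complex c \<tau>) * of_real (Y * z) powr (- Complex c \<tau>) = M \<tau> * cpow z (- Complex c \<tau>)"
        by (simp add: M_def)
    qed
    finally show ?thesis .
  next
    case False
    then show ?thesis using Y by (simp add: gp_def zero_less_mult_iff)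
  qed
  note MR = mellin_riesz[OF w(1), of "Complex c _"]
  \<comment> \<open>The modulus of \<open>cpow z (- Complex c \<tau>)\<close> does not depend on
    \<tau>, so a product dominates the integrand.\<close>
  have prod: "integrable (lborel \<Otimes>\<^sub>M lborel) (\<lambda>(z, \<tau>). M \<tau> * cpow z (- Complex c \<tau>) * of_real (riesz w z))"
  proof (rule integrable_pair_bound[where u = "\<lambda>z. norm (cpow z (- Complex c 0) * of_real (riesz w z))" and w = "\<lambda>\<tau>. norm (M \<tau>)"])
    show "integrable lborel (\<lambda>z. norm (cpow z (- Complex c 0) * of_real (riesz w z)))"
      using MR[of 0] w c by (intro integrable_norm) (simp add: has_bochner_integral_iff)
    show "integrable lborel (\<lambda>\<tau>. norm (M \<tau>))" using M_int by (rule integrable_norm)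
  qed (auto simp: norm_mult norm_cpow)
  have "2 * of_real pi * (LINT z|lborel. gp (Y * z) * of_real (riesz w z)) = (LINT z|lborel. (2 * of_real pi * gp (Y * z)) * of_real (riesz w z))"
    by (simp add: mult.assoc)
  also have "\<dots> = (LINT z|lborel. LINT \<tau>|lborel. M \<tau> * cpow z (- Complex c \<tau>) * of_real (riesz w z))"
    unfolding gpM by simp
  also have "\<dots> = (LINT \<tau>|lborel. LINT z|lborel. M \<tau> * cpow z (- Complex c \<tau>) * of_real (riesz w z))"
    by (rule lborel_pair.Fubini_integral[OF prod, symmetric])
  also have "\<dots> = (LINT \<tau>|lborel. M \<tau> * (\<Gamma>\<^sub>r (of_real w) * \<Gamma>\<^sub>r (1 - Complex c \<tau>) * \<Gamma>\<^sub>r (Complex c \<tau> - of_real w)))"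
  proof (intro Bochner_Integration.integral_cong refl)
    fix \<tau>
    show "(LINT z|lborel. M \<tau> * cpow z (- Complex c \<tau>) * of_real (riesz w z)) = M \<tau> * (\<Gamma>\<^sub>r (of_real w) * \<Gamma>\<^sub>r (1 - Complex c \<tau>) * \<Gamma>\<^sub>r (Complex c \<tau> - of_real w))"
      using MR[of \<tau>] w c unfolding mult.assoc[of "M \<tau>"] integral_mult_right_zero by (simp add: has_bochner_integral_iff)
  qed
  finally have S: "2 * of_real pi * (LINT z|lborel. gp (Y * z) * of_real (riesz w z)) = \<dots>" .
  have "2 * of_real pi * (LINT v|lborel. \<phi> v * of_real (\<bar>y - v\<bar> powr (w - 1))) = of_real (Y powr w) * (2 * of_real pi * (LINT z|lborel. gp (Y * z) * of_real (riesz w z)))"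
    unfolding R by (simp add: mult_ac)
  also have "\<dots> = (LINT \<tau>|lborel. of_real (Y powr w) * (M \<tau> * (\<Gamma>\<^sub>r (of_real w) * \<Gamma>\<^sub>r (1 - Complex c \<tau>) * \<Gamma>\<^sub>r (Complex c \<tau> - of_real w))))"
    unfolding S by (rule integral_mult_right_zero[symmetric])
  finally show ?thesis unfolding M_def Y_def by (simp add: mult_ac)
qed

text \<open>The factor \<open>\<Gamma>\<^sub>r w\<close> of the kernel has a pole at 0, but it
  equals \<open>L_real w / L_real (1 - w)\<close> and cancels against the constants of the Riesz
  potential. What remains is regular at \<open>w = 0\<close>.\<close>

lemma fourier_powr_mellin:
  assumes w: "0 < w" "w < c" and c: "c < 1" and y: "y \<noteq> 0"
  shows "2 * of_real pi * (LINT x|lborel. \<Phi> x * e (x * y) * of_real (\<bar>x\<bar> powr (- w)))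
    = (LINT \<tau>|lborel. mellin g (Complex c \<tau>) * of_real \<bar>y\<bar> powr (- Complex c \<tau>) *
         (exp (of_real w * of_real (ln \<bar>y\<bar>)) * \<Gamma>\<^sub>r (1 - Complex c \<tau>) * \<Gamma>\<^sub>r (Complex c \<tau> - of_real w)))"
proof -
  have w1: "w < 1" using w c by simp
  have L: "L_real w \<noteq> 0" "L_real (1 - w) \<noteq> 0" using L_real_pos[of w] L_real_pos[of "1 - w"] w c by auto
  have G: "of_real (L_real (1 - w)) * \<Gamma>\<^sub>r (of_real w) = of_real (L_real w)"
    using L L_real_eq[of w] L_real_eq[of "1 - w"] by (simp add: Gamma_local_def del: L_local.simps)
  have p: "exp (of_real w * complex_of_real (ln \<bar>y\<bar>)) = of_real (\<bar>y\<bar> powr w)"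
    using y by (simp add: powr_def exp_of_real flip: of_real_mult)
  let ?M = "\<lambda>\<tau>. mellin g (Complex c \<tau>) * of_real \<bar>y\<bar> powr (- Complex c \<tau>)"
  have "of_real (L_real w) * (2 * of_real pi * (LINT x|lborel. \<Phi> x * e (x * y) * of_real (\<bar>x\<bar> powr (- w))))
     = of_real (L_real (1 - w)) * (2 * of_real pi * (LINT v|lborel. \<phi> v * of_real (\<bar>y - v\<bar> powr (w - 1))))"
    using riesz_potential[OF w(1) w1, of y] by (simp add: mult_ac)
  also have "\<dots> = (LINT \<tau>|lborel. of_real (L_real (1 - w)) * (?M \<tau> *
      (of_real (\<bar>y\<bar> powr w) * (\<Gamma>\<^sub>r (of_real w) * \<Gamma>\<^sub>r (1 - Complex c \<tau>) * \<Gamma>\<^sub>r (Complex c \<tau> - of_real w)))))"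
    unfolding phi_riesz_mellin[OF w c y] by (rule integral_mult_right_zero[symmetric])
  also have "\<dots> = (LINT \<tau>|lborel. of_real (L_real w) * (?M \<tau> *
      (exp (of_real w * of_real (ln \<bar>y\<bar>)) * \<Gamma>\<^sub>r (1 - Complex c \<tau>) * \<Gamma>\<^sub>r (Complex c \<tau> - of_real w))))"
    unfolding p by (intro Bochner_Integration.integral_cong refl) (simp add: G[symmetric] mult_ac)
  also have "\<dots> = of_real (L_real w) * (LINT \<tau>|lborel. ?M \<tau> *
      (exp (of_real w * of_real (ln \<bar>y\<bar>)) * \<Gamma>\<^sub>r (1 - Complex c \<tau>) * \<Gamma>\<^sub>r (Complex c \<tau> - of_real w)))"
    by (rule integral_mult_right_zero)
  finally show ?thesis using L by simp
qed

text \<open>With \<open>l = |ln |x||\<close>, the inequality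
  \<open>|exp u - 1| \<le> |u| * exp |u|\<close> bounds the quotient by
  \<open>l * exp (w * l)\<close>. Then \<open>l \<le> 4 * exp (l / 4)\<close> and
  \<open>w \<le> 1 / 4\<close> give \<open>4 * exp (l / 2)\<close>, uniformly in
  \<open>w\<close>.\<close>

lemma powr_difference_quotient_bound:
  fixes x w :: real
  assumes x: "x \<noteq> 0" and w: "0 < w" "w \<le> 1 / 4"
  shows "\<bar>(\<bar>x\<bar> powr (- w) - 1) / w\<bar> \<le> 4 * (\<bar>x\<bar> powr (1 / 2) + \<bar>x\<bar> powr (- (1 / 2)))"
proof -
  define l where "l = \<bar>ln \<bar>x\<bar>\<bar>"
  have l: "0 \<le> l" by (simp add: l_def)
  have e1: "\<bar>exp u - 1\<bar> \<le> \<bar>u\<bar> * exp \<bar>u\<bar>" for u :: real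
  proof (cases "0 \<le> u")
    case True
    have "1 - u \<le> exp (- u)" using exp_ge_add_one_self[of "- u"] by simp
    then have "exp u * (1 - u) \<le> exp u * exp (- u)" by (intro mult_left_mono) auto
    also have "exp u * exp (- u) = 1" by (simp flip: exp_add)
    finally show ?thesis using True by (simp add: algebra_simps)
  next
    case False
    have "1 - exp u \<le> - u" using exp_ge_add_one_self[of u] by linarith
    also have "\<dots> \<le> - u * exp (- u)" using False mult_left_mono[of 1 "exp (- u)" "- u"] by simp
    finally show ?thesis using False by simp
  qed
  have A: "\<bar>\<bar>x\<bar> powr (- w) - 1\<bar> \<le> w * l * exp (w * l)"
    using e1[of "- w * ln \<bar>x\<bar>"] w x by (simp add: powr_def abs_mult l_def)
  have "\<bar>w\<bar> = w" using w by simp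
  then have "\<bar>(\<bar>x\<bar> powr (- w) - 1) / w\<bar> \<le> (w * l * exp (w * l)) / w"
    unfolding abs_divide using divide_right_mono[OF A, of w] w by simp
  also have "\<dots> = l * exp (w * l)" using w by simp
  also have "\<dots> \<le> (4 * exp (l / 4)) * exp (l / 4)"
  proof (rule mult_mono)
    have "l / 4 \<le> exp (l / 4)"
      by (rule order_trans[OF _ exp_ge_add_one_self[of "l / 4"]]) simp
    then show "l \<le> 4 * exp (l / 4)" by (simp add: pos_divide_le_eq mult.commute)
    show "exp (w * l) \<le> exp (l / 4)" using mult_right_mono[OF w(2) l] by simp
  qed auto
  also have "\<dots> = 4 * exp (l / 2)" by (simp flip: exp_add)
  also have "exp (l / 2) \<le> \<bar>x\<bar> powr (1 / 2) + \<bar>x\<bar> powr (- (1 / 2))"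
    using x by (cases "0 \<le> ln \<bar>x\<bar>") (auto simp: l_def powr_def)
  finally show ?thesis by simp
qed

lemma Lambda_vertical_measurable:
  assumes c: "0 < c" "c < 1"
  shows "(\<lambda>\<tau>. Lambda_local Real_Place (Complex c \<tau>)) \<in> borel_measurable borel"
proof -
  have cont: "continuous_on {s. 0 < Re s} L_log_deriv"
    by (rule holomorphic_on_imp_continuous_on[OF L_log_deriv_holomorphic])
  have "continuous_on UNIV (\<lambda>\<tau>. L_log_deriv (Complex c \<tau>) + L_log_deriv (1 - Complex c \<tau>))"
    by (intro continuous_intros continuous_on_compose2[OF cont])
       (use c in \<open>auto simp: Complex_eq intro!: continuous_intros\<close>)
  also have "(\<lambda>\<tau>. L_log_deriv (Complex c \<tau>) + L_log_deriv (1 - Complex c \<tau>)) = (\<lambda>\<tau>. Lambda_local Real_Place (Complex c \<tau>))"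
    using c by (intro ext Lambda_real(1)[symmetric]) auto
  finally show ?thesis by (rule borel_measurable_continuous_onI)
qed

text \<open>From both sides of \<open>fourier_powr_mellin\<close> the identity at
  \<open>w = 0\<close> is subtracted, that is, Fourier inversion on one side and Mellin inversion on
  the other. After division by \<open>w\<close> and passage to the limit the multiplier becomes
  \<open>- ln |x|\<close> and the symbol becomes \<open>ln |y| + \<Lambda> s\<close>.\<close>

lemma log_fourier_eq:
  assumes c: "0 < c" "c < 1" and y: "y \<noteq> 0"
  shows "W_at Real_Place c g y = minus_log_abs y * \<phi> y + (LINT x|lborel. minus_log_abs x * \<Phi> x * e (x * y))"
proof -
  define Y where "Y = \<bar>y\<bar>"
  have Y: "0 < Y" using y by (simp add: Y_def)
  have phiY: "\<phi> y = g Y" using y by (simp add: lift_abs_def absv_def Y_def)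
  define M where "M \<tau> = mellin g (Complex c \<tau>) * of_real Y powr (- Complex c \<tau>)" for \<tau>
  have M_int: "integrable lborel M" unfolding M_def by (rule mellin_inversion(2)[OF g Y])
  have M_val: "(LINT \<tau>|lborel. M \<tau>) = 2 * of_real pi * \<phi> y" unfolding M_def phiY by (rule mellin_inversion(1)[OF g Y])
  \<comment> \<open>\<open>c / 2\<close> is required by the bound for the symbol,
    \<open>1 / 4\<close> by the bound for the difference quotient of the power.\<close>
  define q where "q = min (c / 2) (1 / 4)"
  have q: "0 < q" "q \<le> c / 2" "q \<le> 1 / 4" using c by (auto simp: q_def)
  define X where "X n = q / real (Suc n)" for n
  have X: "0 < X n" "X n \<le> c / 2" "X n \<le> 1 / 4" "X n < c" "X n < 1" for n
  proof -
    have "X n \<le> q" using q by (simp add: X_def pos_divide_le_eq mult_le_cancel_left1)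
    moreover show "0 < X n" using q by (simp add: X_def)
    ultimately show "X n \<le> c / 2" "X n \<le> 1 / 4" "X n < c" "X n < 1" using q c by auto
  qed
  have X0: "X \<longlonglongrightarrow> 0" unfolding X_def by real_asymp
  note [measurable] = Lambda_vertical_measurable[OF c] borel_measurable_integrable[OF M_int]
  define F where "F w \<tau> = exp (of_real w * of_real (ln Y)) * \<Gamma>\<^sub>r (1 - Complex c \<tau>) * \<Gamma>\<^sub>r (Complex c \<tau> - of_real w)" for w \<tau>
  obtain K where K': "0 \<le> K" "\<And>\<tau> w. 0 < w \<Longrightarrow> w \<le> c / 2 \<Longrightarrow>
     norm ((exp (of_real w * of_real (ln Y)) * \<Gamma>\<^sub>r (1 - Complex c \<tau>) * \<Gamma>\<^sub>r (Complex c \<tau> - of_real w) - 1) / of_real w) \<le> K * (1 + \<bar>\<tau>\<bar>)"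
    by (rule riesz_symbol_bound[OF c, of Y], rule that) assumption+
  note K = K'[folded F_def]
  define Q where "Q w x = (\<bar>x\<bar> powr (- w) - 1) / w" for w x :: real
  have Phie_int: "integrable lborel (\<lambda>x. \<Phi> x * e (x * y))"
    by (rule Bochner_Integration.integrable_bound[OF Phi_integrable]) (auto simp: norm_mult)
  have Phiw_int: "integrable lborel (\<lambda>x. \<Phi> x * e (x * y) * of_real (\<bar>x\<bar> powr (- X n)))" for n
    by (rule Bochner_Integration.integrable_bound[OF Phi_powr_integrable[of "- X n"]])
       (use X[of n] in \<open>auto simp: norm_mult\<close>)
  have cont_GF: "(\<lambda>\<tau>. F (X n) \<tau>) \<in> borel_measurable borel" for n
  proof -
    have cg: "continuous_on {s. 0 < Re s \<and> Re s < 1} \<Gamma>\<^sub>r"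
      by (rule DERIV_continuous_on[OF has_field_derivative_at_within[OF Lambda_real(2)]]) auto
    have "continuous_on UNIV (F (X n))"
      unfolding F_def[abs_def]
      by (intro continuous_intros continuous_on_compose2[OF cg])
         (use c X[of n] in \<open>auto simp: Complex_eq intro!: continuous_intros\<close>)
    then show ?thesis by (rule borel_measurable_continuous_onI)
  qed
  note [measurable] = cont_GF
  have dom: "integrable lborel (\<lambda>\<tau>. norm (M \<tau>) * (K * (1 + \<bar>\<tau>\<bar>)))"
  proof -
    have "integrable lborel (\<lambda>\<tau>. mellin g (Complex c \<tau>) * (of_real Y powr (- Complex c \<tau>) * of_real (K * (1 + \<bar>\<tau>\<bar>))))"
    proof (rule integrable_vertical_mellin_mult[OF g, where B = "Y powr (- c) * K"])
      have "(\<lambda>\<tau>. complex_of_real Y powr (- Complex c \<tau>)) = (\<lambda>\<tau>. cpow Y (- Complex c \<tau>))"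
        using Y by (simp add: cpow_eq_powr)
      then have [measurable]: "(\<lambda>\<tau>. complex_of_real Y powr (- Complex c \<tau>)) \<in> borel_measurable borel"
        by simp
      show "(\<lambda>\<tau>. complex_of_real Y powr (- Complex c \<tau>) * of_real (K * (1 + \<bar>\<tau>\<bar>))) \<in> borel_measurable borel"
        by measurable
      show "norm (complex_of_real Y powr (- Complex c \<tau>) * of_real (K * (1 + \<bar>\<tau>\<bar>))) \<le> Y powr (- c) * K * (1 + \<bar>\<tau>\<bar>)" for \<tau>
        using Y K by (simp add: norm_mult norm_powr_real_powr abs_mult del: of_real_mult of_real_add)
    qed
    from integrable_norm[OF this] show ?thesis
      using K by (simp add: M_def norm_mult abs_mult mult_ac del: of_real_mult of_real_add)
  qed
  have eq: "2 * of_real pi * (LINT x|lborel. \<Phi> x * e (x * y) * of_real (Q (X n) x)) = (LINT \<tau>|lborel. M \<tau> * ((F (X n) \<tau> - 1) / of_real (X n)))" for n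
  proof -
    have Xn: "complex_of_real (X n) \<noteq> 0" using X(1)[of n] by simp
    \<comment> \<open>Integrability is recovered from the dominated quotient: \<open>M * F\<close>
      is \<open>M\<close> plus \<open>X n\<close> times the quotient integrand.\<close>
    have MF_int: "integrable lborel (\<lambda>\<tau>. M \<tau> * F (X n) \<tau>)"
    proof -
      have "integrable lborel (\<lambda>\<tau>. M \<tau> * ((F (X n) \<tau> - 1) / of_real (X n)))"
      proof (rule Bochner_Integration.integrable_bound[OF dom])
        show "AE \<tau> in lborel. norm (M \<tau> * ((F (X n) \<tau> - 1) / of_real (X n))) \<le> norm (norm (M \<tau>) * (K * (1 + \<bar>\<tau>\<bar>)))"
        proof (rule AE_I2)
          fix \<tau>
          have "norm (M \<tau>) * norm ((F (X n) \<tau> - 1) / of_real (X n)) \<le> norm (M \<tau>) * (K * (1 + \<bar>\<tau>\<bar>))"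
            by (intro mult_left_mono K X) auto
          then show "norm (M \<tau> * ((F (X n) \<tau> - 1) / of_real (X n))) \<le> norm (norm (M \<tau>) * (K * (1 + \<bar>\<tau>\<bar>)))"
            unfolding norm_mult[of "M \<tau>"] real_norm_def by (rule order_trans[OF _ abs_ge_self])
        qed
      qed measurable
      then have "integrable lborel (\<lambda>\<tau>. of_real (X n) * (M \<tau> * ((F (X n) \<tau> - 1) / of_real (X n))) + M \<tau>)"
        by (intro Bochner_Integration.integrable_add integrable_mult_right M_int)
      moreover have "x * (m * ((f - 1) / x)) + m = m * f" if "x \<noteq> 0" for x m f :: complex
        using that by (simp add: field_simps)
      ultimately show ?thesis using Xn by (simp only: not_False_eq_True)
    qed
    have "2 * of_real pi * (LINT x|lborel. \<Phi> x * e (x * y) * of_real (Q (X n) x))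
       = 2 * of_real pi * (LINT x|lborel. (1 / of_real (X n)) * (\<Phi> x * e (x * y) * of_real (\<bar>x\<bar> powr (- X n)) - \<Phi> x * e (x * y)))"
    proof -
      have "\<Phi> x * e (x * y) * of_real (Q (X n) x) = (1 / of_real (X n)) * (\<Phi> x * e (x * y) * of_real (\<bar>x\<bar> powr (- X n)) - \<Phi> x * e (x * y))" for x
        by (simp add: Q_def diff_divide_distrib algebra_simps)
      then show ?thesis by (simp only:)
    qed
    also have "\<dots> = (1 / of_real (X n)) * (2 * of_real pi * (LINT x|lborel. \<Phi> x * e (x * y) * of_real (\<bar>x\<bar> powr (- X n))) - 2 * of_real pi * \<phi> y)"
      unfolding integral_mult_right_zero Bochner_Integration.integral_diff[OF Phiw_int Phie_int] fourier_inversion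
      by (simp add: right_diff_distrib)
    also have "\<dots> = (1 / of_real (X n)) * ((LINT \<tau>|lborel. M \<tau> * F (X n) \<tau>) - (LINT \<tau>|lborel. M \<tau>))"
      unfolding M_val fourier_powr_mellin[OF X(1) X(4) c(2) y] by (simp add: M_def F_def Y_def)
    also have "\<dots> = (LINT \<tau>|lborel. (1 / of_real (X n)) * (M \<tau> * F (X n) \<tau> - M \<tau>))"
      unfolding integral_mult_right_zero Bochner_Integration.integral_diff[OF MF_int M_int] ..
    also have "\<dots> = (LINT \<tau>|lborel. M \<tau> * ((F (X n) \<tau> - 1) / of_real (X n)))"
      by (rule Bochner_Integration.integral_cong[OF refl]) (simp add: algebra_simps diff_divide_distrib)
    finally show ?thesis .
  qed
  have lim1: "(\<lambda>n. LINT x|lborel. \<Phi> x * e (x * y) * of_real (Q (X n) x)) \<longlonglongrightarrow> (LINT x|lborel. \<Phi> x * e (x * y) * of_real (- ln \<bar>x\<bar>))"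
  proof (rule integral_dominated_convergence[where w = "\<lambda>x. 4 * (norm (\<Phi> x) * \<bar>x\<bar> powr (1 / 2) + norm (\<Phi> x) * \<bar>x\<bar> powr (- (1 / 2)))"])
    show "integrable lborel (\<lambda>x. 4 * (norm (\<Phi> x) * \<bar>x\<bar> powr (1 / 2) + norm (\<Phi> x) * \<bar>x\<bar> powr (- (1 / 2))))"
      by (intro integrable_mult_right Bochner_Integration.integrable_add Phi_powr_integrable) auto
    show "AE x in lborel. (\<lambda>n. \<Phi> x * e (x * y) * of_real (Q (X n) x)) \<longlonglongrightarrow> \<Phi> x * e (x * y) * of_real (- ln \<bar>x\<bar>)"
      using AE_lborel_neq[of 0]
    proof eventually_elim
      case (elim x)
      have "((\<lambda>w. \<bar>x\<bar> powr (- w)) has_real_derivative - ln \<bar>x\<bar>) (at 0)"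
        using elim by (auto intro!: derivative_eq_intros)
      then have "((\<lambda>w. Q w x) \<longlongrightarrow> - ln \<bar>x\<bar>) (at 0)"
        using elim by (simp add: DERIV_def Q_def)
      moreover have "filterlim X (at 0) sequentially"
        using X0 X(1) by (auto simp: filterlim_at intro!: always_eventually) (metis less_irrefl)
      ultimately have "(\<lambda>n. Q (X n) x) \<longlonglongrightarrow> - ln \<bar>x\<bar>" by (rule filterlim_compose)
      then show ?case by (intro tendsto_intros)
    qed
    show "AE x in lborel. norm (\<Phi> x * e (x * y) * of_real (Q (X n) x)) \<le> 4 * (norm (\<Phi> x) * \<bar>x\<bar> powr (1 / 2) + norm (\<Phi> x) * \<bar>x\<bar> powr (- (1 / 2)))" for n
      using AE_lborel_neq[of 0]
    proof eventually_elim
      case (elim x)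
      have "norm (\<Phi> x) * \<bar>Q (X n) x\<bar> \<le> norm (\<Phi> x) * (4 * (\<bar>x\<bar> powr (1 / 2) + \<bar>x\<bar> powr (- (1 / 2))))"
        unfolding Q_def by (intro mult_left_mono powr_difference_quotient_bound elim X) auto
      then show ?case by (simp add: norm_mult algebra_simps)
    qed
  qed (auto simp: Q_def[abs_def])
  have lim2: "(\<lambda>n. LINT \<tau>|lborel. M \<tau> * ((F (X n) \<tau> - 1) / of_real (X n))) \<longlonglongrightarrow> (LINT \<tau>|lborel. M \<tau> * (of_real (ln Y) + Lambda_local Real_Place (Complex c \<tau>)))"
    and int2: "integrable lborel (\<lambda>\<tau>. M \<tau> * (of_real (ln Y) + Lambda_local Real_Place (Complex c \<tau>)))"
  proof -
    have meas: "(\<lambda>\<tau>. M \<tau> * (of_real (ln Y) + Lambda_local Real_Place (Complex c \<tau>))) \<in> borel_measurable lborel"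
      "\<And>n. (\<lambda>\<tau>. M \<tau> * ((F (X n) \<tau> - 1) / of_real (X n))) \<in> borel_measurable lborel"
      by measurable
    have lim: "AE \<tau> in lborel. (\<lambda>n. M \<tau> * ((F (X n) \<tau> - 1) / of_real (X n))) \<longlonglongrightarrow> M \<tau> * (of_real (ln Y) + Lambda_local Real_Place (Complex c \<tau>))"
      unfolding F_def using c by (intro AE_I2 tendsto_mult tendsto_const riesz_symbol_limit X0 X) auto
    have bnd: "\<And>n. AE \<tau> in lborel. norm (M \<tau> * ((F (X n) \<tau> - 1) / of_real (X n))) \<le> norm (M \<tau>) * (K * (1 + \<bar>\<tau>\<bar>))"
      unfolding norm_mult[of "M _"] by (intro AE_I2 mult_left_mono K X) auto
    show "(\<lambda>n. LINT \<tau>|lborel. M \<tau> * ((F (X n) \<tau> - 1) / of_real (X n))) \<longlonglongrightarrow> (LINT \<tau>|lborel. M \<tau> * (of_real (ln Y) + Lambda_local Real_Place (Complex c \<tau>)))"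
      by (rule integral_dominated_convergence[OF meas dom lim bnd])
    show "integrable lborel (\<lambda>\<tau>. M \<tau> * (of_real (ln Y) + Lambda_local Real_Place (Complex c \<tau>)))"
      by (rule integrable_dominated_convergence[OF meas dom lim bnd])
  qed
  have "2 * of_real pi * (LINT x|lborel. \<Phi> x * e (x * y) * of_real (- ln \<bar>x\<bar>)) = (LINT \<tau>|lborel. M \<tau> * (of_real (ln Y) + Lambda_local Real_Place (Complex c \<tau>)))"
    by (rule LIMSEQ_unique[OF _ lim2]) (unfold eq[symmetric], intro tendsto_mult tendsto_const lim1)
  \<comment> \<open>Splitting off \<open>ln Y * M\<close>, whose integral is known by Mellin
    inversion, isolates \<Lambda>; moved to the other side it becomes the summand
    \<open>minus_log_abs y * \<phi> y\<close>.\<close>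
  also have "\<dots> = (LINT \<tau>|lborel. of_real (ln Y) * M \<tau> + (M \<tau> * (of_real (ln Y) + Lambda_local Real_Place (Complex c \<tau>)) - of_real (ln Y) * M \<tau>))"
    by simp
  also have "\<dots> = of_real (ln Y) * (2 * of_real pi * \<phi> y) + (LINT \<tau>|lborel. M \<tau> * (of_real (ln Y) + Lambda_local Real_Place (Complex c \<tau>)) - of_real (ln Y) * M \<tau>)"
    by (subst Bochner_Integration.integral_add[OF integrable_mult_right[OF M_int] Bochner_Integration.integrable_diff[OF int2 integrable_mult_right[OF M_int]]])
       (simp only: integral_mult_right_zero M_val)
  also have "(LINT \<tau>|lborel. M \<tau> * (of_real (ln Y) + Lambda_local Real_Place (Complex c \<tau>)) - of_real (ln Y) * M \<tau>)
      = (LINT \<tau>|lborel. Lambda_local Real_Place (Complex c \<tau>) * M \<tau>)"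
    by (simp add: algebra_simps)
  finally have main: "2 * of_real pi * (LINT x|lborel. \<Phi> x * e (x * y) * of_real (- ln \<bar>x\<bar>))
     = of_real (ln Y) * (2 * of_real pi * \<phi> y) + (LINT \<tau>|lborel. Lambda_local Real_Place (Complex c \<tau>) * M \<tau>)" .
  have "W_at Real_Place c g y = 1 / (2 * of_real pi * \<i>) * (LINT \<tau>|lborel. Lambda_local Real_Place (Complex c \<tau>) * M \<tau> * \<i>)"
    by (simp add: W_at_def vertical_integral_def M_def Y_def absv_def mult.assoc)
  also have "\<dots> = 1 / (2 * of_real pi) * (LINT \<tau>|lborel. Lambda_local Real_Place (Complex c \<tau>) * M \<tau>)"
    by simp
  also have "\<dots> = (LINT x|lborel. \<Phi> x * e (x * y) * of_real (- ln \<bar>x\<bar>)) - of_real (ln Y) * \<phi> y"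
    using main by (simp add: field_simps)
  also have "\<dots> = minus_log_abs y * \<phi> y + (LINT x|lborel. minus_log_abs x * \<Phi> x * e (x * y))"
    by (simp add: minus_log_abs_def absv_def Y_def mult_ac)
  finally show ?thesis .
qed

lemma inverse_fourier_eq: "inverse_fourier lborel e \<phi> x = \<Phi> x"
  by (simp add: inverse_fourier_def \<Phi>_def)

text \<open>The substitution \<open>u = y - v\<close> turns the transform of the reflected translate
  into \<open>\<Phi> x * e (x * y)\<close>, so the convolution coincides with the Fourier transform
  already computed.\<close>

lemma distribution_conv_eq:
  "distribution_conv (G_dist lborel e) \<phi> y = (LINT x|lborel. minus_log_abs x * \<Phi> x * e (x * y))"
proof -
  have "fourier lborel e (\<lambda>u. \<phi> (y - u)) x = \<Phi> x * e (x * y)" for x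
  proof -
    have "fourier lborel e (\<lambda>u. \<phi> (y - u)) x = (LINT v|lborel. \<phi> (y - (y + (-1) * v)) * e ((y + (-1) * v) * x))"
      unfolding fourier_def by (subst lborel_integral_real_affine[where c = "-1" and t = y]) simp_all
    also have "\<dots> = (LINT v|lborel. \<phi> v * e (- (x * v)) * e (x * y))"
      using e_add[of "- (x * _)" "x * y"] by (intro Bochner_Integration.integral_cong refl) (simp add: algebra_simps)
    finally show ?thesis by (simp add: \<Phi>_def)
  qed
  then show ?thesis
    unfolding distribution_conv_def G_dist_def distribution_fourier_def distribution_of_def by (simp add: mult.assoc)
qed

lemma W_at_real_eq:
  assumes c: "0 < c" "c < 1" and y: "y \<noteq> 0"
  shows "W_at Real_Place c g y = minus_log_abs y * \<phi> y + fourier lborel e (\<lambda>x. minus_log_abs x * inverse_fourier lborel e \<phi> x) y"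
    and "W_at Real_Place c g y = minus_log_abs y * \<phi> y + distribution_conv (G_dist lborel e) \<phi> y"
  using log_fourier_eq[OF c y] unfolding inverse_fourier_eq distribution_conv_eq by (simp_all add: fourier_def)

end

section \<open>From the two kinds of place to the theorem\<close>

lemma standard_real_characterE:
  assumes "is_standard_real_character \<psi>"
  obtains \<kappa> where "\<kappa>\<^sup>2 = 4 * pi\<^sup>2" "\<psi> = (\<lambda>x. exp (\<i> * of_real (\<kappa> * x)))"
proof -
  from assms consider "\<psi> = (\<lambda>x. exp (\<i> * of_real ((2 * pi) * x)))" | "\<psi> = (\<lambda>x. exp (\<i> * of_real ((- (2 * pi)) * x)))"
    unfolding is_standard_real_character_def by (auto simp: mult_ac)
  then show ?thesis
    by cases (rule that[of "2 * pi"] that[of "- (2 * pi)"]; simp add: power_mult_distrib)+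
qed

theorem mainTheorem1:
  fixes g :: "real \<Rightarrow> complex" and c :: real
  assumes "is_test_function g" and "0 < c" and "c < 1"
  shows
    "(\<forall>\<psi>. is_standard_real_character \<psi> \<longrightarrow>
        (\<forall>y::real. y \<noteq> 0 \<longrightarrow>
           W_at Real_Place c g y =
             minus_log_abs y * lift_abs g y +
             fourier lborel \<psi> (\<lambda>x. minus_log_abs x * inverse_fourier lborel \<psi> (lift_abs g) x) y \<and>
           W_at Real_Place c g y =
             minus_log_abs y * lift_abs g y +
             distribution_conv (G_dist lborel \<psi>) (lift_abs g) y) \<and>
        W_local Real_Place g = W_at Real_Place c g (1::real) \<and>
        W_local Real_Place g = distribution_conv (G_dist lborel \<psi>) (lift_abs g) 1) \<and>
     (\<forall>p (\<mu> :: 'a::{field_char_0, complete_space} measure) \<psi>.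
        prime p \<and> is_padic_completion p TYPE('a) \<and>
        is_normalized_haar \<mu> \<and> is_standard_padic_character \<psi> \<longrightarrow>
        (\<forall>y::'a. y \<noteq> 0 \<longrightarrow>
           W_at (Prime_Place p) c g y =
             minus_log_abs y * lift_abs g y +
             fourier \<mu> \<psi> (\<lambda>x. minus_log_abs x * inverse_fourier \<mu> \<psi> (lift_abs g) x) y \<and>
           W_at (Prime_Place p) c g y =
             minus_log_abs y * lift_abs g y +
             distribution_conv (G_dist \<mu> \<psi>) (lift_abs g) y) \<and>
        W_local (Prime_Place p) g = W_at (Prime_Place p) c g (1::'a) \<and>
        W_local (Prime_Place p) g = distribution_conv (G_dist \<mu> \<psi>) (lift_abs g) 1)"
proof (intro conjI allI impI)
  fix \<psi> assume "is_standard_real_character \<psi>"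
  then obtain \<kappa> where kappa: "\<kappa>\<^sup>2 = 4 * pi\<^sup>2" and psi: "\<psi> = (\<lambda>x. exp (\<i> * of_real (\<kappa> * x)))"
    by (rule standard_real_characterE)
  interpret real_fourier g \<kappa> by unfold_locales (rule assms(1), rule kappa)
  have psi_e: "\<psi> = e" by (simp add: psi e_def[abs_def])
  note W = W_at_real_eq[OF assms(2,3)]
  show loc: "W_local Real_Place g = W_at Real_Place c g (1::real)" by (rule W_local_real[OF assms])
  \<comment> \<open>At \<open>y = 1\<close> the logarithmic summand is 0, so only the convolution
    remains.\<close>
  show "W_local Real_Place g = distribution_conv (G_dist lborel \<psi>) (lift_abs g) 1"
    unfolding loc psi_e using W(2)[of 1] by (simp add: minus_log_abs_def absv_def)
  fix y :: real assume y: "y \<noteq> 0"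
  show "W_at Real_Place c g y = minus_log_abs y * lift_abs g y + fourier lborel \<psi> (\<lambda>x. minus_log_abs x * inverse_fourier lborel \<psi> (lift_abs g) x) y"
    unfolding psi_e by (rule W(1)[OF y])
  show "W_at Real_Place c g y = minus_log_abs y * lift_abs g y + distribution_conv (G_dist lborel \<psi>) (lift_abs g) y"
    unfolding psi_e by (rule W(2)[OF y])
next
  fix p and \<mu> :: "'a measure" and \<psi> :: "'a \<Rightarrow> complex"
  assume "prime p \<and> is_padic_completion p TYPE('a) \<and> is_normalized_haar \<mu> \<and> is_standard_padic_character \<psi>"
  then interpret padic_field p \<mu> \<psi> by unfold_locales auto
  show "W_local (Prime_Place p) g = W_at (Prime_Place p) c g (1::'a)"
    and "W_local (Prime_Place p) g = distribution_conv (G_dist \<mu> \<psi>) (lift_abs g) 1"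
    by (rule W_local_eq[OF assms])+
  fix y :: 'a assume y: "y \<noteq> 0"
  show "W_at (Prime_Place p) c g y = minus_log_abs y * lift_abs g y + fourier \<mu> \<psi> (\<lambda>x. minus_log_abs x * inverse_fourier \<mu> \<psi> (lift_abs g) x) y"
    and "W_at (Prime_Place p) c g y = minus_log_abs y * lift_abs g y + distribution_conv (G_dist \<mu> \<psi>) (lift_abs g) y"
    by (rule W_at_eq[OF assms y])+
qed

end
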